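(* Let $g$ be a left invariant pseudo-Riemannian metric on $SU(2)$, let $\langle\cdot,\cdot\rangle$ be the biinvariant Riemannian metric on $SU(2)$ with constant sectional curvature $1$, and let $A:\mathfrak{su}(2)\to\mathfrak{su}(2)$ be the $\langle\cdot,\cdot\rangle$-self-adjoint linear transformation with $g(x,y)=\langle Ax,y\rangle$ for $x,y\in\mathfrak{su}(2)$. Let $\lambda_1\le\lambda_2\le\lambda_3$ be the eigenvalues of $A$ (with multiplicity). Call $g$ generic if $\lambda_1<\lambda_2<\lambda_3$, and special if at least one of the inequalities $\lambda_1\le\lambda_2\le\lambda_3$ is an equality. (a) If $g$ is generic, then it is not $\mathbb{C}$-complete. (b) If $g$ is special, then it is $\mathcal P$-complete.
   Context: For $v\in TG$, $G=SU(2)$, let $\gamma_v:I_v\to G$ be the maximal geodesic of the Levi-Civita connection of $g$ with $\dot\gamma_v(0)=v$. Let $\eta:SU(2)\to SL(2,\mathbb{C})$ be the universal complexification (the inclusion). The metric $g$ is called $\mathbb{C}$-complete if for every $v\in TG$ the curve $\eta\circ\gamma_v$ extends holomorphically to a map $\mathbb{C}\to SL(2,\mathbb C)$. Let $\mathbb{C}I_v=\{t+is:t\in I_v,\ s\in\mathbb R\}$ and $\Omega_v:\mathbb{C}I_v\to TG$, $\Omega_v(t+is)=s\dot\gamma_v(t)$. A polarization on an even-dimensional smooth manifold $X$ is a smooth complex subbundle $P\subset\mathbb{C}TX$ closed under Lie brackets of local smooth sections with $\operatorname{rank}_{\mathbb C}P=\frac12\dim X$. An ac-polarization on $TG$ is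 a polarization $P$ on the manifold $TG$ with $(\Omega_v)_*(T^{1,0}(\mathbb{C}I_v))\subset P$ for all $v\in TG$. The metric $g$ is $\mathcal P$-complete if an ac-polarization exists on $TG$. *)

theory Defs
  imports "HOL-Analysis.Analysis"
begin

section \<open>Calculus on embedded submanifolds of a Euclidean space\<close>

text \<open>Manifolds are given as subsets \<open>X\<close> of a Euclidean space. They are used here only for
  the group \<open>SU(2)\<close>, embedded in the complex two by two matrices, and for its tangent bundle, both
  of which are embedded submanifolds.  A tensor or vector field on \<open>X\<close> is a function on the
  ambient space of which only the values at points of \<open>X\<close> (and at tangent vectors) matter.\<close>

primrec Ck_on :: "nat \<Rightarrow> 'a::euclidean_space set \<Rightarrow> ('a \<Rightarrow> 'b::euclidean_space) \<Rightarrow> bool" where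
  "Ck_on 0 U f \<longleftrightarrow> continuous_on U f"
| "Ck_on (Suc k) U f \<longleftrightarrow> (\<forall>x\<in>U. f differentiable (at x)) \<and>
     (\<forall>v. Ck_on k U (\<lambda>x. frechet_derivative f (at x) v))"

text \<open>Meant for open \<open>U\<close>.\<close>

definition smooth_on :: "'a::euclidean_space set \<Rightarrow> ('a \<Rightarrow> 'b::euclidean_space) \<Rightarrow> bool" where
  "smooth_on U f \<longleftrightarrow> (\<forall>k. Ck_on k U f)"

text \<open>Smoothness on an arbitrary subset: locally the restriction of an ambient smooth map.\<close>

definition smooth_map :: "'a::euclidean_space set \<Rightarrow> ('a \<Rightarrow> 'b::euclidean_space) \<Rightarrow> bool" where
  "smooth_map S f \<longleftrightarrow> (\<forall>p\<in>S. \<exists>U F. open U \<and> p \<in> U \<and> smooth_on U F \<and> (\<forall>q\<in>U \<inter> S. F q = f q))"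

definition tangent_space :: "'a::euclidean_space set \<Rightarrow> 'a \<Rightarrow> 'a set" where
  "tangent_space X p = {v. \<exists>e c. e > 0 \<and> smooth_on {-e<..<e} c \<and> c ` {-e<..<e} \<subseteq> X \<and>
     c (0::real) = p \<and> (c has_vector_derivative v) (at 0)}"

definition tangent_bundle :: "'a::euclidean_space set \<Rightarrow> ('a \<times> 'a) set" where
  "tangent_bundle X = {(p, v). p \<in> X \<and> v \<in> tangent_space X p}"

definition vector_field :: "'a::euclidean_space set \<Rightarrow> ('a \<Rightarrow> 'a) \<Rightarrow> bool" where
  "vector_field S V \<longleftrightarrow> smooth_map S V \<and> (\<forall>p\<in>S. V p \<in> tangent_space S p)"

text \<open>The Frechet derivative of a map within a submanifold is not unique as a linear map on the
  ambient space, but its values at vectors tangent to the submanifold are: they are the values of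
  the differential of the map.  It is applied to tangent vectors only.\<close>

definition lie_bracket :: "'a::euclidean_space set \<Rightarrow> ('a \<Rightarrow> 'a) \<Rightarrow> ('a \<Rightarrow> 'a) \<Rightarrow> 'a \<Rightarrow> 'a" where
  "lie_bracket S V W p =
     frechet_derivative W (at p within S) (V p) - frechet_derivative V (at p within S) (W p)"


section \<open>Pseudo-Riemannian metrics, Levi-Civita connection, geodesics\<close>

definition pseudo_riemannian :: "'a::euclidean_space set \<Rightarrow> ('a \<Rightarrow> 'a \<Rightarrow> 'a \<Rightarrow> real) \<Rightarrow> bool" where
  "pseudo_riemannian X g \<longleftrightarrow>
     (\<forall>p\<in>X. \<forall>x\<in>tangent_space X p. \<forall>y\<in>tangent_space X p. g p x y = g p y x) \<and>
     (\<forall>p\<in>X. \<forall>x\<in>tangent_space X p. \<forall>y\<in>tangent_space X p. \<forall>z\<in>tangent_space X p. \<forall>a b.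
        g p (a *\<^sub>R x + b *\<^sub>R y) z = a * g p x z + b * g p y z) \<and>
     (\<forall>p\<in>X. \<forall>x\<in>tangent_space X p. (\<forall>y\<in>tangent_space X p. g p x y = 0) \<longrightarrow> x = 0) \<and>
     (\<forall>V W. vector_field X V \<and> vector_field X W \<longrightarrow> smooth_map X (\<lambda>p. g p (V p) (W p)))"

definition riemannian :: "'a::euclidean_space set \<Rightarrow> ('a \<Rightarrow> 'a \<Rightarrow> 'a \<Rightarrow> real) \<Rightarrow> bool" where
  "riemannian X g \<longleftrightarrow> pseudo_riemannian X g \<and>
     (\<forall>p\<in>X. \<forall>x\<in>tangent_space X p. x \<noteq> 0 \<longrightarrow> g p x x > 0)"

text \<open>A connection is written \<open>nabla p v Y\<close>: the covariant derivative at \<open>p\<close> of the vector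
  field \<open>Y\<close> in the direction of the tangent vector \<open>v\<close> at \<open>p\<close>.\<close>

definition affine_connection ::
    "'a::euclidean_space set \<Rightarrow> ('a \<Rightarrow> 'a \<Rightarrow> ('a \<Rightarrow> 'a) \<Rightarrow> 'a) \<Rightarrow> bool" where
  "affine_connection X nabla \<longleftrightarrow>
     (\<forall>V Y. vector_field X V \<and> vector_field X Y \<longrightarrow> vector_field X (\<lambda>p. nabla p (V p) Y)) \<and>
     (\<forall>p\<in>X. \<forall>v\<in>tangent_space X p. \<forall>w\<in>tangent_space X p. \<forall>a b Y. vector_field X Y \<longrightarrow>
        nabla p (a *\<^sub>R v + b *\<^sub>R w) Y = a *\<^sub>R nabla p v Y + b *\<^sub>R nabla p w Y) \<and>
     (\<forall>p\<in>X. \<forall>v\<in>tangent_space X p. \<forall>Y Z. vector_field X Y \<and> vector_field X Z \<longrightarrow>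
        nabla p v (\<lambda>q. Y q + Z q) = nabla p v Y + nabla p v Z) \<and>
     (\<forall>p\<in>X. \<forall>v\<in>tangent_space X p. \<forall>f Y. smooth_map X (f :: 'a \<Rightarrow> real) \<and> vector_field X Y \<longrightarrow>
        nabla p v (\<lambda>q. f q *\<^sub>R Y q) =
          frechet_derivative f (at p within X) v *\<^sub>R Y p + f p *\<^sub>R nabla p v Y)"

definition is_levi_civita :: "'a::euclidean_space set \<Rightarrow> ('a \<Rightarrow> 'a \<Rightarrow> 'a \<Rightarrow> real) \<Rightarrow>
    ('a \<Rightarrow> 'a \<Rightarrow> ('a \<Rightarrow> 'a) \<Rightarrow> 'a) \<Rightarrow> bool" where
  "is_levi_civita X g nabla \<longleftrightarrow> affine_connection X nabla \<and>
     (\<forall>V W. vector_field X V \<and> vector_field X W \<longrightarrow>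
        (\<forall>p\<in>X. nabla p (V p) W - nabla p (W p) V = lie_bracket X V W p)) \<and>
     (\<forall>p\<in>X. \<forall>v\<in>tangent_space X p. \<forall>Y Z. vector_field X Y \<and> vector_field X Z \<longrightarrow>
        frechet_derivative (\<lambda>q. g q (Y q) (Z q)) (at p within X) v =
          g p (nabla p v Y) (Z p) + g p (Y p) (nabla p v Z))"

text \<open>For a pseudo-Riemannian metric the value at points, tangent vectors and vector fields of
  \<open>X\<close> is unique; only the irrelevant remaining values are left to the choice.\<close>

definition levi_civita :: "'a::euclidean_space set \<Rightarrow> ('a \<Rightarrow> 'a \<Rightarrow> 'a \<Rightarrow> real) \<Rightarrow>
    'a \<Rightarrow> 'a \<Rightarrow> ('a \<Rightarrow> 'a) \<Rightarrow> 'a" where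
  "levi_civita X g = (SOME nabla. is_levi_civita X g nabla)"

definition riemann_curvature :: "'a::euclidean_space set \<Rightarrow> ('a \<Rightarrow> 'a \<Rightarrow> 'a \<Rightarrow> real) \<Rightarrow>
    ('a \<Rightarrow> 'a) \<Rightarrow> ('a \<Rightarrow> 'a) \<Rightarrow> ('a \<Rightarrow> 'a) \<Rightarrow> 'a \<Rightarrow> 'a" where
  "riemann_curvature X g V W Z p = (let nabla = levi_civita X g in
     nabla p (V p) (\<lambda>q. nabla q (W q) Z) - nabla p (W p) (\<lambda>q. nabla q (V q) Z)
     - nabla p (lie_bracket X V W p) Z)"

definition constant_sectional_curvature ::
    "'a::euclidean_space set \<Rightarrow> ('a \<Rightarrow> 'a \<Rightarrow> 'a \<Rightarrow> real) \<Rightarrow> real \<Rightarrow> bool" where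
  "constant_sectional_curvature X g K \<longleftrightarrow>
     (\<forall>V W. vector_field X V \<and> vector_field X W \<longrightarrow>
       (\<forall>p\<in>X. g p (V p) (V p) * g p (W p) (W p) - (g p (V p) (W p))\<^sup>2 \<noteq> 0 \<longrightarrow>
          g p (riemann_curvature X g V W W p) (V p) /
            (g p (V p) (V p) * g p (W p) (W p) - (g p (V p) (W p))\<^sup>2) = K))"

text \<open>The covariant derivative \<open>D\<close> at time \<open>t\<close> of a vector field \<open>V\<close> along the curve \<open>c\<close>: write
  \<open>V\<close> near \<open>t\<close> as a combination of restrictions to \<open>c\<close> of vector fields of \<open>X\<close>, and apply the
  product rule.  Such an expression exists, and \<open>D\<close> does not depend on it.\<close>

definition has_covariant_derivative :: "'a::euclidean_space set \<Rightarrow> ('a \<Rightarrow> 'a \<Rightarrow> ('a \<Rightarrow> 'a) \<Rightarrow> 'a) \<Rightarrow>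
    (real \<Rightarrow> 'a) \<Rightarrow> (real \<Rightarrow> 'a) \<Rightarrow> 'a \<Rightarrow> real \<Rightarrow> bool" where
  "has_covariant_derivative X nabla c V D t \<longleftrightarrow>
     (\<exists>(n::nat) (f :: nat \<Rightarrow> real \<Rightarrow> real) (Y :: nat \<Rightarrow> 'a \<Rightarrow> 'a) U.
        open U \<and> t \<in> U \<and> (\<forall>i<n. smooth_on U (f i)) \<and> (\<forall>i<n. vector_field X (Y i)) \<and>
        (\<forall>s\<in>U. V s = (\<Sum>i<n. f i s *\<^sub>R Y i (c s))) \<and>
        D = (\<Sum>i<n. deriv (f i) t *\<^sub>R Y i (c t)
               + f i t *\<^sub>R nabla (c t) (vector_derivative c (at t)) (Y i)))"

definition geodesic :: "'a::euclidean_space set \<Rightarrow> ('a \<Rightarrow> 'a \<Rightarrow> 'a \<Rightarrow> real) \<Rightarrow>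
    real set \<Rightarrow> (real \<Rightarrow> 'a) \<Rightarrow> bool" where
  "geodesic X g I c \<longleftrightarrow> open I \<and> is_interval I \<and> smooth_on I c \<and> c ` I \<subseteq> X \<and>
     (\<forall>t\<in>I. has_covariant_derivative X (levi_civita X g) c
              (\<lambda>s. vector_derivative c (at s)) 0 t)"

definition geodesic_from :: "'a::euclidean_space set \<Rightarrow> ('a \<Rightarrow> 'a \<Rightarrow> 'a \<Rightarrow> real) \<Rightarrow>
    'a \<times> 'a \<Rightarrow> real set \<Rightarrow> (real \<Rightarrow> 'a) \<Rightarrow> bool" where
  "geodesic_from X g v I c \<longleftrightarrow> geodesic X g I c \<and> 0 \<in> I \<and> c 0 = fst v \<and>
     vector_derivative c (at 0) = snd v"

text \<open>The maximal geodesic is the one of which all geodesics with the same initial velocity are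
  restrictions.  It is unique up to the values of \<open>c\<close> outside \<open>I\<close>.\<close>

definition maximal_geodesic :: "'a::euclidean_space set \<Rightarrow> ('a \<Rightarrow> 'a \<Rightarrow> 'a \<Rightarrow> real) \<Rightarrow>
    'a \<times> 'a \<Rightarrow> real set \<Rightarrow> (real \<Rightarrow> 'a) \<Rightarrow> bool" where
  "maximal_geodesic X g v I c \<longleftrightarrow> geodesic_from X g v I c \<and>
     (\<forall>J d. geodesic_from X g v J d \<longrightarrow> J \<subseteq> I \<and> (\<forall>t\<in>J. d t = c t))"


section \<open>Complexification and polarizations\<close>

text \<open>The complexification of a real vector space is modelled by pairs, \<open>(a, b)\<close> standing for
  \<open>a + ib\<close>.  The imaginary unit acts by \<open>cscale\<close>; it is unrelated to any complex structure
  the original space may have, as the complex matrices do.\<close>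

definition cscale :: "complex \<Rightarrow> 'a::real_vector \<times> 'a \<Rightarrow> 'a \<times> 'a" where
  "cscale z w = (Re z *\<^sub>R fst w - Im z *\<^sub>R snd w, Re z *\<^sub>R snd w + Im z *\<^sub>R fst w)"

definition complexify :: "('a \<Rightarrow> 'b) \<Rightarrow> 'a \<times> 'a \<Rightarrow> 'b \<times> 'b" where
  "complexify L w = (L (fst w), L (snd w))"

definition complex_tangent_space :: "'a::euclidean_space set \<Rightarrow> 'a \<Rightarrow> ('a \<times> 'a) set" where
  "complex_tangent_space X p = tangent_space X p \<times> tangent_space X p"

text \<open>Complex bilinear extension of the Lie bracket.\<close>

definition complex_lie_bracket :: "'a::euclidean_space set \<Rightarrow> ('a \<Rightarrow> 'a \<times> 'a) \<Rightarrow>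
    ('a \<Rightarrow> 'a \<times> 'a) \<Rightarrow> 'a \<Rightarrow> 'a \<times> 'a" where
  "complex_lie_bracket S V W p = (let B = (\<lambda>A C. lie_bracket S A C p) in
     (B (fst \<circ> V) (fst \<circ> W) - B (snd \<circ> V) (snd \<circ> W),
      B (fst \<circ> V) (snd \<circ> W) + B (snd \<circ> V) (fst \<circ> W)))"

definition local_section :: "'a::euclidean_space set \<Rightarrow> ('a \<Rightarrow> ('a \<times> 'a) set) \<Rightarrow>
    ('a \<Rightarrow> 'a \<times> 'a) \<Rightarrow> bool" where
  "local_section S P V \<longleftrightarrow> smooth_map S V \<and> (\<forall>q\<in>S. V q \<in> P q)"

text \<open>Smooth complex subbundle of the given complex rank, by local frames.\<close>

definition complex_subbundle :: "'a::euclidean_space set \<Rightarrow> nat \<Rightarrow> ('a \<Rightarrow> ('a \<times> 'a) set) \<Rightarrow> bool"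
  where
  "complex_subbundle X r P \<longleftrightarrow>
     (\<forall>p\<in>X. P p \<subseteq> complex_tangent_space X p) \<and>
     (\<forall>p\<in>X. \<exists>U (E :: nat \<Rightarrow> 'a \<Rightarrow> 'a \<times> 'a). open U \<and> p \<in> U \<and>
        (\<forall>j<r. local_section (U \<inter> X) P (E j)) \<and>
        (\<forall>q\<in>U \<inter> X.
           P q = range (\<lambda>z :: nat \<Rightarrow> complex. \<Sum>j<r. cscale (z j) (E j q)) \<and>
           (\<forall>z :: nat \<Rightarrow> complex. (\<Sum>j<r. cscale (z j) (E j q)) = 0 \<longrightarrow> (\<forall>j<r. z j = 0))))"

definition involutive :: "'a::euclidean_space set \<Rightarrow> ('a \<Rightarrow> ('a \<times> 'a) set) \<Rightarrow> bool" where
  "involutive X P \<longleftrightarrow> (\<forall>U V W. open U \<and> local_section (U \<inter> X) P V \<and> local_section (U \<inter> X) P W \<longrightarrow>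
     (\<forall>q\<in>U \<inter> X. complex_lie_bracket (U \<inter> X) V W q \<in> P q))"

definition polarization :: "'a::euclidean_space set \<Rightarrow> ('a \<Rightarrow> ('a \<times> 'a) set) \<Rightarrow> bool" where
  "polarization X P \<longleftrightarrow>
     (\<exists>r. (\<forall>p\<in>X. dim (tangent_space X p) = 2 * r) \<and> complex_subbundle X r P) \<and> involutive X P"

text \<open>The holomorphic tangent space of an open subset of the complex plane, as the
  \<open>i\<close>-eigenspace of the complexified complex structure.\<close>

definition T10 :: "(complex \<times> complex) set" where
  "T10 = {w. complexify (\<lambda>a. \<i> * a) w = cscale \<i> w}"

definition Omega :: "(real \<Rightarrow> 'a::euclidean_space) \<Rightarrow> complex \<Rightarrow> 'a \<times> 'a" where
  "Omega c z = (c (Re z), Im z *\<^sub>R vector_derivative c (at (Re z)))"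

definition ac_polarization :: "'a::euclidean_space set \<Rightarrow> ('a \<Rightarrow> 'a \<Rightarrow> 'a \<Rightarrow> real) \<Rightarrow>
    ('a \<times> 'a \<Rightarrow> (('a \<times> 'a) \<times> ('a \<times> 'a)) set) \<Rightarrow> bool" where
  "ac_polarization X g P \<longleftrightarrow> polarization (tangent_bundle X) P \<and>
     (\<forall>v\<in>tangent_bundle X. \<forall>I c. maximal_geodesic X g v I c \<longrightarrow>
        (\<forall>z. Re z \<in> I \<longrightarrow>
           complexify (frechet_derivative (Omega c) (at z)) ` T10 \<subseteq> P (Omega c z)))"

definition P_complete :: "'a::euclidean_space set \<Rightarrow> ('a \<Rightarrow> 'a \<Rightarrow> 'a \<Rightarrow> real) \<Rightarrow> bool" where
  "P_complete X g \<longleftrightarrow> (\<exists>P. ac_polarization X g P)"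


section \<open>The group SU(2)\<close>

type_synonym cmat2 = "complex^2^2"

definition adjoint_mat :: "cmat2 \<Rightarrow> cmat2" where
  "adjoint_mat U = (\<chi> i j. cnj (U $ j $ i))"

definition SU2 :: "cmat2 set" where
  "SU2 = {U. U ** adjoint_mat U = mat 1 \<and> det U = 1}"

definition su2 :: "cmat2 set" where
  "su2 = tangent_space SU2 (mat 1)"

definition SL2C :: "cmat2 set" where
  "SL2C = {U. det U = 1}"

definition left_invariant :: "(cmat2 \<Rightarrow> cmat2 \<Rightarrow> cmat2 \<Rightarrow> real) \<Rightarrow> bool" where
  "left_invariant g \<longleftrightarrow> (\<forall>h\<in>SU2. \<forall>p\<in>SU2. \<forall>x\<in>tangent_space SU2 p. \<forall>y\<in>tangent_space SU2 p.
     g (h ** p) (h ** x) (h ** y) = g p x y)"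

definition right_invariant :: "(cmat2 \<Rightarrow> cmat2 \<Rightarrow> cmat2 \<Rightarrow> real) \<Rightarrow> bool" where
  "right_invariant g \<longleftrightarrow> (\<forall>h\<in>SU2. \<forall>p\<in>SU2. \<forall>x\<in>tangent_space SU2 p. \<forall>y\<in>tangent_space SU2 p.
     g (p ** h) (x ** h) (y ** h) = g p x y)"

text \<open>The universal complexification is the inclusion of \<open>SU2\<close> in \<open>SL2C\<close>, so the geodesic
  itself is what has to be extended.\<close>

definition C_complete :: "(cmat2 \<Rightarrow> cmat2 \<Rightarrow> cmat2 \<Rightarrow> real) \<Rightarrow> bool" where
  "C_complete g \<longleftrightarrow> (\<forall>v\<in>tangent_bundle SU2. \<forall>I c. maximal_geodesic SU2 g v I c \<longrightarrow>
     (\<exists>F :: complex \<Rightarrow> cmat2. range F \<subseteq> SL2C \<and>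
        (\<forall>i j. (\<lambda>z. F z $ i $ j) holomorphic_on UNIV) \<and>
        (\<forall>t\<in>I. F (complex_of_real t) = c t)))"

text \<open>A self-adjoint endomorphism of the Lie algebra \<open>su2\<close> with respect to the inner product
  \<open>k\<close>, and its list of eigenvalues with multiplicity.  For such endomorphisms the algebraic and
  the geometric multiplicity agree.\<close>

definition self_adjoint_on_su2 :: "(cmat2 \<Rightarrow> cmat2 \<Rightarrow> real) \<Rightarrow> (cmat2 \<Rightarrow> cmat2) \<Rightarrow> bool" where
  "self_adjoint_on_su2 k A \<longleftrightarrow> (\<forall>x\<in>su2. A x \<in> su2) \<and>
     (\<forall>x\<in>su2. \<forall>y\<in>su2. \<forall>a b. A (a *\<^sub>R x + b *\<^sub>R y) = a *\<^sub>R A x + b *\<^sub>R A y) \<and>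
     (\<forall>x\<in>su2. \<forall>y\<in>su2. k (A x) y = k x (A y))"

definition eigenvalue_list_su2 :: "(cmat2 \<Rightarrow> cmat2) \<Rightarrow> real list \<Rightarrow> bool" where
  "eigenvalue_list_su2 A ls \<longleftrightarrow> length ls = 3 \<and>
     (\<forall>m. dim {x \<in> su2. A x = m *\<^sub>R x} = count_list ls m)"

definition generic_eigenvalues :: "real \<Rightarrow> real \<Rightarrow> real \<Rightarrow> bool" where
  "generic_eigenvalues l1 l2 l3 \<longleftrightarrow> l1 < l2 \<and> l2 < l3"

definition special_eigenvalues :: "real \<Rightarrow> real \<Rightarrow> real \<Rightarrow> bool" where
  "special_eigenvalues l1 l2 l3 \<longleftrightarrow> l1 = l2 \<or> l2 = l3"

end

theory Submission
  imports Defs "HOL-Complex_Analysis.Conformal_Mappings"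
begin

text \<open>
  Left translation turns a tangent vector of \<open>SU2\<close> into an element of its Lie algebra \<open>su\<close>, and a left
  invariant metric into a symmetric operator \<open>A\<close> on \<open>su\<close>, relative to the inner product of the
  ambient matrix space: a biinvariant metric is a multiple of it (\<open>invariant_form_unique\<close>). The operator
  is diagonal in a basis \<open>e1, e2, e3\<close> multiplying like the quaternion units (\<open>eigenbasis_exists\<close>).
  The Levi-Civita connection is given by the Koszul formula (\<open>levi_civita_eq\<close>), and \<open>c\<close> is a geodesic
  if and only if \<open>c' = c x\<close> with a solution \<open>x\<close> of Euler's equation \<open>A x' = [A x, x]\<close>
  (\<open>geodesic_iff_euler\<close>).

  For three different eigenvalues, Euler's equation is the one of a rigid body with three different moments of inertia,
  possibly of different signs. It always has one unstable axis, and on the separatrix of this axis both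
  the velocity and the attitude are elementary functions. Along this geodesic \<open>c\<close> the \<open>e3\<close> component of
  \<open>inverse (c t) e3 (c t)\<close> is \<open>- tanh t\<close>. An entire extension of \<open>c\<close> would extend \<open>tanh\<close> to
  an entire function, but \<open>tanh\<close> has a pole at \<open>i pi / 2\<close> (\<open>separatrix_not_C_complete\<close>).

  If two eigenvalues agree, the velocity rotates about the third axis with constant
  speed, and the geodesic with \<open>c 0 = p\<close> and initial velocity \<open>p u\<close> is
  \<open>p exp (t (u + \<beta> e3)) exp (- t \<beta> e3)\<close> with a number \<open>\<beta>\<close> depending linearly on \<open>u\<close>. It extends to complex
  times, and its value at the imaginary unit is a smooth map \<open>Phi\<close> from the tangent bundle to the
  complex matrices. By construction \<open>Phi\<close> is holomorphic on the leaves \<open>Omega c\<close>, so the vectors which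
  the differential of \<open>Phi\<close> maps to type (1,0) contain the images of the holomorphic tangent spaces
  (\<open>Omega_polar\<close>). They form an involutive bundle, since they are the common kernel of the pullbacks of
  closed forms (\<open>pullback_polarization_bracket\<close>). The rank is half the dimension everywhere, even where
  \<open>Phi\<close> fails to be an immersion: \<open>Phi\<close> commutes with left translations, and the complex span of the image
  of the directions of the group is already everything, so that the bundle is a graph over the
  fibre directions (\<open>polar_eq_graph\<close>).
\<close>

section \<open>Smooth maps\<close>

abbreviation FD :: "('a::real_normed_vector \<Rightarrow> 'b::real_normed_vector) \<Rightarrow> 'a \<Rightarrow> 'a \<Rightarrow> 'b" where
  "FD f x \<equiv> frechet_derivative f (at x)"

lemma FD_works: "f differentiable (at x) \<Longrightarrow> (f has_derivative FD f x) (at x)"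
  by (simp add: frechet_derivative_works)

lemma FD_eq: "(f has_derivative f') (at x) \<Longrightarrow> FD f x = f'"
  by (metis frechet_derivative_at)

lemma Ck_on_cong:
  assumes "open U" "\<And>x. x \<in> U \<Longrightarrow> f x = g x"
  shows "Ck_on k U f \<longleftrightarrow> Ck_on k U g"
  using assms(2)
proof (induction k arbitrary: f g)
  case 0
  then show ?case unfolding Ck_on.simps by (intro continuous_on_cong refl) auto
next
  case (Suc k)
  have hd: "(f has_derivative D) (at x) \<longleftrightarrow> (g has_derivative D) (at x)" if "x \<in> U" for x D
    using has_derivative_transform_within_open[OF _ assms(1) that, of f D UNIV g]
      has_derivative_transform_within_open[OF _ assms(1) that, of g D UNIV f] Suc.prems by auto
  have "f differentiable (at x) \<longleftrightarrow> g differentiable (at x)" if "x \<in> U" for x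
    using hd that by (simp add: differentiable_def)
  moreover have "FD f x = FD g x" if "x \<in> U" for x
    using hd that by (simp add: frechet_derivative_def)
  then have "Ck_on k U (\<lambda>x. FD f x v) \<longleftrightarrow> Ck_on k U (\<lambda>x. FD g x v)" for v
    by (intro Suc.IH) auto
  ultimately show ?case by simp
qed

text \<open>The choice in \<open>frechet_derivative\<close> is harmless on open sets: any explicit derivative may be used.\<close>

lemma Ck_on_SucI:
  assumes "open U" "\<And>x. x \<in> U \<Longrightarrow> (f has_derivative D x) (at x)" "\<And>v. Ck_on k U (\<lambda>x. D x v)"
  shows "Ck_on (Suc k) U f"
proof -
  have "Ck_on k U (\<lambda>x. FD f x v)" for v
    using assms(3)[of v] Ck_on_cong[OF assms(1), of "\<lambda>x. FD f x v" "\<lambda>x. D x v" k] FD_eq[OF assms(2)]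
    by simp
  then show ?thesis using assms(2) by (auto simp: differentiable_def)
qed

lemma Ck_on_subset: "Ck_on k U f \<Longrightarrow> V \<subseteq> U \<Longrightarrow> Ck_on k V f"
proof (induction k arbitrary: f)
  case 0
  then show ?case by (auto intro: continuous_on_subset)
next
  case (Suc k)
  then show ?case by auto
qed

lemma Ck_on_SucD: "Ck_on (Suc k) U f \<Longrightarrow> Ck_on k U f"
proof (induction k arbitrary: f)
  case 0
  then have "\<And>x. x \<in> U \<Longrightarrow> isCont f x"
    by (auto intro: differentiable_imp_continuous_within)
  then show ?case by (simp add: continuous_at_imp_continuous_on)
next
  case (Suc k)
  then show ?case using Ck_on.simps(2) by blast
qed

lemma Ck_on_const: "Ck_on k U (\<lambda>x. a)"
proof (induction k arbitrary: a)
  case (Suc k)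
  then show ?case by (auto simp: frechet_derivative_const)
qed auto

lemma Ck_on_bounded_linear_comp:
  assumes "open U" "bounded_linear L" "Ck_on k U f"
  shows "Ck_on k U (\<lambda>x. L (f x))"
  using assms(3)
proof (induction k arbitrary: f)
  case 0
  then show ?case by (auto intro: bounded_linear.continuous_on[OF assms(2)])
next
  case (Suc k)
  show ?case
  proof (rule Ck_on_SucI[OF assms(1)])
    show "((\<lambda>x. L (f x)) has_derivative (\<lambda>v. L (FD f x v))) (at x)" if "x \<in> U" for x
      using bounded_linear.has_derivative[OF assms(2) FD_works] Suc.prems that by auto
    show "Ck_on k U (\<lambda>x. L (FD f x v))" for v
      using Suc by auto
  qed
qed

lemma Ck_on_id: "open U \<Longrightarrow> Ck_on k U (\<lambda>x. x)"
proof (cases k)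
  case (Suc m)
  assume "open U"
  then show ?thesis unfolding Suc by (rule Ck_on_SucI) (auto intro: has_derivative_ident Ck_on_const)
qed auto

lemma Ck_on_add:
  assumes "open U" "Ck_on k U f" "Ck_on k U g"
  shows "Ck_on k U (\<lambda>x. f x + g x)"
  using assms(2,3)
proof (induction k arbitrary: f g)
  case 0
  then show ?case by (auto intro: continuous_on_add)
next
  case (Suc k)
  show ?case
  proof (rule Ck_on_SucI[OF assms(1)])
    show "((\<lambda>x. f x + g x) has_derivative (\<lambda>v. FD f x v + FD g x v)) (at x)" if "x \<in> U" for x
      using Suc.prems that by (intro has_derivative_add FD_works) auto
    show "Ck_on k U (\<lambda>x. FD f x v + FD g x v)" for v
      using Suc by auto
  qed
qed

lemma Ck_on_sum:
  assumes "open U" "\<And>i. i \<in> I \<Longrightarrow> Ck_on k U (f i)"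
  shows "Ck_on k U (\<lambda>x. \<Sum>i\<in>I. f i x)"
  using assms(2)
  by (induction I rule: infinite_finite_induct) (auto intro: Ck_on_const Ck_on_add[OF assms(1)])

lemma Ck_on_bilinear:
  assumes "open U" "bounded_bilinear b" "Ck_on k U f" "Ck_on k U g"
  shows "Ck_on k U (\<lambda>x. b (f x) (g x))"
  using assms(3,4)
proof (induction k arbitrary: f g)
  case 0
  then show ?case by (auto intro: bounded_bilinear.continuous_on[OF assms(2)])
next
  case (Suc k)
  have "Ck_on k U f" "Ck_on k U g" using Suc.prems by (auto intro: Ck_on_SucD simp del: Ck_on.simps)
  then show ?case
  proof (intro Ck_on_SucI[OF assms(1)])
    show "((\<lambda>x. b (f x) (g x)) has_derivative (\<lambda>v. b (f x) (FD g x v) + b (FD f x v) (g x))) (at x)"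
      if "x \<in> U" for x
      using Suc.prems that by (intro bounded_bilinear.FDERIV[OF assms(2)] FD_works) auto
    show "Ck_on k U (\<lambda>x. b (f x) (FD g x v) + b (FD f x v) (g x))" for v
      using Suc.prems Suc.IH \<open>Ck_on k U f\<close> \<open>Ck_on k U g\<close> by (intro Ck_on_add[OF assms(1)]) auto
  qed
qed

lemma linear_basis_expansion:
  fixes L :: "'a::euclidean_space \<Rightarrow> 'b::real_vector"
  assumes "linear L"
  shows "L v = (\<Sum>b\<in>Basis. (v \<bullet> b) *\<^sub>R L b)"
proof -
  have "L v = L (\<Sum>b\<in>Basis. (v \<bullet> b) *\<^sub>R b)" by (simp add: euclidean_representation)
  also have "\<dots> = (\<Sum>b\<in>Basis. (v \<bullet> b) *\<^sub>R L b)"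
    by (simp add: linear_sum[OF assms] linear_cmul[OF assms])
  finally show ?thesis .
qed

text \<open>By definition \<open>Ck_on\<close> differentiates in fixed directions, whereas the chain rule produces a
  direction varying with the point. Expanding it in a basis reduces the chain rule to sums of products.\<close>

lemma Ck_on_compose:
  assumes "open U" "open V" "f ` U \<subseteq> V" "Ck_on k U f" "Ck_on k V g"
  shows "Ck_on k U (\<lambda>x. g (f x))"
  using assms(3-5)
proof (induction k arbitrary: g)
  case 0
  then show ?case by (auto intro: continuous_on_compose2)
next
  case (Suc k)
  have f: "Ck_on k U f" using Suc.prems(2) by (rule Ck_on_SucD)
  show ?case
  proof (intro Ck_on_SucI[OF assms(1)])
    show "((\<lambda>x. g (f x)) has_derivative (\<lambda>v. \<Sum>b\<in>Basis. (FD f x v \<bullet> b) *\<^sub>R FD g (f x) b)) (at x)"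
      if "x \<in> U" for x
    proof -
      have g: "(g has_derivative FD g (f x)) (at (f x))"
        using Suc.prems that by (intro FD_works) auto
      have f: "(f has_derivative FD f x) (at x)"
        using Suc.prems that by (intro FD_works) auto
      have "(\<lambda>v. FD g (f x) (FD f x v)) = (\<lambda>v. \<Sum>b\<in>Basis. (FD f x v \<bullet> b) *\<^sub>R FD g (f x) b)"
        by (rule ext) (rule linear_basis_expansion[OF has_derivative_linear[OF g]])
      then show ?thesis using has_derivative_compose[OF f g] by simp
    qed
    show "Ck_on k U (\<lambda>x. \<Sum>b\<in>Basis. (FD f x v \<bullet> b) *\<^sub>R FD g (f x) b)" for v
    proof (intro Ck_on_sum[OF assms(1)] Ck_on_bilinear[OF assms(1) bounded_bilinear_scaleR])
      fix b :: 'b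
      show "Ck_on k U (\<lambda>x. FD f x v \<bullet> b)"
        using Suc.prems by (intro Ck_on_bounded_linear_comp[OF assms(1) bounded_linear_inner_left]) auto
      show "Ck_on k U (\<lambda>x. FD g (f x) b)"
        using Suc.IH[of "\<lambda>y. FD g y b"] Suc.prems f by auto
    qed
  qed
qed

lemma smooth_on_subset: "smooth_on U f \<Longrightarrow> V \<subseteq> U \<Longrightarrow> smooth_on V f"
  unfolding smooth_on_def using Ck_on_subset by blast

lemma smooth_on_cong: "open U \<Longrightarrow> (\<And>x. x \<in> U \<Longrightarrow> f x = g x) \<Longrightarrow> smooth_on U f \<longleftrightarrow> smooth_on U g"
  unfolding smooth_on_def using Ck_on_cong by blast

lemma smooth_on_const: "smooth_on U (\<lambda>x. a)"
  unfolding smooth_on_def by (simp add: Ck_on_const)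

lemma smooth_on_id: "open U \<Longrightarrow> smooth_on U (\<lambda>x. x)"
  unfolding smooth_on_def by (simp add: Ck_on_id)

lemma smooth_on_add: "open U \<Longrightarrow> smooth_on U f \<Longrightarrow> smooth_on U g \<Longrightarrow> smooth_on U (\<lambda>x. f x + g x)"
  unfolding smooth_on_def by (simp add: Ck_on_add)

lemma smooth_on_sum: "open U \<Longrightarrow> (\<And>i. i \<in> I \<Longrightarrow> smooth_on U (f i)) \<Longrightarrow> smooth_on U (\<lambda>x. \<Sum>i\<in>I. f i x)"
  unfolding smooth_on_def by (simp add: Ck_on_sum)

lemma smooth_on_bilinear:
  "bounded_bilinear b \<Longrightarrow> open U \<Longrightarrow> smooth_on U f \<Longrightarrow> smooth_on U g \<Longrightarrow> smooth_on U (\<lambda>x. b (f x) (g x))"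
  unfolding smooth_on_def by (simp add: Ck_on_bilinear)

lemma smooth_on_linear:
  "bounded_linear L \<Longrightarrow> open U \<Longrightarrow> smooth_on U f \<Longrightarrow> smooth_on U (\<lambda>x. L (f x))"
  unfolding smooth_on_def by (simp add: Ck_on_bounded_linear_comp)

lemma smooth_on_compose:
  "open U \<Longrightarrow> open V \<Longrightarrow> f ` U \<subseteq> V \<Longrightarrow> smooth_on U f \<Longrightarrow> smooth_on V g \<Longrightarrow> smooth_on U (\<lambda>x. g (f x))"
  unfolding smooth_on_def by (simp add: Ck_on_compose)

lemma smooth_on_Pair:
  assumes "open U" "smooth_on U f" "smooth_on U g"
  shows "smooth_on U (\<lambda>x. (f x, g x))"
proof -
  have "bounded_linear (\<lambda>x. (x, 0))" "bounded_linear (\<lambda>x. (0, x))"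
    by (auto intro!: bounded_linear_Pair bounded_linear_ident bounded_linear_zero)
  note smooth_on_add[OF assms(1) smooth_on_linear[OF this(1) assms(1,2)] smooth_on_linear[OF this(2) assms(1,3)]]
  then show ?thesis by simp
qed

lemma smooth_on_FD: "smooth_on U f \<Longrightarrow> smooth_on U (\<lambda>x. FD f x v)"
  unfolding smooth_on_def using Ck_on.simps(2) by blast

lemma smooth_on_has_derivative: "smooth_on U f \<Longrightarrow> x \<in> U \<Longrightarrow> (f has_derivative FD f x) (at x)"
  unfolding smooth_on_def using Ck_on.simps(2) FD_works by blast

lemma smooth_on_FD_apply:
  assumes U: "open U" and f: "smooth_on U f" and G: "smooth_on U G"
  shows "smooth_on U (\<lambda>x. FD f x (G x))"
proof -
  have "smooth_on U (\<lambda>x. \<Sum>b\<in>Basis. (G x \<bullet> b) *\<^sub>R FD f x b)"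
    by (rule smooth_on_sum[OF U smooth_on_bilinear[OF bounded_bilinear_scaleR U
          smooth_on_linear[OF bounded_linear_inner_left U G] smooth_on_FD[OF f]]])
  moreover have "FD f x (G x) = (\<Sum>b\<in>Basis. (G x \<bullet> b) *\<^sub>R FD f x b)" if "x \<in> U" for x
    by (rule linear_basis_expansion[OF has_derivative_linear[OF smooth_on_has_derivative[OF f that]]])
  ultimately show ?thesis using smooth_on_cong[OF U] by (metis (no_types, lifting))
qed

text \<open>Bootstrapping: a solution of an autonomous equation with smooth right hand side has as
  many derivatives as its right hand side, hence one more. This makes curves smooth without
  knowing anything about the smoothness of the elementary functions which occur in them.\<close>

lemma smooth_on_ode_solution:
  fixes y :: "real \<Rightarrow> 'a::euclidean_space"
  assumes I: "open I" and y: "\<And>t. t \<in> I \<Longrightarrow> (y has_vector_derivative G (y t)) (at t)"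
    and G: "smooth_on UNIV G"
  shows "smooth_on I y"
  unfolding smooth_on_def
proof
  fix k show "Ck_on k I y"
  proof (induction k)
    case 0
    have "isCont y t" if "t \<in> I" for t
      using y[OF that] has_vector_derivative_continuous by blast
    then show ?case by (simp add: continuous_at_imp_continuous_on)
  next
    case (Suc k)
    show ?case
    proof (rule Ck_on_SucI[OF I])
      show "(y has_derivative (\<lambda>v. v *\<^sub>R G (y t))) (at t)" if "t \<in> I" for t
        using y[OF that] by (simp add: has_vector_derivative_def)
      show "Ck_on k I (\<lambda>t. v *\<^sub>R G (y t))" for v
        by (rule Ck_on_bounded_linear_comp[OF I bounded_linear_scaleR_right
            Ck_on_compose[OF I open_UNIV subset_UNIV Suc.IH]]) (use G in \<open>simp add: smooth_on_def\<close>)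
    qed
  qed
qed

lemma smooth_mapI: "smooth_on UNIV f \<Longrightarrow> smooth_map S f"
  unfolding smooth_map_def by blast

lemma smooth_mapE:
  assumes "smooth_map S f" "p \<in> S"
  obtains U F where "open U" "p \<in> U" "smooth_on U F" "\<And>q. q \<in> U \<inter> S \<Longrightarrow> F q = f q"
proof -
  have "\<exists>U F. open U \<and> p \<in> U \<and> smooth_on U F \<and> (\<forall>q\<in>U \<inter> S. F q = f q)"
    using assms(1) unfolding smooth_map_def by (rule bspec) (rule assms(2))
  then show ?thesis using that by auto
qed

lemma smooth_map_cong:
  assumes "smooth_map S f" "\<And>x. x \<in> S \<Longrightarrow> f x = g x"
  shows "smooth_map S g"
  unfolding smooth_map_def
proof
  fix p assume "p \<in> S"
  then obtain U F where "open U" "p \<in> U" "smooth_on U F" "\<And>q. q \<in> U \<inter> S \<Longrightarrow> F q = f q"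
    using assms smooth_mapE[of S f p] by auto
  then show "\<exists>U F. open U \<and> p \<in> U \<and> smooth_on U F \<and> (\<forall>q\<in>U \<inter> S. F q = g q)"
    using assms(2) by (intro exI[of _ U] exI[of _ F]) auto
qed

lemma smooth_map_Pair:
  assumes "smooth_map S f" "smooth_map S g"
  shows "smooth_map S (\<lambda>x. (f x, g x))"
  unfolding smooth_map_def
proof
  fix p assume p: "p \<in> S"
  obtain U F where U: "open U" "p \<in> U" "smooth_on U F" "\<And>q. q \<in> U \<inter> S \<Longrightarrow> F q = f q"
    using smooth_mapE[OF assms(1) p] by blast
  obtain V G where V: "open V" "p \<in> V" "smooth_on V G" "\<And>q. q \<in> V \<inter> S \<Longrightarrow> G q = g q"
    using smooth_mapE[OF assms(2) p] by blast
  have "smooth_on (U \<inter> V) (\<lambda>x. (F x, G x))"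
    using U V by (intro smooth_on_Pair) (auto intro: smooth_on_subset)
  then show "\<exists>U F. open U \<and> p \<in> U \<and> smooth_on U F \<and> (\<forall>q\<in>U \<inter> S. F q = (f q, g q))"
    using U V by (intro exI[of _ "U \<inter> V"] exI[of _ "\<lambda>x. (F x, G x)"]) auto
qed

lemma smooth_map_compose:
  assumes "smooth_on UNIV H" "smooth_map S f"
  shows "smooth_map S (\<lambda>x. H (f x))"
  unfolding smooth_map_def
proof
  fix p assume p: "p \<in> S"
  obtain U F where U: "open U" "p \<in> U" "smooth_on U F" "\<And>q. q \<in> U \<inter> S \<Longrightarrow> F q = f q"
    using smooth_mapE[OF assms(2) p] by blast
  have "smooth_on U (\<lambda>x. H (F x))"
    by (rule smooth_on_compose[OF U(1) open_UNIV subset_UNIV U(3) assms(1)])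
  then show "\<exists>U F. open U \<and> p \<in> U \<and> smooth_on U F \<and> (\<forall>q\<in>U \<inter> S. F q = H (f q))"
    using U by (intro exI[of _ U] exI[of _ "\<lambda>x. H (F x)"]) auto
qed

lemma smooth_map_linear: "bounded_linear L \<Longrightarrow> smooth_map S f \<Longrightarrow> smooth_map S (\<lambda>x. L (f x))"
  by (rule smooth_map_compose[OF smooth_on_linear[OF _ open_UNIV smooth_on_id[OF open_UNIV]]])

lemma smooth_map_bilinear:
  assumes "bounded_bilinear b" "smooth_map S f" "smooth_map S g"
  shows "smooth_map S (\<lambda>x. b (f x) (g x))"
proof -
  have "smooth_on UNIV (\<lambda>z. b (fst z) (snd z))"
    by (rule smooth_on_bilinear[OF assms(1) open_UNIV
          smooth_on_linear[OF bounded_linear_fst open_UNIV smooth_on_id[OF open_UNIV]]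
          smooth_on_linear[OF bounded_linear_snd open_UNIV smooth_on_id[OF open_UNIV]]])
  from smooth_map_compose[OF this smooth_map_Pair[OF assms(2,3)]] show ?thesis by simp
qed

lemma smooth_map_add: "smooth_map S f \<Longrightarrow> smooth_map S g \<Longrightarrow> smooth_map S (\<lambda>x. f x + g x)"
proof -
  assume *: "smooth_map S f" "smooth_map S g"
  have "smooth_on UNIV (\<lambda>z::'b\<times>'b. fst z + snd z)"
    by (rule smooth_on_linear[OF bounded_linear_add[OF bounded_linear_fst bounded_linear_snd] open_UNIV
          smooth_on_id[OF open_UNIV]])
  from smooth_map_compose[OF this smooth_map_Pair[OF *]] show ?thesis by simp
qed

section \<open>Derivatives along a subset of Euclidean space\<close>

lemma curve_chain_rule:
  assumes f: "(f has_derivative f') (at p within (W \<inter> S))" and W: "open W" "p \<in> W"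
    and e: "e > 0" "c ` {-e<..<e} \<subseteq> S" "c 0 = p" "(c has_vector_derivative v) (at (0::real))"
  shows "((\<lambda>t. f (c t)) has_vector_derivative f' v) (at 0)"
proof -
  have "isCont c 0" using e(4) has_vector_derivative_continuous by blast
  then have "\<forall>\<^sub>F t in nhds 0. c t \<in> W"
    using W e(3) by (auto simp: isCont_def tendsto_def eventually_nhds_conv_at)
  then obtain N where N: "open N" "0 \<in> N" "\<And>t. t \<in> N \<Longrightarrow> c t \<in> W"
    unfolding eventually_nhds by blast
  define M where "M = N \<inter> {-e<..<e}"
  have M: "open M" "0 \<in> M" "c ` M \<subseteq> W \<inter> S"
    using N e by (auto simp: M_def)
  have c: "(c has_derivative (\<lambda>h. h *\<^sub>R v)) (at 0 within M)"
    using e(4) by (simp add: has_vector_derivative_def has_derivative_at_withinI)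
  have "(f has_derivative f') (at (c 0) within (c ` M))"
    using f M(3) e(3) by (auto intro: has_derivative_subset)
  from has_derivative_in_compose[OF c this]
  have "((\<lambda>t. f (c t)) has_derivative (\<lambda>h. f' (h *\<^sub>R v))) (at 0)"
    using M(1,2) by (metis at_within_open)
  moreover have "f' (h *\<^sub>R v) = h *\<^sub>R f' v" for h
    using has_derivative_linear[OF f] by (simp add: linear_cmul)
  ultimately show ?thesis by (simp add: has_vector_derivative_def)
qed

lemma tangent_derivative_unique:
  assumes "(f has_derivative f') (at p within (W \<inter> S))" "(f has_derivative f'') (at p within (W \<inter> S))"
    "open W" "p \<in> W" "v \<in> tangent_space S p"
  shows "f' v = f'' v"
proof -
  obtain e c where "e > 0" "c ` {-e<..<e} \<subseteq> S" "c (0::real) = p" "(c has_vector_derivative v) (at 0)"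
    using assms(5) unfolding tangent_space_def by blast
  from curve_chain_rule[OF assms(1,3,4) this] curve_chain_rule[OF assms(2,3,4) this]
  show ?thesis using vector_derivative_unique_at by blast
qed

text \<open>A derivative within a subset is determined on tangent vectors only, where it is the velocity of
  the image of a curve. Hence it may be computed from any ambient extension.\<close>

lemma derivative_within_extension:
  assumes F: "(F has_derivative F') (at p)" and U: "open U" "p \<in> U"
    and eq: "\<And>q. q \<in> U \<inter> (W \<inter> S) \<Longrightarrow> F q = f q" and p: "p \<in> S"
    and W: "open W" "p \<in> W"
  shows "(f has_derivative F') (at p within (W \<inter> S))"
    and "v \<in> tangent_space S p \<Longrightarrow> frechet_derivative f (at p within (W \<inter> S)) v = F' v"
proof -
  obtain d where d: "d > 0" "ball p d \<subseteq> U" using U openE by blast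
  show f: "(f has_derivative F') (at p within (W \<inter> S))"
  proof (rule has_derivative_transform_within[OF has_derivative_at_withinI[OF F] d(1)])
    show "p \<in> W \<inter> S" using p W by simp
    show "\<And>x. x \<in> W \<inter> S \<Longrightarrow> dist x p < d \<Longrightarrow> F x = f x"
      using d(2) eq by (auto simp: dist_commute subset_iff)
  qed
  then have "(f has_derivative frechet_derivative f (at p within (W \<inter> S))) (at p within (W \<inter> S))"
    using frechet_derivative_works unfolding differentiable_def by blast
  from tangent_derivative_unique[OF this f W]
  show "v \<in> tangent_space S p \<Longrightarrow> frechet_derivative f (at p within (W \<inter> S)) v = F' v" .
qed

text \<open>This is what makes the covariant derivative of a vector field along another one smooth.\<close>

lemma smooth_map_derivative_apply:
  assumes f: "smooth_map S f" and V: "vector_field S V"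
  shows "smooth_map S (\<lambda>p. frechet_derivative f (at p within S) (V p))"
  unfolding smooth_map_def
proof
  fix p assume p: "p \<in> S"
  obtain U1 F where U1: "open U1" "p \<in> U1" "smooth_on U1 F" "\<And>q. q \<in> U1 \<inter> S \<Longrightarrow> F q = f q"
    using smooth_mapE[OF f p] by blast
  obtain U2 G where U2: "open U2" "p \<in> U2" "smooth_on U2 G" "\<And>q. q \<in> U2 \<inter> S \<Longrightarrow> G q = V q"
    using V smooth_mapE[OF _ p] unfolding vector_field_def by blast
  define U where "U = U1 \<inter> U2"
  have U: "open U" "p \<in> U" "smooth_on U F" "smooth_on U G"
    using U1 U2 by (auto simp: U_def intro: smooth_on_subset)
  have "FD F q (G q) = frechet_derivative f (at q within S) (V q)" if "q \<in> U \<inter> S" for q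
  proof -
    have q: "(F has_derivative FD F q) (at q)" "q \<in> U1" "q \<in> S"
      using U(3) that by (auto intro: smooth_on_has_derivative simp: U_def)
    have "frechet_derivative f (at q within (UNIV \<inter> S)) (V q) = FD F q (V q)"
      by (rule derivative_within_extension(2)[OF q(1) U1(1) q(2) _ q(3)])
        (use U1(4) V q in \<open>auto simp: vector_field_def\<close>)
    then show ?thesis using U2(4)[of q] that by (simp add: U_def)
  qed
  then show "\<exists>U F. open U \<and> p \<in> U \<and> smooth_on U F \<and>
      (\<forall>q\<in>U \<inter> S. F q = frechet_derivative f (at q within S) (V q))"
    using U smooth_on_FD_apply[OF U(1,3,4)] by (intro exI[of _ U] exI[of _ "\<lambda>q. FD F q (G q)"]) auto
qed

subsection \<open>Symmetry of the second derivative and brackets of related fields\<close>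

text \<open>The second difference of \<open>f\<close> over a small parallelogram equals, by two applications of the mean value
  theorem, a value of either mixed derivative at some point nearby. Thus the two mixed derivatives
  take a common value arbitrarily close to \<open>p\<close>, and they are continuous.\<close>

lemma second_derivative_symmetric_real:
  fixes f :: "'a::euclidean_space \<Rightarrow> real"
  assumes U: "open U" "p \<in> U" and f: "smooth_on U f"
  shows "FD (\<lambda>q. FD f q v) p u = FD (\<lambda>q. FD f q u) p v"
proof -
  have mixed: "\<exists>x\<in>ball p r. \<exists>y\<in>ball p r. FD (\<lambda>q. FD f q v) x u = FD (\<lambda>q. FD f q u) y v"
    if r: "r > 0" "ball p r \<subseteq> U" for r
  proof -
    define h where "h = r / (2 * (1 + norm u + norm v))"
    have pos: "1 + norm u + norm v > 0" by (simp add: add_pos_nonneg)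
    have h: "h > 0" using r pos by (simp add: h_def)
    have inball: "p + s *\<^sub>R u + t *\<^sub>R v \<in> ball p r" if "0 \<le> s" "s \<le> h" "0 \<le> t" "t \<le> h" for s t
    proof -
      have "norm (s *\<^sub>R u + t *\<^sub>R v) \<le> s * norm u + t * norm v"
        using that by (intro norm_triangle_le) auto
      also have "\<dots> \<le> h * norm u + h * norm v"
        using that by (intro add_mono mult_right_mono) auto
      also have "\<dots> \<le> h * (1 + norm u + norm v)" using h by (simp add: algebra_simps)
      also have "\<dots> = r / 2" using pos unfolding h_def by (simp add: divide_simps)
      also have "\<dots> < r" using r by simp
      finally show ?thesis
        by (metis add.assoc add_diff_cancel_left' dist_norm mem_ball norm_minus_commute)
    qed
    have ex: "\<exists>x\<in>ball p r. f (p + h *\<^sub>R a + h *\<^sub>R b) - f (p + h *\<^sub>R a) - f (p + h *\<^sub>R b) + f p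
         = h * h * FD (\<lambda>q. FD f q a) x b"
      if ab: "\<And>s t. 0 \<le> s \<Longrightarrow> s \<le> h \<Longrightarrow> 0 \<le> t \<Longrightarrow> t \<le> h \<Longrightarrow> p + s *\<^sub>R a + t *\<^sub>R b \<in> ball p r" for a b
    proof -
      define \<psi> where "\<psi> = (\<lambda>s. f (p + s *\<^sub>R a + h *\<^sub>R b) - f (p + s *\<^sub>R a))"
      have df: "((\<lambda>s. f (z + s *\<^sub>R w)) has_real_derivative FD f (z + s *\<^sub>R w) w) (at s)"
        if "z + s *\<^sub>R w \<in> U" for z w s
      proof -
        note * = smooth_on_has_derivative[OF f that]
        have "((\<lambda>s. f (z + s *\<^sub>R w)) has_derivative (\<lambda>k. FD f (z + s *\<^sub>R w) (k *\<^sub>R w))) (at s)"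
          by (rule has_derivative_compose[where f = "\<lambda>s. z + s *\<^sub>R w", OF _ *]) (auto intro!: derivative_eq_intros)
        then show ?thesis
          using linear_cmul[OF has_derivative_linear[OF *]]
          by (simp add: has_field_derivative_def mult_commute_abs)
      qed
      have "\<exists>z. 0 < z \<and> z < h \<and> \<psi> h - \<psi> 0 = (h - 0) * (FD f (p + z *\<^sub>R a + h *\<^sub>R b) a - FD f (p + z *\<^sub>R a) a)"
      proof (rule MVT2[OF h])
        fix s assume s: "0 \<le> s" "s \<le> h"
        have "p + s *\<^sub>R a + h *\<^sub>R b \<in> U" "p + s *\<^sub>R a + 0 *\<^sub>R b \<in> U"
          using ab[OF s, of h] ab[OF s, of 0] h r by auto
        then show "(\<psi> has_real_derivative FD f (p + s *\<^sub>R a + h *\<^sub>R b) a - FD f (p + s *\<^sub>R a) a) (at s)"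
          unfolding \<psi>_def using df[of "p + h *\<^sub>R b" s a] df[of p s a]
          by (intro DERIV_diff) (auto simp: algebra_simps)
      qed
      then obtain \<xi> where \<xi>: "0 < \<xi>" "\<xi> < h"
        "\<psi> h - \<psi> 0 = h * (FD f (p + \<xi> *\<^sub>R a + h *\<^sub>R b) a - FD f (p + \<xi> *\<^sub>R a + 0 *\<^sub>R b) a)" by auto
      have "\<exists>z. 0 < z \<and> z < h \<and> FD f (p + \<xi> *\<^sub>R a + h *\<^sub>R b) a - FD f (p + \<xi> *\<^sub>R a + 0 *\<^sub>R b) a
          = (h - 0) * FD (\<lambda>q. FD f q a) (p + \<xi> *\<^sub>R a + z *\<^sub>R b) b"
      proof (rule MVT2[OF h])
        fix t assume t: "0 \<le> t" "t \<le> h"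
        have "p + \<xi> *\<^sub>R a + t *\<^sub>R b \<in> U" using ab[of \<xi> t] \<xi> t r by auto
        note * = smooth_on_has_derivative[OF smooth_on_FD[OF f, of a] this]
        have "((\<lambda>t. FD f (p + \<xi> *\<^sub>R a + t *\<^sub>R b) a) has_derivative
            (\<lambda>k. FD (\<lambda>q. FD f q a) (p + \<xi> *\<^sub>R a + t *\<^sub>R b) (k *\<^sub>R b))) (at t)"
          by (rule has_derivative_compose[where f = "\<lambda>t. p + \<xi> *\<^sub>R a + t *\<^sub>R b" and g = "\<lambda>q. FD f q a", OF _ *])
            (auto intro!: derivative_eq_intros)
        then show "((\<lambda>t. FD f (p + \<xi> *\<^sub>R a + t *\<^sub>R b) a) has_real_derivative
            FD (\<lambda>q. FD f q a) (p + \<xi> *\<^sub>R a + t *\<^sub>R b) b) (at t)"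
          using linear_cmul[OF has_derivative_linear[OF *]]
          by (simp add: has_field_derivative_def mult_commute_abs)
      qed
      then obtain \<eta> where \<eta>: "0 < \<eta>" "\<eta> < h"
        "FD f (p + \<xi> *\<^sub>R a + h *\<^sub>R b) a - FD f (p + \<xi> *\<^sub>R a + 0 *\<^sub>R b) a
          = h * FD (\<lambda>q. FD f q a) (p + \<xi> *\<^sub>R a + \<eta> *\<^sub>R b) b" by auto
      then show ?thesis
        using \<xi> ab[of \<xi> \<eta>] by (intro bexI[of _ "p + \<xi> *\<^sub>R a + \<eta> *\<^sub>R b"]) (auto simp: \<psi>_def)
    qed
    have inball': "p + s *\<^sub>R v + t *\<^sub>R u \<in> ball p r" if "0 \<le> s" "s \<le> h" "0 \<le> t" "t \<le> h" for s t
      using inball[OF that(3,4,1,2)] by (simp add: add.assoc add.commute[of "s *\<^sub>R v"])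
    obtain x where x: "x \<in> ball p r" "f (p + h *\<^sub>R v + h *\<^sub>R u) - f (p + h *\<^sub>R v) - f (p + h *\<^sub>R u) + f p
         = h * h * FD (\<lambda>q. FD f q v) x u"
      using ex[of v u, OF inball'] by blast
    obtain y where y: "y \<in> ball p r" "f (p + h *\<^sub>R u + h *\<^sub>R v) - f (p + h *\<^sub>R u) - f (p + h *\<^sub>R v) + f p
         = h * h * FD (\<lambda>q. FD f q u) y v"
      using ex[of u v, OF inball] by blast
    have "h * h * FD (\<lambda>q. FD f q v) x u = h * h * FD (\<lambda>q. FD f q u) y v"
      using x(2) y(2) by (simp add: algebra_simps)
    then have "FD (\<lambda>q. FD f q v) x u = FD (\<lambda>q. FD f q u) y v" using h by simp
    then show ?thesis using x(1) y(1) by blast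
  qed
  have cont: "isCont (\<lambda>x. FD (\<lambda>q. FD f q a) x b) p" for a b
    using smooth_on_FD[OF smooth_on_FD[OF f], of a b] U
    unfolding smooth_on_def by (metis Ck_on.simps(1) continuous_on_eq_continuous_at)
  show ?thesis
  proof (rule ccontr)
    let ?a = "\<lambda>x. FD (\<lambda>q. FD f q v) x u" and ?b = "\<lambda>x. FD (\<lambda>q. FD f q u) x v"
    assume "?a p \<noteq> ?b p"
    then have e: "\<bar>?a p - ?b p\<bar> / 2 > 0" (is "?e > 0") by simp
    obtain d1 where d1: "d1 > 0" "\<And>x. dist x p < d1 \<Longrightarrow> dist (?a x) (?a p) < ?e"
      using cont[of v u] e unfolding continuous_at_eps_delta by metis
    obtain d2 where d2: "d2 > 0" "\<And>x. dist x p < d2 \<Longrightarrow> dist (?b x) (?b p) < ?e"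
      using cont[of u v] e unfolding continuous_at_eps_delta by metis
    obtain d3 where d3: "d3 > 0" "ball p d3 \<subseteq> U" using U openE by blast
    have "min d1 (min d2 d3) > 0" "ball p (min d1 (min d2 d3)) \<subseteq> U" using d1 d2 d3 by auto
    from mixed[OF this] obtain x y
      where xy: "x \<in> ball p (min d1 (min d2 d3))" "y \<in> ball p (min d1 (min d2 d3))" "?a x = ?b y"
      by blast
    have "dist x p < d1" "dist y p < d2" using xy(1,2) by (auto simp: dist_commute)
    from d1(2)[OF this(1)] d2(2)[OF this(2)]
    have "dist (?a x) (?a p) < ?e" "dist (?b y) (?b p) < ?e" .
    then show False using xy(3) unfolding dist_real_def by (smt (verit) field_sum_of_halves)
  qed
qed

lemma second_derivative_symmetric:
  fixes f :: "'a::euclidean_space \<Rightarrow> 'b::euclidean_space"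
  assumes U: "open U" "p \<in> U" and f: "smooth_on U f"
  shows "FD (\<lambda>q. FD f q v) p u = FD (\<lambda>q. FD f q u) p v"
proof (rule euclidean_eqI)
  fix b :: 'b assume "b \<in> Basis"
  let ?h = "\<lambda>q. f q \<bullet> b"
  have h: "smooth_on U ?h" by (intro smooth_on_linear[OF bounded_linear_inner_left U(1)] f)
  have 1: "FD ?h q w = FD f q w \<bullet> b" if "q \<in> U" for q w
    using FD_eq[OF bounded_linear.has_derivative[OF bounded_linear_inner_left
          smooth_on_has_derivative[OF f that]]] by metis
  have 2: "FD (\<lambda>q. FD ?h q w) p z = FD (\<lambda>q. FD f q w) p z \<bullet> b" for w z
  proof -
    have "((\<lambda>q. FD f q w \<bullet> b) has_derivative (\<lambda>z. FD (\<lambda>q. FD f q w) p z \<bullet> b)) (at p)"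
      by (intro bounded_linear.has_derivative[OF bounded_linear_inner_left]
          smooth_on_has_derivative[OF smooth_on_FD[OF f] U(2)])
    then have "((\<lambda>q. FD ?h q w) has_derivative (\<lambda>z. FD (\<lambda>q. FD f q w) p z \<bullet> b)) (at p)"
      by (rule has_derivative_transform_within_open[OF _ U]) (simp add: 1)
    from FD_eq[OF this] show ?thesis by simp
  qed
  show "FD (\<lambda>q. FD f q v) p u \<bullet> b = FD (\<lambda>q. FD f q u) p v \<bullet> b"
    using second_derivative_symmetric_real[OF U h, of v u] by (simp add: 2)
qed

text \<open>Product rule for the derivative of \<open>f\<close> applied to a moving vector; the second derivative enters
  because the base point moves as well.\<close>

lemma FD_apply_has_derivative:
  assumes U: "open U" "p \<in> U" and f: "smooth_on U f" and G: "(G has_derivative G') (at p)"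
  shows "((\<lambda>q. FD f q (G q)) has_derivative (\<lambda>v. FD f p (G' v) + FD (\<lambda>q. FD f q (G p)) p v)) (at p)"
proof -
  have lin: "(\<Sum>b\<in>Basis. (w \<bullet> b) *\<^sub>R FD f q b) = FD f q w" if "q \<in> U" for q w
    by (rule linear_basis_expansion[OF has_derivative_linear[OF smooth_on_has_derivative[OF f that]], symmetric])
  have d: "((\<lambda>q. FD f q w) has_derivative FD (\<lambda>q. FD f q w) p) (at p)" for w
    by (rule smooth_on_has_derivative[OF smooth_on_FD[OF f] U(2)])
  have sumd: "((\<lambda>q. \<Sum>b\<in>Basis. (H q \<bullet> b) *\<^sub>R FD f q b) has_derivative
      (\<lambda>v. \<Sum>b\<in>Basis. (H p \<bullet> b) *\<^sub>R FD (\<lambda>q. FD f q b) p v + (H' v \<bullet> b) *\<^sub>R FD f p b)) (at p)"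
    if "(H has_derivative H') (at p)" for H H'
    using that
    by (intro has_derivative_sum bounded_bilinear.FDERIV[OF bounded_bilinear_scaleR] d
        bounded_linear.has_derivative[OF bounded_linear_inner_left]) auto
  have 1: "FD (\<lambda>q. FD f q w) p v = (\<Sum>b\<in>Basis. (w \<bullet> b) *\<^sub>R FD (\<lambda>q. FD f q b) p v)" for v w
  proof -
    have "((\<lambda>q. FD f q w) has_derivative (\<lambda>v. \<Sum>b\<in>Basis. (w \<bullet> b) *\<^sub>R FD (\<lambda>q. FD f q b) p v)) (at p)"
      by (rule has_derivative_transform_within_open[OF
            sumd[of "\<lambda>_. w" "\<lambda>_. 0", simplified] U(1,2)]) (use lin in auto)
    from FD_eq[OF this] show ?thesis by simp
  qed
  have "((\<lambda>q. FD f q (G q)) has_derivative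
      (\<lambda>v. \<Sum>b\<in>Basis. (G p \<bullet> b) *\<^sub>R FD (\<lambda>q. FD f q b) p v + (G' v \<bullet> b) *\<^sub>R FD f p b)) (at p)"
    by (rule has_derivative_transform_within_open[OF sumd[OF G] U(1,2)]) (use lin in auto)
  moreover have "(\<lambda>v. \<Sum>b\<in>Basis. (G p \<bullet> b) *\<^sub>R FD (\<lambda>q. FD f q b) p v + (G' v \<bullet> b) *\<^sub>R FD f p b)
      = (\<lambda>v. FD f p (G' v) + FD (\<lambda>q. FD f q (G p)) p v)"
    by (rule ext) (simp only: sum.distrib lin[OF U(2)] 1[symmetric] add.commute)
  ultimately show ?thesis by simp
qed

text \<open>The bracket of vector fields along a subset behaves under a smooth map like the bracket of
  vector fields on a manifold; the second derivatives of the map cancel by symmetry.\<close>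

lemma pushforward_lie_bracket:
  assumes U: "open U" "p \<in> U" and f: "smooth_on U f"
    and A: "smooth_map (W \<inter> X) A" and B: "smooth_map (W \<inter> X) B"
    and Ap: "A p \<in> tangent_space X p" and Bp: "B p \<in> tangent_space X p"
    and W: "open W" "p \<in> W" and p: "p \<in> X"
    and a: "\<And>q. q \<in> W \<inter> X \<Longrightarrow> q \<in> U \<Longrightarrow> a q = FD f q (A q)"
    and b: "\<And>q. q \<in> W \<inter> X \<Longrightarrow> q \<in> U \<Longrightarrow> b q = FD f q (B q)"
  shows "FD f p (lie_bracket (W \<inter> X) A B p) =
    frechet_derivative b (at p within (W \<inter> X)) (A p) - frechet_derivative a (at p within (W \<inter> X)) (B p)"
proof -
  have pWX: "p \<in> W \<inter> X" using p W by simp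
  have ext: "\<exists>C'. linear C' \<and> frechet_derivative C (at p within (W \<inter> X)) v = C' v
      \<and> frechet_derivative d (at p within (W \<inter> X)) v = FD f p (C' v) + FD (\<lambda>q. FD f q (C p)) p v"
    if C: "smooth_map (W \<inter> X) C" and v: "v \<in> tangent_space X p"
      and d: "\<And>q. q \<in> W \<inter> X \<Longrightarrow> q \<in> U \<Longrightarrow> d q = FD f q (C q)" for C d v
  proof -
    obtain N G where N: "open N" "p \<in> N" "smooth_on N G" "\<And>q. q \<in> N \<inter> (W \<inter> X) \<Longrightarrow> G q = C q"
      using smooth_mapE[OF C pWX] by blast
    note G = smooth_on_has_derivative[OF N(3,2)]
    have 1: "frechet_derivative C (at p within (W \<inter> X)) v = FD G p v"
      by (rule derivative_within_extension(2)[OF G N(1,2,4) p W v])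
    have 2: "((\<lambda>q. FD f q (G q)) has_derivative
        (\<lambda>v. FD f p (FD G p v) + FD (\<lambda>q. FD f q (G p)) p v)) (at p)"
      by (rule FD_apply_has_derivative[OF U f G])
    have "frechet_derivative d (at p within (W \<inter> X)) v = FD f p (FD G p v) + FD (\<lambda>q. FD f q (G p)) p v"
      by (rule derivative_within_extension(2)[OF 2 open_Int[OF U(1) N(1)] _ _ p W v])
        (use U N d in auto)
    moreover have "G p = C p" using N(2,4) pWX by auto
    ultimately show ?thesis using 1 has_derivative_linear[OF G] by auto
  qed
  obtain B' where B': "frechet_derivative B (at p within (W \<inter> X)) (A p) = B' (A p)"
    "frechet_derivative b (at p within (W \<inter> X)) (A p) = FD f p (B' (A p)) + FD (\<lambda>q. FD f q (B p)) p (A p)"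
    using ext[OF B Ap b] by blast
  obtain A' where A': "frechet_derivative A (at p within (W \<inter> X)) (B p) = A' (B p)"
    "frechet_derivative a (at p within (W \<inter> X)) (B p) = FD f p (A' (B p)) + FD (\<lambda>q. FD f q (A p)) p (B p)"
    using ext[OF A Bp a] by blast
  have "linear (FD f p)" using smooth_on_has_derivative[OF f U(2)] has_derivative_linear by blast
  then show ?thesis
    using second_derivative_symmetric[OF U f, of "B p" "A p"]
    by (simp add: lie_bracket_def A' B' linear_diff)
qed

section \<open>Two by two matrices and SU(2)\<close>

abbreviation dagger :: "cmat2 \<Rightarrow> cmat2" where "dagger \<equiv> adjoint_mat"

text \<open>The complex linear anti-involution which inverts matrices of determinant one. On \<open>SU2\<close> it agrees
  with the antilinear one, the conjugate transpose. Describing the group and its Lie algebra by these two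
  maps makes every defining equation real bilinear or linear.\<close>

definition adjugate :: "cmat2 \<Rightarrow> cmat2" where
  "adjugate M = mat (trace M) - M"

text \<open>The complex structure of the matrix space. It is different from \<open>cscale\<close>, which belongs to
  the formal complexification of a real space.\<close>

definition itimes :: "cmat2 \<Rightarrow> cmat2" where
  "itimes M = (\<chi> i j. \<i> * M $ i $ j)"

abbreviation one :: cmat2 where "one \<equiv> mat 1"

lemmas mat2_simps = vec_eq_iff forall_2 matrix_matrix_mult_def sum_2 mat_def adjoint_mat_def
  adjugate_def itimes_def trace_def

lemma bounded_bilinear_mat_mult: "bounded_bilinear ((**) :: cmat2 \<Rightarrow> cmat2 \<Rightarrow> cmat2)"
  unfolding bilinear_conv_bounded_bilinear[symmetric] bilinear_def
  by (auto intro!: linearI simp: mat2_simps algebra_simps scaleR_conv_of_real[where 'a=complex])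

interpretation mm: bounded_bilinear "(**) :: cmat2 \<Rightarrow> cmat2 \<Rightarrow> cmat2"
  by (rule bounded_bilinear_mat_mult)

lemmas mm_simps = mm.add_left mm.add_right mm.diff_left mm.diff_right mm.minus_left mm.minus_right
  mm.scaleR_left mm.scaleR_right mm.zero_left mm.zero_right matrix_mul_assoc[symmetric]

lemma bounded_linear_dagger: "bounded_linear dagger"
  unfolding linear_conv_bounded_linear[symmetric]
  by (auto intro!: linearI simp: mat2_simps algebra_simps scaleR_conv_of_real[where 'a=complex])

lemmas dagger_add = linear_add[OF bounded_linear.linear[OF bounded_linear_dagger]]
lemmas dagger_diff = linear_diff[OF bounded_linear.linear[OF bounded_linear_dagger]]
lemmas dagger_minus = linear_neg[OF bounded_linear.linear[OF bounded_linear_dagger]]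
lemmas dagger_scaleR = linear_scale[OF bounded_linear.linear[OF bounded_linear_dagger]]
lemmas dagger_zero = linear_0[OF bounded_linear.linear[OF bounded_linear_dagger]]

lemma bounded_linear_adjugate: "bounded_linear adjugate"
  unfolding linear_conv_bounded_linear[symmetric]
  by (auto intro!: linearI simp: mat2_simps algebra_simps scaleR_conv_of_real[where 'a=complex])

lemmas adjugate_add = linear_add[OF bounded_linear.linear[OF bounded_linear_adjugate]]
lemmas adjugate_diff = linear_diff[OF bounded_linear.linear[OF bounded_linear_adjugate]]
lemmas adjugate_scaleR = linear_scale[OF bounded_linear.linear[OF bounded_linear_adjugate]]
lemmas adjugate_zero = linear_0[OF bounded_linear.linear[OF bounded_linear_adjugate]]

lemma bounded_linear_itimes: "bounded_linear itimes"
  unfolding linear_conv_bounded_linear[symmetric]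
  by (auto intro!: linearI simp: mat2_simps algebra_simps scaleR_conv_of_real[where 'a=complex])

lemmas itimes_add = linear_add[OF bounded_linear.linear[OF bounded_linear_itimes]]
lemmas itimes_diff = linear_diff[OF bounded_linear.linear[OF bounded_linear_itimes]]
lemmas itimes_minus = linear_neg[OF bounded_linear.linear[OF bounded_linear_itimes]]
lemmas itimes_scaleR = linear_scale[OF bounded_linear.linear[OF bounded_linear_itimes]]
lemmas itimes_zero = linear_0[OF bounded_linear.linear[OF bounded_linear_itimes]]

lemma dagger_mult: "dagger (a ** b) = dagger b ** dagger a"
  by (simp add: mat2_simps algebra_simps)

lemma dagger_dagger [simp]: "dagger (dagger a) = a"
  by (simp add: mat2_simps)

lemma dagger_one [simp]: "dagger one = one"
  by (simp add: mat2_simps)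

lemma adjugate_mult: "adjugate (a ** b) = adjugate b ** adjugate a"
  by (simp add: mat2_simps algebra_simps)

lemma adjugate_adjugate [simp]: "adjugate (adjugate a) = a"
  by (simp add: mat2_simps)

lemma adjugate_one [simp]: "adjugate one = one"
  by (simp add: mat2_simps)

lemma mult_adjugate: "a ** adjugate a = mat (det a)" "adjugate a ** a = mat (det a)"
  by (simp_all add: mat2_simps det_2 algebra_simps)

lemma itimes_mult: "itimes a ** b = itimes (a ** b)" "a ** itimes b = itimes (a ** b)"
  by (simp_all add: mat2_simps algebra_simps)

lemma itimes_itimes [simp]: "itimes (itimes a) = - a"
  by (simp add: mat2_simps mult.assoc[symmetric])

lemma adjugate_itimes: "adjugate (itimes a) = itimes (adjugate a)"
  by (simp add: mat2_simps algebra_simps)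

lemma dagger_itimes: "dagger (itimes a) = - itimes (dagger a)"
  by (simp add: mat2_simps)

lemma inner_mult_left: "(a ** b) \<bullet> c = b \<bullet> (dagger a ** c)" for a b c :: cmat2
  by (simp add: mat2_simps inner_vec_def inner_complex_def algebra_simps)

lemma inner_mult_right: "(a ** b) \<bullet> c = a \<bullet> (c ** dagger b)" for a b c :: cmat2
  by (simp add: mat2_simps inner_vec_def inner_complex_def algebra_simps)

lemma SU2_iff: "U \<in> SU2 \<longleftrightarrow> U ** adjugate U = one \<and> dagger U = adjugate U"
proof
  assume U: "U \<in> SU2"
  then have 1: "U ** adjugate U = one" "adjugate U ** U = one" "U ** dagger U = one"
    by (auto simp: SU2_def mult_adjugate)
  have "dagger U = (adjugate U ** U) ** dagger U" by (simp add: 1)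
  also have "\<dots> = adjugate U" by (simp add: matrix_mul_assoc[symmetric] 1(3))
  finally show "U ** adjugate U = one \<and> dagger U = adjugate U" using 1 by simp
next
  assume U: "U ** adjugate U = one \<and> dagger U = adjugate U"
  then have "mat (det U) = one" by (simp add: mult_adjugate)
  then have "det U = 1" by (simp add: mat2_simps)
  then show "U \<in> SU2" using U by (simp add: SU2_def)
qed

lemma SU2D:
  assumes "p \<in> SU2"
  shows "p ** dagger p = one" "dagger p ** p = one" "adjugate p = dagger p"
proof -
  have "det p = 1" "p ** dagger p = one" using assms by (auto simp: SU2_def)
  moreover have "dagger p = adjugate p" using assms SU2_iff by blast
  ultimately show "p ** dagger p = one" "dagger p ** p = one" "adjugate p = dagger p"
    using mult_adjugate[of p] by auto
qed

lemma SU2_cancel: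
  assumes "p \<in> SU2"
  shows "dagger p ** (p ** x) = x" "p ** (dagger p ** x) = x" "x ** dagger p ** p = x" "x ** p ** dagger p = x"
  using SU2D[OF assms] by (simp_all add: matrix_mul_assoc[symmetric]) (simp_all add: matrix_mul_assoc)

lemma SU2_dagger:
  assumes "p \<in> SU2"
  shows "dagger p \<in> SU2"
proof -
  have "adjugate (dagger p) = p" unfolding SU2D(3)[OF assms, symmetric] by simp
  then show ?thesis using SU2D(2)[OF assms] by (simp add: SU2_iff)
qed

lemma SU2_mult:
  assumes "p \<in> SU2" "q \<in> SU2"
  shows "p ** q \<in> SU2"
  unfolding SU2_iff[of "p ** q"] dagger_mult adjugate_mult
  using SU2D[OF assms(1)] SU2D[OF assms(2)] SU2_cancel[OF assms(2)]
  by (simp add: matrix_mul_assoc[symmetric])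

lemma SU2_one: "one \<in> SU2"
  by (simp add: SU2_iff)

definition su :: "cmat2 set" where
  "su = {x. dagger x = - x \<and> adjugate x = - x}"

lemma suD: "x \<in> su \<Longrightarrow> dagger x = - x" "x \<in> su \<Longrightarrow> adjugate x = - x"
  by (auto simp: su_def)

lemma subspace_su: "subspace su"
  by (auto simp: subspace_def su_def dagger_add adjugate_add dagger_scaleR adjugate_scaleR dagger_zero adjugate_zero)

lemmas su_add = subspace_add[OF subspace_su]
lemmas su_diff = subspace_diff[OF subspace_su]
lemmas su_neg = subspace_neg[OF subspace_su]
lemmas su_scale = subspace_scale[OF subspace_su]
lemmas su_zero = subspace_0[OF subspace_su]
lemmas su_sum = subspace_sum[OF subspace_su]

definition bracket :: "cmat2 \<Rightarrow> cmat2 \<Rightarrow> cmat2" where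
  "bracket x y = x ** y - y ** x"

lemma bounded_bilinear_bracket: "bounded_bilinear bracket"
  unfolding bilinear_conv_bounded_bilinear[symmetric] bilinear_def bracket_def
  by (auto intro!: linearI simp: mm_simps scaleR_diff_right)

interpretation br: bounded_bilinear bracket
  by (rule bounded_bilinear_bracket)

lemma bracket_su: "x \<in> su \<Longrightarrow> y \<in> su \<Longrightarrow> bracket x y \<in> su"
  by (auto simp: su_def bracket_def dagger_diff adjugate_diff dagger_mult adjugate_mult mm_simps)

lemma bracket_self [simp]: "bracket x x = 0"
  by (simp add: bracket_def)

lemma bracket_swap: "bracket x y = - bracket y x"
  by (simp add: bracket_def)

lemma bracket_invariant:
  assumes "x \<in> su" "y \<in> su" "z \<in> su"
  shows "bracket x y \<bullet> z = x \<bullet> bracket y z"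
  using inner_mult_right[of x y z] inner_mult_left[of y x z] suD[OF assms(2)]
  by (simp add: bracket_def inner_diff_left inner_diff_right mm_simps)

lemma su_elements: "x \<in> su \<longleftrightarrow>
   Re (x $ 1 $ 1) = 0 \<and> x $ 2 $ 2 = - x $ 1 $ 1 \<and> x $ 2 $ 1 = - cnj (x $ 1 $ 2)"
  by (auto simp: su_def mat2_simps complex_eq_iff)

text \<open>The Clifford relation of the imaginary quaternions. The inner product is the one of the ambient space
  of matrices, which is twice the quaternionic one.\<close>

lemma su_anticommutator:
  assumes "x \<in> su" "y \<in> su"
  shows "x ** y + y ** x = - (x \<bullet> y) *\<^sub>R one"
  using assms
  by (auto simp: su_elements mat2_simps inner_vec_def inner_complex_def complex_eq_iff)

lemma su_square: "x \<in> su \<Longrightarrow> x ** x = - ((x \<bullet> x) / 2) *\<^sub>R one"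
  using su_anticommutator[of x x] by (metis (no_types, lifting) divide_minus_left scaleR_half_double
      scaleR_scaleR times_divide_eq_left mult_1 mult.commute)

lemma has_vector_derivative_scaleR_const:
  "(f has_real_derivative f') (at t) \<Longrightarrow> ((\<lambda>t. f t *\<^sub>R x) has_vector_derivative f' *\<^sub>R x) (at t)"
  using has_vector_derivative_scaleR[OF _ has_vector_derivative_const, of f f' t UNIV x] by simp

text \<open>The square of \<open>x\<close> is a scalar, so the exponential series of \<open>t x\<close> sums to a cosine and a sine.\<close>

lemma su_exp_exists:
  assumes x: "x \<in> su"
  shows "\<exists>E. (\<forall>t. E t \<in> SU2) \<and> E (0::real) = one \<and> (\<forall>t. (E has_vector_derivative E t ** x) (at t))"
proof (cases "x = 0")
  case True
  then show ?thesis
    by (intro exI[of _ "\<lambda>_. one"]) (auto simp: SU2_one mm.zero_right intro!: derivative_eq_intros)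
next
  case False
  define n where "n = sqrt ((x \<bullet> x) / 2)"
  have n: "n \<noteq> 0" using False by (simp add: n_def)
  have n2: "n * n = (x \<bullet> x) / 2" by (simp add: n_def)
  have xx: "x ** x = - (n * n) *\<^sub>R one" using su_square[OF x] n2 by simp
  define E where "E = (\<lambda>t. cos (n * t) *\<^sub>R one + (sin (n * t) / n) *\<^sub>R x)"
  have "E t \<in> SU2" for t
    using n suD[OF x] sin_cos_squared_add[of "n * t"]
    by (auto simp: SU2_iff E_def dagger_add adjugate_add dagger_scaleR adjugate_scaleR mm_simps xx algebra_simps
        power2_eq_square scaleR_left_distrib[symmetric])
  moreover have "(E has_vector_derivative E t ** x) (at t)" for t
  proof -
    have "((\<lambda>t. cos (n * t)) has_real_derivative - n * sin (n * t)) (at t)"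
      "((\<lambda>t. sin (n * t) / n) has_real_derivative cos (n * t)) (at t)"
      using n by (auto intro!: derivative_eq_intros)
    then have "(E has_vector_derivative (- n * sin (n * t)) *\<^sub>R one + cos (n * t) *\<^sub>R x) (at t)"
      unfolding E_def by (intro has_vector_derivative_add has_vector_derivative_scaleR_const)
    then show ?thesis using n by (simp add: E_def mm_simps xx mult.commute)
  qed
  ultimately show ?thesis by (intro exI[of _ E]) (auto simp: E_def)
qed

lemma smooth_flow:
  fixes x :: cmat2 and E :: "real \<Rightarrow> cmat2"
  assumes "\<And>t. (E has_vector_derivative E t ** x) (at t)"
  shows "smooth_on (UNIV :: real set) E"
proof (rule smooth_on_ode_solution[where G = "\<lambda>z :: cmat2. z ** x", OF open_UNIV assms])
  show "smooth_on UNIV (\<lambda>z :: cmat2. z ** x)"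
    by (rule smooth_on_linear[where f = "\<lambda>z. z"]) (auto intro: mm.bounded_linear_left smooth_on_id)
qed

text \<open>The Lie algebra is the zero set of two linear maps, and these maps commute with the derivative.\<close>

lemma has_vector_derivative_in_su:
  assumes u: "(u has_vector_derivative u') (at (0::real))" and e: "e > 0" "\<And>t. \<bar>t\<bar> < e \<Longrightarrow> u t \<in> su"
  shows "u' \<in> su"
proof -
  have "L u' = 0" if L: "bounded_linear L" and z: "\<And>x. x \<in> su \<Longrightarrow> L x = 0" for L :: "cmat2 \<Rightarrow> cmat2"
  proof -
    have "((\<lambda>t. L (u t)) has_vector_derivative L u') (at 0)"
      by (rule bounded_linear.has_vector_derivative[OF L u])
    moreover have "((\<lambda>t. L (u t)) has_vector_derivative 0) (at 0)"
      by (rule has_vector_derivative_transform_within_open[where S = "{-e<..<e}" and f = "\<lambda>_. 0"])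
        (use e z in \<open>auto intro!: derivative_eq_intros\<close>)
    ultimately show ?thesis by (rule vector_derivative_unique_at)
  qed
  from this[of "\<lambda>x. dagger x + x"] this[of "\<lambda>x. adjugate x + x"]
    bounded_linear_add[OF bounded_linear_dagger bounded_linear_ident]
    bounded_linear_add[OF bounded_linear_adjugate bounded_linear_ident]
  have "dagger u' + u' = 0" "adjugate u' + u' = 0"
    by (auto simp: suD)
  then show ?thesis by (auto simp: su_def eq_neg_iff_add_eq_0)
qed

text \<open>One inclusion differentiates the two equations \<open>L (c t) ** c t = one\<close>, where \<open>L\<close> is one of the two
  anti-involutions; for the other one, translated one-parameter subgroups are curves in every direction.\<close>

lemma tangent_space_SU2_iff:
  assumes p: "p \<in> SU2"
  shows "v \<in> tangent_space SU2 p \<longleftrightarrow> dagger p ** v \<in> su"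
proof
  assume "v \<in> tangent_space SU2 p"
  then obtain e c where e: "e > 0" "c ` {-e<..<e} \<subseteq> SU2" "c (0::real) = p"
    "(c has_vector_derivative v) (at 0)"
    unfolding tangent_space_def by blast
  have cS: "c t \<in> SU2" if "\<bar>t\<bar> < e" for t
    using image_subset_iff[THEN iffD1, OF e(2)] that by (simp add: abs_less_iff)
  have der: "(if b then dagger v else adjugate v) ** p + dagger p ** v = 0" for b
  proof -
    let ?L = "if b then dagger else adjugate"
    have L: "bounded_linear ?L" by (simp add: bounded_linear_dagger bounded_linear_adjugate)
    have "((\<lambda>t. ?L (c t) ** c t) has_vector_derivative ?L p ** v + ?L v ** p) (at 0)"
      using bounded_bilinear.has_vector_derivative[OF bounded_bilinear_mat_mult
          bounded_linear.has_vector_derivative[OF L e(4)] e(4)] e(3) by simp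
    moreover have "((\<lambda>t. ?L (c t) ** c t) has_vector_derivative 0) (at 0)"
      by (rule has_vector_derivative_transform_within_open[where S = "{-e<..<e}" and f = "\<lambda>_. one"])
        (use e(1) cS SU2D in \<open>auto intro!: derivative_eq_intros\<close>)
    ultimately have "?L p ** v + ?L v ** p = 0" by (rule vector_derivative_unique_at)
    then show ?thesis using SU2D(3)[OF p] by (auto simp: add.commute split: if_splits)
  qed
  show "dagger p ** v \<in> su"
    using der[of True] der[of False] SU2D(3)[OF p] SU2D(3)[OF SU2_dagger[OF p]]
    by (auto simp: su_def dagger_mult adjugate_mult eq_neg_iff_add_eq_0)
next
  assume x: "dagger p ** v \<in> su"
  obtain E where E: "\<And>t. E t \<in> SU2" "E (0::real) = one"
    "\<And>t. (E has_vector_derivative E t ** (dagger p ** v)) (at t)"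
    using su_exp_exists[OF x] by blast
  have "smooth_on {-1<..<1} (\<lambda>t. p ** E t)"
    by (rule smooth_on_subset[OF smooth_on_linear[OF mm.bounded_linear_right open_UNIV
            smooth_flow[OF E(3)]]]) simp
  moreover have "((\<lambda>t. p ** E t) has_vector_derivative v) (at 0)"
    using bounded_linear.has_vector_derivative[OF mm.bounded_linear_right[of p] E(3)[of 0]] E(2) p
    by (simp add: SU2_cancel)
  ultimately show "v \<in> tangent_space SU2 p"
    unfolding tangent_space_def using E p
    by (auto intro!: exI[of _ "1::real"] exI[of _ "\<lambda>t. p ** E t"] SU2_mult)
qed

lemma tangent_SU2I: "p \<in> SU2 \<Longrightarrow> x \<in> su \<Longrightarrow> p ** x \<in> tangent_space SU2 p"
  by (simp add: tangent_space_SU2_iff SU2_cancel)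

lemma su2_eq_su: "su2 = su"
  using tangent_space_SU2_iff[OF SU2_one] by (auto simp: su2_def)

lemma tangent_bundle_SU2_iff: "(p, v) \<in> tangent_bundle SU2 \<longleftrightarrow> p \<in> SU2 \<and> dagger p ** v \<in> su"
  by (auto simp: tangent_bundle_def tangent_space_SU2_iff)

text \<open>Left trivialization of the second tangent bundle: at \<open>(p, p u)\<close> a curve \<open>(c, c w)\<close> in the tangent bundle,
  with \<open>w\<close> in the Lie algebra, has velocity \<open>(p \<xi>, p (\<xi> u + \<eta>))\<close> where \<open>c' = p \<xi>\<close> and \<open>w' = \<eta>\<close>.\<close>

lemma tangent_space_TSU2_iff:
  assumes pv: "(p, v) \<in> tangent_bundle SU2"
  shows "(a, b) \<in> tangent_space (tangent_bundle SU2) (p, v) \<longleftrightarrow>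
     dagger p ** a \<in> su \<and> dagger p ** b - (dagger p ** a) ** (dagger p ** v) \<in> su"
proof
  have p: "p \<in> SU2" and u: "dagger p ** v \<in> su" using pv by (auto simp: tangent_bundle_SU2_iff)
  {
    assume "(a, b) \<in> tangent_space (tangent_bundle SU2) (p, v)"
    then obtain e c where e: "e > 0" "smooth_on {-e<..<e} c" "c ` {-e<..<e} \<subseteq> tangent_bundle SU2"
      "c (0::real) = (p, v)" "(c has_vector_derivative (a, b)) (at 0)"
      unfolding tangent_space_def by blast
    have d1: "((\<lambda>t. fst (c t)) has_vector_derivative a) (at 0)"
      using bounded_linear.has_vector_derivative[OF bounded_linear_fst e(5)] by simp
    have d2: "((\<lambda>t. snd (c t)) has_vector_derivative b) (at 0)"
      using bounded_linear.has_vector_derivative[OF bounded_linear_snd e(5)] by simp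
    have mem: "fst (c t) \<in> SU2 \<and> dagger (fst (c t)) ** snd (c t) \<in> su" if "\<bar>t\<bar> < e" for t
      using image_subset_iff[THEN iffD1, OF e(3)] that tangent_bundle_SU2_iff[of "fst (c t)" "snd (c t)"]
      by (simp add: abs_less_iff)
    have "a \<in> tangent_space SU2 p"
      unfolding tangent_space_def using e d1 mem
      by (auto intro!: exI[of _ e] exI[of _ "\<lambda>t. fst (c t)"] smooth_on_linear[OF bounded_linear_fst])
    then have a: "dagger p ** a \<in> su" using p by (simp add: tangent_space_SU2_iff)
    have "((\<lambda>t. dagger (fst (c t)) ** snd (c t)) has_vector_derivative dagger p ** b + dagger a ** v) (at 0)"
      using bounded_bilinear.has_vector_derivative[OF bounded_bilinear_mat_mult
          bounded_linear.has_vector_derivative[OF bounded_linear_dagger d1] d2] e(4) by simp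
    from has_vector_derivative_in_su[OF this e(1)] mem
    have "dagger p ** b + dagger a ** v \<in> su" by simp
    moreover have "dagger a ** v = - (dagger p ** a) ** (dagger p ** v)"
    proof -
      have "dagger a ** v = dagger (dagger p ** a) ** (dagger p ** v)"
        using p by (simp add: dagger_mult mm_simps SU2_cancel)
      then show ?thesis using suD[OF a] by simp
    qed
    ultimately show "dagger p ** a \<in> su \<and> dagger p ** b - (dagger p ** a) ** (dagger p ** v) \<in> su"
      using a by (simp add: mm_simps)
  }
  {
    assume "dagger p ** a \<in> su \<and> dagger p ** b - (dagger p ** a) ** (dagger p ** v) \<in> su"
    then obtain \<xi> \<eta> where \<xi>: "\<xi> = dagger p ** a" "\<xi> \<in> su"
      and \<eta>: "\<eta> = dagger p ** b - \<xi> ** (dagger p ** v)" "\<eta> \<in> su" by blast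
    obtain E where E: "\<And>t. E t \<in> SU2" "E (0::real) = one"
      "\<And>t. (E has_vector_derivative E t ** \<xi>) (at t)"
      using su_exp_exists[OF \<xi>(2)] by blast
    define u where "u = (\<lambda>t::real. dagger p ** v + t *\<^sub>R \<eta>)"
    define c where "c = (\<lambda>t. (p ** E t, (p ** E t) ** u t))"
    have su: "smooth_on UNIV u" unfolding u_def
      by (intro smooth_on_add smooth_on_const open_UNIV
          smooth_on_linear[OF bounded_linear_scaleR_left] smooth_on_id)
    have sE: "smooth_on UNIV (\<lambda>t. p ** E t)"
      by (rule smooth_on_linear[OF mm.bounded_linear_right open_UNIV smooth_flow[OF E(3)]])
    have sc: "smooth_on {-1<..<1} c" unfolding c_def
      by (rule smooth_on_subset[OF smooth_on_Pair[OF open_UNIV sE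
              smooth_on_bilinear[OF bounded_bilinear_mat_mult open_UNIV sE su]]]) simp
    have dE: "((\<lambda>t. p ** E t) has_vector_derivative a) (at 0)"
      using bounded_linear.has_vector_derivative[OF mm.bounded_linear_right[of p] E(3)[of 0]] E(2) p
      by (simp add: SU2_cancel \<xi>(1))
    have du: "(u has_vector_derivative \<eta>) (at 0)"
      unfolding u_def by (auto intro!: derivative_eq_intros)
    have "((\<lambda>t. (p ** E t) ** u t) has_vector_derivative p ** \<eta> + a ** (dagger p ** v)) (at 0)"
      using bounded_bilinear.has_vector_derivative[OF bounded_bilinear_mat_mult dE du] E(2)
      by (simp add: u_def)
    moreover have "p ** \<eta> + a ** (dagger p ** v) = b"
      using p by (simp add: \<eta>(1) \<xi>(1) mm_simps SU2_cancel)
    ultimately have dc: "(c has_vector_derivative (a, b)) (at 0)"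
      unfolding c_def using has_vector_derivative_Pair[OF dE] by auto
    have mem: "c t \<in> tangent_bundle SU2" for t
    proof -
      have "p ** E t \<in> SU2" using p E by (intro SU2_mult)
      moreover have "u t \<in> su" unfolding u_def by (intro su_add su_scale u \<eta>(2))
      ultimately show ?thesis
        unfolding c_def tangent_bundle_SU2_iff by (simp add: SU2_cancel)
    qed
    have "c 0 = (p, v)" using p E(2) by (simp add: c_def u_def SU2_cancel)
    then show "(a, b) \<in> tangent_space (tangent_bundle SU2) (p, v)"
      unfolding tangent_space_def using sc dc mem
      by (auto intro!: exI[of _ "1::real"] exI[of _ c])
  }
qed

section \<open>The Levi-Civita connection of a left invariant metric\<close>

lemma chain_rule_within:
  assumes f: "(f has_derivative f') (at (c t) within S)" and N: "open N" "t \<in> N" "c ` N \<subseteq> S"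
    and c: "(c has_vector_derivative v) (at (t::real))"
  shows "((\<lambda>s. f (c s)) has_vector_derivative f' v) (at t)"
proof -
  have c': "(c has_derivative (\<lambda>h. h *\<^sub>R v)) (at t within N)"
    using c by (simp add: has_vector_derivative_def has_derivative_at_withinI)
  have "(f has_derivative f') (at (c t) within (c ` N))"
    using f N(3) by (auto intro: has_derivative_subset)
  from has_derivative_in_compose[OF c' this]
  have "((\<lambda>t. f (c t)) has_derivative (\<lambda>h. f' (h *\<^sub>R v))) (at t)"
    using at_within_open[OF N(2,1)] by simp
  moreover have "f' (h *\<^sub>R v) = h *\<^sub>R f' v" for h
    using has_derivative_linear[OF f] by (simp add: linear_cmul)
  ultimately show ?thesis by (simp add: has_vector_derivative_def)
qed

lemma smooth_map_has_derivative:
  assumes "smooth_map S f" "p \<in> S"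
  shows "(f has_derivative frechet_derivative f (at p within S)) (at p within S)"
proof -
  obtain U F where U: "open U" "p \<in> U" "smooth_on U F" "\<And>q. q \<in> U \<inter> S \<Longrightarrow> F q = f q"
    using smooth_mapE[OF assms] by blast
  have "(f has_derivative FD F p) (at p within (UNIV \<inter> S))"
    using derivative_within_extension(1)[OF smooth_on_has_derivative[OF U(3,2)] U(1,2) _ assms(2), of UNIV f] U(4)
    by auto
  then show ?thesis using frechet_derivative_works unfolding differentiable_def by auto
qed

lemma frechet_derivative_within_eq:
  assumes "(f has_derivative f') (at p within S)" "v \<in> tangent_space S p"
  shows "frechet_derivative f (at p within S) v = f' v"
proof -
  have "(f has_derivative frechet_derivative f (at p within S)) (at p within S)"
    using assms(1) frechet_derivative_works unfolding differentiable_def by blast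
  from tangent_derivative_unique[of f _ p UNIV S, simplified, OF this assms] show ?thesis .
qed

lemma derivative_in_su:
  assumes y: "smooth_map SU2 y" "\<And>q. q \<in> SU2 \<Longrightarrow> y q \<in> su" and p: "p \<in> SU2"
    and v: "v \<in> tangent_space SU2 p"
  shows "frechet_derivative y (at p within SU2) v \<in> su"
proof -
  obtain e c where e: "e > 0" "c ` {-e<..<e} \<subseteq> SU2" "c (0::real) = p"
    "(c has_vector_derivative v) (at 0)"
    using v unfolding tangent_space_def by blast
  have "((\<lambda>t. y (c t)) has_vector_derivative frechet_derivative y (at p within SU2) v) (at 0)"
    using chain_rule_within[of y _ c 0 SU2 "{-e<..<e}" v] smooth_map_has_derivative[OF y(1) p] e by auto
  then show ?thesis
    by (rule has_vector_derivative_in_su[OF _ e(1)])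
      (use e(2) y(2) in \<open>auto simp: image_subset_iff abs_less_iff\<close>)
qed

lemma smooth_map_id: "smooth_map S (\<lambda>q. q)"
  by (rule smooth_mapI[OF smooth_on_id[OF open_UNIV]])

lemma smooth_map_const: "smooth_map S (\<lambda>q. a)"
  by (rule smooth_mapI[OF smooth_on_const])

lemma smooth_map_mult:
  fixes f h :: "_ \<Rightarrow> cmat2"
  shows "smooth_map S f \<Longrightarrow> smooth_map S h \<Longrightarrow> smooth_map S (\<lambda>q. f q ** h q)"
  by (rule smooth_map_bilinear[OF bounded_bilinear_mat_mult])

text \<open>A vector field on the group is the same as a map to the Lie algebra, its left translate.\<close>

lemma vector_field_body:
  assumes "vector_field SU2 Y"
  shows "smooth_map SU2 (\<lambda>q. dagger q ** Y q)" "\<And>q. q \<in> SU2 \<Longrightarrow> dagger q ** Y q \<in> su"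
  using assms tangent_space_SU2_iff
  by (auto simp: vector_field_def intro!: smooth_map_mult
      smooth_map_linear[OF bounded_linear_dagger] smooth_map_id)

lemma vector_fieldI_body:
  assumes "smooth_map SU2 y" "\<And>q. q \<in> SU2 \<Longrightarrow> y q \<in> su"
  shows "vector_field SU2 (\<lambda>q. q ** y q)"
  using assms by (auto simp: vector_field_def intro!: smooth_map_mult smooth_map_id tangent_SU2I)

lemma left_invariant_field: "x \<in> su \<Longrightarrow> vector_field SU2 (\<lambda>q. q ** x)"
  by (rule vector_fieldI_body) (auto intro: smooth_map_const)

lemma vector_field_add:
  assumes "vector_field SU2 Y" "vector_field SU2 Z"
  shows "vector_field SU2 (\<lambda>q. Y q + Z q)"
  using assms
  by (auto simp: vector_field_def tangent_space_SU2_iff mm_simps intro!: smooth_map_add su_add)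

lemma vector_field_scale:
  assumes "vector_field SU2 Y" "smooth_map SU2 (f :: _ \<Rightarrow> real)"
  shows "vector_field SU2 (\<lambda>q. f q *\<^sub>R Y q)"
  using assms
  by (auto simp: vector_field_def tangent_space_SU2_iff mm_simps
      intro!: smooth_map_bilinear[OF bounded_bilinear_scaleR] su_scale)

text \<open>Orthogonal projection onto the Lie algebra. The images of the standard basis of the matrix
  space are a spanning family of the Lie algebra with smooth coefficients, which is
  all that is needed of a frame.\<close>

definition pr_su :: "cmat2 \<Rightarrow> cmat2" where
  "pr_su x = (1/4) *\<^sub>R (x - dagger x - adjugate x + dagger (adjugate x))"

lemma dagger_adjugate: "dagger (adjugate x) = adjugate (dagger x)"
  by (simp add: mat2_simps)

lemma linear_pr_su: "linear pr_su"
  unfolding pr_su_def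
  by (auto intro!: linearI simp: dagger_add dagger_scaleR adjugate_add adjugate_scaleR algebra_simps)

lemma pr_su_in: "pr_su x \<in> su"
  by (simp add: su_def pr_su_def dagger_add dagger_diff dagger_scaleR adjugate_add adjugate_diff
      adjugate_scaleR dagger_adjugate scaleR_minus_right[symmetric] del: scaleR_minus_right)

lemma pr_su_id: "x \<in> su \<Longrightarrow> pr_su x = x"
proof -
  assume "x \<in> su"
  then have "pr_su x = (1/4) *\<^sub>R ((1 + 1 + 1 + 1) *\<^sub>R x)"
    unfolding pr_su_def scaleR_left_distrib scaleR_one by (simp only: suD dagger_minus) simp
  then show ?thesis by simp
qed

lemma su_expansion: "x \<in> su \<Longrightarrow> x = (\<Sum>b\<in>Basis. (x \<bullet> b) *\<^sub>R pr_su b)"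
  using linear_basis_expansion[OF linear_pr_su, of x] pr_su_id by simp

text \<open>The metric is \<open>\<langle>A x, y\<rangle>\<close> in the left trivialization. The operators are linear on the whole matrix
  space, so that they can be differentiated there; \<open>Ai\<close> is the inverse of \<open>A\<close> on the Lie algebra.\<close>

locale left_invariant_metric =
  fixes A Ai :: "cmat2 \<Rightarrow> cmat2" and g :: "cmat2 \<Rightarrow> cmat2 \<Rightarrow> cmat2 \<Rightarrow> real"
  assumes linear_A: "linear A" and linear_Ai: "linear Ai"
    and A_su: "\<And>x. x \<in> su \<Longrightarrow> A x \<in> su" and Ai_su: "\<And>x. x \<in> su \<Longrightarrow> Ai x \<in> su"
    and A_Ai: "\<And>x. x \<in> su \<Longrightarrow> A (Ai x) = x"
    and self_adjoint: "\<And>x y. x \<in> su \<Longrightarrow> y \<in> su \<Longrightarrow> A x \<bullet> y = x \<bullet> A y"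
    and g_eq: "\<And>p x y. p \<in> SU2 \<Longrightarrow> x \<in> su \<Longrightarrow> y \<in> su \<Longrightarrow> g p (p ** x) (p ** y) = A x \<bullet> y"
begin

text \<open>The Levi-Civita connection on left invariant fields, from the Koszul formula. On the diagonal it is the
  negative of the right hand side of Euler's equation.\<close>

definition B :: "cmat2 \<Rightarrow> cmat2 \<Rightarrow> cmat2" where
  "B x y = (1/2) *\<^sub>R Ai (A (bracket x y) + bracket y (A x) + bracket x (A y))"

lemma bounded_bilinear_B: "bounded_bilinear B"
  unfolding bilinear_conv_bounded_bilinear[symmetric] bilinear_def B_def
  by (auto intro!: linearI simp: br.add_left br.add_right br.scaleR_left br.scaleR_right
      linear_add[OF linear_A] linear_add[OF linear_Ai] linear_scale[OF linear_A] linear_scale[OF linear_Ai]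
      algebra_simps)

sublocale B: bounded_bilinear B
  by (rule bounded_bilinear_B)

lemma B_su: "x \<in> su \<Longrightarrow> y \<in> su \<Longrightarrow> B x y \<in> su"
  unfolding B_def by (intro su_scale Ai_su su_add A_su bracket_su)

lemma A_B: "x \<in> su \<Longrightarrow> y \<in> su \<Longrightarrow>
    A (B x y) = (1/2) *\<^sub>R (A (bracket x y) + bracket y (A x) + bracket x (A y))"
  unfolding B_def by (simp add: linear_scale[OF linear_A] A_Ai su_add A_su bracket_su)

lemma nondegenerate:
  assumes d: "d \<in> su" and "\<And>z. z \<in> su \<Longrightarrow> A d \<bullet> z = 0"
  shows "d = 0"
proof -
  have "A d \<bullet> Ai d = d \<bullet> d" using self_adjoint[OF d Ai_su[OF d]] A_Ai[OF d] by simp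
  then show ?thesis using assms(2)[OF Ai_su[OF d]] by simp
qed

lemma B_torsion:
  assumes "x \<in> su" "y \<in> su"
  shows "B x y - B y x = bracket x y"
proof -
  have "B x y - B y x = Ai (A (bracket x y))"
    unfolding B_def bracket_swap[of y x]
    by (simp add: linear_diff[OF linear_Ai, symmetric] linear_neg[OF linear_A] br.minus_left
        scaleR_diff_right[symmetric] linear_add[OF linear_Ai] linear_neg[OF linear_Ai] flip: scaleR_2)
  moreover have "A (Ai (A (bracket x y)) - bracket x y) \<bullet> z = 0" for z
    using assms by (simp add: linear_diff[OF linear_A] A_Ai A_su bracket_su)
  then have "Ai (A (bracket x y)) - bracket x y = 0"
    using assms by (intro nondegenerate su_diff Ai_su A_su bracket_su)
  ultimately show ?thesis by simp
qed

text \<open>Skewness of the covariant derivative with respect to the metric. Everything cancels in pairs because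
  the inner product is invariant under the adjoint action.\<close>

lemma B_metric:
  assumes "x \<in> su" "y \<in> su" "z \<in> su"
  shows "A (B x y) \<bullet> z + A y \<bullet> B x z = 0"
proof -
  have "A y \<bullet> B x z = A (B x z) \<bullet> y"
    using self_adjoint[OF assms(2) B_su] assms by (simp add: inner_commute)
  moreover have "A (bracket x y) \<bullet> z = - (bracket x (A z) \<bullet> y)"
    using self_adjoint[of "bracket x y" z] bracket_invariant[of "A z" x y] bracket_swap[of "A z" x] assms
    by (simp add: bracket_su A_su inner_commute)
  moreover have "A (bracket x z) \<bullet> y = - (bracket x (A y) \<bullet> z)"
    using self_adjoint[of "bracket x z" y] bracket_invariant[of "A y" x z] bracket_swap[of "A y" x] assms
    by (simp add: bracket_su A_su inner_commute)
  moreover have "bracket y (A x) \<bullet> z = - (bracket z (A x) \<bullet> y)"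
    using bracket_invariant[of y "A x" z] bracket_swap[of "A x" z] assms
    by (simp add: A_su inner_commute)
  moreover have "A (B x y) \<bullet> z = (A (bracket x y) \<bullet> z + bracket y (A x) \<bullet> z + bracket x (A y) \<bullet> z) / 2"
    "A (B x z) \<bullet> y = (A (bracket x z) \<bullet> y + bracket z (A x) \<bullet> y + bracket x (A z) \<bullet> y) / 2"
    using assms by (simp_all add: A_B inner_add_left)
  ultimately show ?thesis by simp
qed

text \<open>A difference of two solutions is
  symmetric in its first two arguments and skew in the last two, hence zero.\<close>

lemma B_unique:
  assumes N: "\<And>x y. x \<in> su \<Longrightarrow> y \<in> su \<Longrightarrow> N x y \<in> su"
    and tor: "\<And>x y. x \<in> su \<Longrightarrow> y \<in> su \<Longrightarrow> N x y - N y x = bracket x y"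
    and met: "\<And>x y z. x \<in> su \<Longrightarrow> y \<in> su \<Longrightarrow> z \<in> su \<Longrightarrow> A (N x y) \<bullet> z + A y \<bullet> N x z = 0"
    and xy: "x \<in> su" "y \<in> su"
  shows "N x y = B x y"
proof -
  define T where "T = (\<lambda>x y z. A (N x y - B x y) \<bullet> z)"
  have sym: "T x y z = T y x z" if "x \<in> su" "y \<in> su" for x y z
  proof -
    have "N x y - B x y = N y x - B y x" using tor[OF that] B_torsion[OF that] by (simp add: algebra_simps)
    then show ?thesis by (simp add: T_def)
  qed
  have skew: "T x y z = - T x z y" if "x \<in> su" "y \<in> su" "z \<in> su" for x y z
  proof -
    have "A y \<bullet> N x z = A (N x z) \<bullet> y" "A y \<bullet> B x z = A (B x z) \<bullet> y"
      using self_adjoint[OF N[OF that(1,3)] that(2)] self_adjoint[OF B_su[OF that(1,3)] that(2)]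
      by (simp_all add: inner_commute)
    then show ?thesis
      using met[OF that] B_metric[OF that] by (simp add: T_def linear_diff[OF linear_A] inner_diff_left)
  qed
  have "T x y z = 0" if z: "z \<in> su" for z
  proof -
    have "T x y z = - T y z x" using sym[OF xy] skew[of y x z] xy z by simp
    also have "\<dots> = T z x y" using sym[of y z] skew[of z y x] xy z by simp
    also have "\<dots> = - T x y z" using sym[of z x] skew[of x z y] xy z by simp
    finally show ?thesis by simp
  qed
  then have "N x y - B x y = 0" unfolding T_def
    using xy N B_su by (intro nondegenerate su_diff) auto
  then show ?thesis by simp
qed

text \<open>In the left trivialization a vector field is a function with values in a fixed vector space, and the
  connection is the derivative of this function plus a bilinear term.\<close>

definition connection :: "cmat2 \<Rightarrow> cmat2 \<Rightarrow> (cmat2 \<Rightarrow> cmat2) \<Rightarrow> cmat2" where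
  "connection p v Y = p ** (frechet_derivative (\<lambda>q. dagger q ** Y q) (at p within SU2) v
     + B (dagger p ** v) (dagger p ** Y p))"

lemma g_tangent:
  assumes "p \<in> SU2" "dagger p ** v \<in> su" "dagger p ** w \<in> su"
  shows "g p v w = A (dagger p ** v) \<bullet> (dagger p ** w)"
  using g_eq[OF assms] assms(1) by (simp add: SU2_cancel)

lemma lie_bracket_SU2:
  assumes V: "vector_field SU2 V" and W: "vector_field SU2 W" and p: "p \<in> SU2"
  shows "lie_bracket SU2 V W p = p ** (bracket (dagger p ** V p) (dagger p ** W p)
     + frechet_derivative (\<lambda>q. dagger q ** W q) (at p within SU2) (V p)
     - frechet_derivative (\<lambda>q. dagger q ** V q) (at p within SU2) (W p))"
proof -
  have *: "frechet_derivative Y (at p within SU2) v =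
      p ** frechet_derivative (\<lambda>q. dagger q ** Y q) (at p within SU2) v + v ** (dagger p ** Y p)"
    if Y: "vector_field SU2 Y" and v: "v \<in> tangent_space SU2 p" for Y v
  proof -
    have "((\<lambda>q. q ** (dagger q ** Y q)) has_derivative
        (\<lambda>v. p ** frechet_derivative (\<lambda>q. dagger q ** Y q) (at p within SU2) v + v ** (dagger p ** Y p)))
        (at p within SU2)"
      by (rule bounded_bilinear.FDERIV[OF bounded_bilinear_mat_mult has_derivative_ident
            smooth_map_has_derivative[OF vector_field_body(1)[OF Y] p]])
    then have "(Y has_derivative
        (\<lambda>v. p ** frechet_derivative (\<lambda>q. dagger q ** Y q) (at p within SU2) v + v ** (dagger p ** Y p)))
        (at p within SU2)"
      by (rule has_derivative_transform[rotated 2]) (use p in \<open>auto simp: SU2_cancel\<close>)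
    from frechet_derivative_within_eq[OF this v] show ?thesis .
  qed
  have "V p \<in> tangent_space SU2 p" "W p \<in> tangent_space SU2 p"
    using V W p by (auto simp: vector_field_def)
  then show ?thesis
    unfolding lie_bracket_def using V W p
    by (simp add: * bracket_def mm_simps SU2_cancel)
qed

lemma connection_is_levi_civita: "is_levi_civita SU2 g connection"
proof -
  let ?d = "\<lambda>Y p. frechet_derivative (\<lambda>q. dagger q ** Y q) (at p within SU2)"
  have der: "((\<lambda>q. dagger q ** Y q) has_derivative ?d Y p) (at p within SU2)"
    if "vector_field SU2 Y" "p \<in> SU2" for Y p
    using smooth_map_has_derivative[OF vector_field_body(1)] that by blast
  have tan: "V p \<in> tangent_space SU2 p" if "vector_field SU2 V" "p \<in> SU2" for V p
    using that by (auto simp: vector_field_def)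
  have dsu: "?d Y p v \<in> su" if "vector_field SU2 Y" "p \<in> SU2" "v \<in> tangent_space SU2 p" for Y p v
    using derivative_in_su[OF vector_field_body[OF that(1)] that(2,3)] .
  have field: "vector_field SU2 (\<lambda>p. connection p (V p) Y)"
    if V: "vector_field SU2 V" and Y: "vector_field SU2 Y" for V Y
    unfolding connection_def
    using dsu[OF Y _ tan[OF V]] vector_field_body[OF V] vector_field_body[OF Y]
    by (intro vector_fieldI_body smooth_map_add smooth_map_bilinear[OF bounded_bilinear_B]
        smooth_map_derivative_apply[OF _ V] su_add B_su) auto
  have lin1: "connection p (a *\<^sub>R v + b *\<^sub>R w) Y = a *\<^sub>R connection p v Y + b *\<^sub>R connection p w Y"
    if "p \<in> SU2" "vector_field SU2 Y" for p v w a b Y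
    using has_derivative_linear[OF der[OF that(2,1)]]
    by (simp add: connection_def linear_add linear_scale mm_simps B.add_left B.scaleR_left algebra_simps)
  have lin2: "connection p v (\<lambda>q. Y q + Z q) = connection p v Y + connection p v Z"
    if p: "p \<in> SU2" and v: "v \<in> tangent_space SU2 p" and Y: "vector_field SU2 Y" and Z: "vector_field SU2 Z"
    for p v Y Z
  proof -
    have "?d (\<lambda>q. Y q + Z q) p v = ?d Y p v + ?d Z p v"
      by (rule frechet_derivative_within_eq[OF _ v])
        (use has_derivative_add[OF der[OF Y p] der[OF Z p]] in \<open>simp add: mm_simps\<close>)
    then show ?thesis by (simp add: connection_def mm_simps B.add_right)
  qed
  have leibniz: "connection p v (\<lambda>q. f q *\<^sub>R Y q) =
      frechet_derivative f (at p within SU2) v *\<^sub>R Y p + f p *\<^sub>R connection p v Y"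
    if p: "p \<in> SU2" and v: "v \<in> tangent_space SU2 p" and f: "smooth_map SU2 f" and Y: "vector_field SU2 Y"
    for p v Y and f :: "cmat2 \<Rightarrow> real"
  proof -
    have "?d (\<lambda>q. f q *\<^sub>R Y q) p v = f p *\<^sub>R ?d Y p v + frechet_derivative f (at p within SU2) v *\<^sub>R (dagger p ** Y p)"
      by (rule frechet_derivative_within_eq[OF _ v])
        (use bounded_bilinear.FDERIV[OF bounded_bilinear_scaleR smooth_map_has_derivative[OF f p] der[OF Y p]]
         in \<open>simp add: mm_simps\<close>)
    then show ?thesis
      using p by (simp add: connection_def mm_simps B.scaleR_right SU2_cancel algebra_simps)
  qed
  have torsion: "connection p (V p) W - connection p (W p) V = lie_bracket SU2 V W p"
    if "vector_field SU2 V" "vector_field SU2 W" "p \<in> SU2" for V W p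
  proof -
    have "B (dagger p ** V p) (dagger p ** W p) - B (dagger p ** W p) (dagger p ** V p)
        = bracket (dagger p ** V p) (dagger p ** W p)"
      using that vector_field_body(2) by (intro B_torsion) auto
    then show ?thesis
      unfolding lie_bracket_SU2[OF that] connection_def
      by (simp add: mm.diff_right[symmetric] mm.add_right[symmetric]) (simp add: algebra_simps)
  qed
  have metric: "frechet_derivative (\<lambda>q. g q (Y q) (Z q)) (at p within SU2) v =
      g p (connection p v Y) (Z p) + g p (Y p) (connection p v Z)"
    if p: "p \<in> SU2" and v: "v \<in> tangent_space SU2 p" and Y: "vector_field SU2 Y" and Z: "vector_field SU2 Z"
    for p v Y Z
  proof -
    let ?y = "dagger p ** Y p" and ?z = "dagger p ** Z p" and ?x = "dagger p ** v"
    have su: "?y \<in> su" "?z \<in> su" "?x \<in> su" "?d Y p v \<in> su" "?d Z p v \<in> su"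
      using vector_field_body(2) Y Z p v dsu tangent_space_SU2_iff by auto
    have "((\<lambda>q. A (dagger q ** Y q) \<bullet> (dagger q ** Z q)) has_derivative
        (\<lambda>v. A ?y \<bullet> ?d Z p v + A (?d Y p v) \<bullet> ?z)) (at p within SU2)"
      by (rule bounded_bilinear.FDERIV[OF bounded_bilinear_inner bounded_linear.has_derivative[OF _ der[OF Y p]]
            der[OF Z p]]) (simp add: linear_A linear_conv_bounded_linear[symmetric])
    then have "((\<lambda>q. g q (Y q) (Z q)) has_derivative
        (\<lambda>v. A ?y \<bullet> ?d Z p v + A (?d Y p v) \<bullet> ?z)) (at p within SU2)"
      by (rule has_derivative_transform[rotated 2])
        (use p g_tangent vector_field_body(2) Y Z in auto)
    from frechet_derivative_within_eq[OF this v]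
    have 1: "frechet_derivative (\<lambda>q. g q (Y q) (Z q)) (at p within SU2) v
        = A ?y \<bullet> ?d Z p v + A (?d Y p v) \<bullet> ?z" .
    have 2: "g p (connection p v Y) (Z p) = A (?d Y p v + B ?x ?y) \<bullet> ?z"
      using p su by (subst g_tangent) (auto simp: connection_def SU2_cancel intro!: su_add B_su)
    have 3: "g p (Y p) (connection p v Z) = A ?y \<bullet> (?d Z p v + B ?x ?z)"
      using p su by (subst g_tangent) (auto simp: connection_def SU2_cancel intro!: su_add B_su)
    show ?thesis
      unfolding 1 2 3 using B_metric[OF su(3,1,2)]
      by (simp add: linear_add[OF linear_A] inner_add_left inner_add_right)
  qed
  show ?thesis
    unfolding is_levi_civita_def affine_connection_def
  proof (intro conjI allI ballI impI)
    fix V Y assume "vector_field SU2 V \<and> vector_field SU2 Y"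
    then show "vector_field SU2 (\<lambda>p. connection p (V p) Y)" by (intro field) auto
  next
    fix p v w a b Y assume "p \<in> SU2" "vector_field SU2 Y"
    then show "connection p (a *\<^sub>R v + b *\<^sub>R w) Y = a *\<^sub>R connection p v Y + b *\<^sub>R connection p w Y"
      by (rule lin1)
  next
    fix p v Y Z assume "p \<in> SU2" "v \<in> tangent_space SU2 p" "vector_field SU2 Y \<and> vector_field SU2 Z"
    then show "connection p v (\<lambda>q. Y q + Z q) = connection p v Y + connection p v Z"
      by (intro lin2) auto
  next
    fix p v Y and f :: "cmat2 \<Rightarrow> real"
    assume "p \<in> SU2" "v \<in> tangent_space SU2 p" "smooth_map SU2 f \<and> vector_field SU2 Y"
    then show "connection p v (\<lambda>q. f q *\<^sub>R Y q) =
        frechet_derivative f (at p within SU2) v *\<^sub>R Y p + f p *\<^sub>R connection p v Y"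
      by (intro leibniz) auto
  next
    fix V W p assume "vector_field SU2 V \<and> vector_field SU2 W" "p \<in> SU2"
    then show "connection p (V p) W - connection p (W p) V = lie_bracket SU2 V W p"
      by (intro torsion) auto
  next
    fix p v Y Z assume "p \<in> SU2" "v \<in> tangent_space SU2 p" "vector_field SU2 Y \<and> vector_field SU2 Z"
    then show "frechet_derivative (\<lambda>q. g q (Y q) (Z q)) (at p within SU2) v =
        g p (connection p v Y) (Z p) + g p (Y p) (connection p v Z)"
      by (intro metric) auto
  qed
qed

text \<open>On left invariant fields the connection is determined by its torsion and the metric (\<open>B_unique\<close>).
  An arbitrary field is a combination of left invariant ones with smooth coefficients, to which the product rule
  applies.\<close>

lemma levi_civita_eq:
  assumes lc: "is_levi_civita SU2 g nabla" and p: "p \<in> SU2" and v: "v \<in> tangent_space SU2 p"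
    and Y: "vector_field SU2 Y"
  shows "nabla p v Y = connection p v Y"
proof -
  note lc' = lc[unfolded is_levi_civita_def affine_connection_def]
  note field = lc'[THEN conjunct1, THEN conjunct1, rule_format, OF conjI]
  note add = lc'[THEN conjunct1, THEN conjunct2, THEN conjunct2, THEN conjunct1, rule_format, OF p v conjI]
  note leibniz = lc'[THEN conjunct1, THEN conjunct2, THEN conjunct2, THEN conjunct2, rule_format, OF p v conjI]
  note torsion = lc'[THEN conjunct2, THEN conjunct1, rule_format, OF conjI p]
  note metric = lc'[THEN conjunct2, THEN conjunct2, rule_format, OF p _ conjI]
  let ?x = "dagger p ** v"
  have x: "?x \<in> su" using v p by (simp add: tangent_space_SU2_iff)
  have dconst: "frechet_derivative (f :: cmat2 \<Rightarrow> real) (at p within SU2) w = 0"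
    if "\<And>q. q \<in> SU2 \<Longrightarrow> f q = a" "w \<in> tangent_space SU2 p" for f a w
  proof (rule frechet_derivative_within_eq[OF _ that(2), of _ "\<lambda>_. 0"])
    show "(f has_derivative (\<lambda>_. 0)) (at p within SU2)"
      by (rule has_derivative_transform[OF p _ has_derivative_const[of a]]) (use that(1) in auto)
  qed
  \<comment> \<open>Multiplication by the indicator function of the group shows that the values of a field
    outside the group do not matter.\<close>
  have cong: "nabla p v Y1 = nabla p v Y2"
    if 1: "vector_field SU2 Y1" and 2: "vector_field SU2 Y2" and eq: "\<And>q. q \<in> SU2 \<Longrightarrow> Y1 q = Y2 q" for Y1 Y2
  proof -
    define f where "f = (\<lambda>q. if q \<in> SU2 then 1 else 0 :: real)"
    have f: "smooth_map SU2 f"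
      by (rule smooth_map_cong[OF smooth_map_const[of _ 1]]) (simp add: f_def)
    have indicator: "nabla p v (\<lambda>q. f q *\<^sub>R Z q) = nabla p v Z" if "vector_field SU2 Z" for Z
      using leibniz[OF f that] dconst[of f 1, OF _ v] p by (simp add: f_def)
    have "(\<lambda>q. f q *\<^sub>R Y1 q) = (\<lambda>q. f q *\<^sub>R Y2 q)" using eq by (auto simp: f_def)
    then show ?thesis unfolding indicator[OF 1, symmetric] indicator[OF 2, symmetric] by (rule arg_cong)
  qed
  have left: "nabla p (p ** a) (\<lambda>q. q ** b) = p ** B a b" if "a \<in> su" "b \<in> su" for a b
  proof -
    define N where "N = (\<lambda>a b. dagger p ** nabla p (p ** a) (\<lambda>q. q ** b))"
    have N_su: "N a b \<in> su" if "a \<in> su" "b \<in> su" for a b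
      unfolding N_def
      using vector_field_body(2)[OF field[OF left_invariant_field[OF that(1)] left_invariant_field[OF that(2)]] p] .
    have nN: "nabla p (p ** a) (\<lambda>q. q ** b) = p ** N a b" for a b
      using p by (simp add: N_def SU2_cancel)
    have dz: "frechet_derivative (\<lambda>q. dagger q ** (q ** b)) (at p within SU2) (p ** a) = 0"
      if "a \<in> su" for a b :: cmat2
    proof (rule frechet_derivative_within_eq[OF _ tangent_SU2I[OF p that], of _ "\<lambda>_. 0"])
      show "((\<lambda>q. dagger q ** (q ** b)) has_derivative (\<lambda>_. 0)) (at p within SU2)"
        by (rule has_derivative_transform[OF p _ has_derivative_const[of b]]) (simp add: SU2_cancel)
    qed
    have "N a b = B a b"
    proof (rule B_unique[OF N_su _ _ that])
      fix x y assume x: "x \<in> su" and y: "y \<in> su"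
      have "p ** N x y - p ** N y x = p ** bracket x y"
        using torsion[OF left_invariant_field[OF x] left_invariant_field[OF y]] p
          lie_bracket_SU2[OF left_invariant_field[OF x] left_invariant_field[OF y] p] dz x y
        by (simp add: nN SU2_cancel)
      then have "dagger p ** (p ** (N x y - N y x)) = dagger p ** (p ** bracket x y)"
        by (simp add: mm.diff_right)
      then show "N x y - N y x = bracket x y" using p by (simp only: SU2_cancel)
      fix z assume z: "z \<in> su"
      have "0 = g p (p ** N x y) (p ** z) + g p (p ** y) (p ** N x z)"
        using metric[OF tangent_SU2I[OF p x] left_invariant_field[OF y] left_invariant_field[OF z]]
          dconst[of "\<lambda>q. g q (q ** y) (q ** z)" "A y \<bullet> z", OF _ tangent_SU2I[OF p x]] g_eq y z
        by (simp add: nN)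
      then show "A (N x y) \<bullet> z + A y \<bullet> N x z = 0"
        using g_eq p x y z N_su by simp
    qed
    then show ?thesis by (simp add: nN)
  qed
  have zero: "nabla p v (\<lambda>q. 0) = 0"
    using add[OF left_invariant_field[OF su_zero] left_invariant_field[OF su_zero]] by (simp add: mm.zero_right)
  let ?y = "\<lambda>q. dagger q ** Y q"
  note body = vector_field_body[OF Y]
  have coeff: "smooth_map SU2 (\<lambda>q. ?y q \<bullet> b)" for b
    by (rule smooth_map_linear[OF bounded_linear_inner_left body(1)])
  have summand: "vector_field SU2 (\<lambda>q. (?y q \<bullet> b) *\<^sub>R (q ** pr_su b))" for b
    by (rule vector_field_scale[OF left_invariant_field[OF pr_su_in] coeff])
  have sumfield: "vector_field SU2 (\<lambda>q. \<Sum>b\<in>F. (?y q \<bullet> b) *\<^sub>R (q ** pr_su b))" for F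
    using left_invariant_field[OF su_zero]
    by (induction F rule: infinite_finite_induct) (auto intro: vector_field_add summand simp: mm.zero_right)
  have nsum: "nabla p v (\<lambda>q. \<Sum>b\<in>F. (?y q \<bullet> b) *\<^sub>R (q ** pr_su b))
      = (\<Sum>b\<in>F. nabla p v (\<lambda>q. (?y q \<bullet> b) *\<^sub>R (q ** pr_su b)))" for F
    by (induction F rule: infinite_finite_induct) (auto simp: zero add[OF summand sumfield])
  let ?dy = "frechet_derivative ?y (at p within SU2) v"
  have dy: "?dy \<in> su" by (rule derivative_in_su[OF body p v])
  have dcoeff: "frechet_derivative (\<lambda>q. ?y q \<bullet> b) (at p within SU2) v = ?dy \<bullet> b" for b
    by (rule frechet_derivative_within_eq[OF bounded_linear.has_derivative[OF bounded_linear_inner_left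
            smooth_map_has_derivative[OF body(1) p]] v])
  have Yeq: "Y q = (\<Sum>b\<in>Basis. (?y q \<bullet> b) *\<^sub>R (q ** pr_su b))" if "q \<in> SU2" for q
  proof -
    have "Y q = q ** ?y q" using that by (simp add: SU2_cancel)
    also have "\<dots> = q ** (\<Sum>b\<in>Basis. (?y q \<bullet> b) *\<^sub>R pr_su b)" by (rule arg_cong[OF su_expansion[OF body(2)[OF that]]])
    finally show ?thesis by (simp add: mm.sum_right mm.scaleR_right)
  qed
  have "nabla p v Y = nabla p v (\<lambda>q. \<Sum>b\<in>Basis. (?y q \<bullet> b) *\<^sub>R (q ** pr_su b))"
    by (rule cong[OF Y sumfield Yeq])
  also have "\<dots> = (\<Sum>b\<in>Basis. (?dy \<bullet> b) *\<^sub>R (p ** pr_su b) + (?y p \<bullet> b) *\<^sub>R (p ** B ?x (pr_su b)))"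
    unfolding nsum
  proof (rule sum.cong[OF refl])
    fix b :: cmat2
    have "v = p ** ?x" using p by (simp add: SU2_cancel)
    then have "nabla p v (\<lambda>q. q ** pr_su b) = p ** B ?x (pr_su b)"
      using left[OF x pr_su_in] by metis
    then show "nabla p v (\<lambda>q. (?y q \<bullet> b) *\<^sub>R (q ** pr_su b)) =
        (?dy \<bullet> b) *\<^sub>R (p ** pr_su b) + (?y p \<bullet> b) *\<^sub>R (p ** B ?x (pr_su b))"
      using leibniz[OF coeff left_invariant_field[OF pr_su_in]] dcoeff by simp
  qed
  also have "\<dots> = p ** ((\<Sum>b\<in>Basis. (?dy \<bullet> b) *\<^sub>R pr_su b) + B ?x (\<Sum>b\<in>Basis. (?y p \<bullet> b) *\<^sub>R pr_su b))"
    by (simp add: sum.distrib mm.sum_right mm.scaleR_right mm.add_right B.sum_right B.scaleR_right)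
  also have "\<dots> = connection p v Y"
    unfolding connection_def using su_expansion[OF dy] su_expansion[OF body(2)[OF p]] by simp
  finally show ?thesis .
qed

lemma levi_civita_connection:
  assumes "p \<in> SU2" "v \<in> tangent_space SU2 p" "vector_field SU2 Y"
  shows "levi_civita SU2 g p v Y = connection p v Y"
  using levi_civita_eq[OF _ assms] someI[of "is_levi_civita SU2 g", OF connection_is_levi_civita]
  by (simp add: levi_civita_def)


subsection \<open>Geodesics\<close>

text \<open>The covariant derivative along a curve does not depend on the expression of the field by vector
  fields of the group: it is the derivative of the left translated field plus the bilinear term.\<close>

lemma covariant_derivative_body:
  assumes I: "open I" "c ` I \<subseteq> SU2" "t \<in> I" and c: "(c has_vector_derivative v) (at t)"
    and v: "v \<in> tangent_space SU2 (c t)"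
    and D: "has_covariant_derivative SU2 (levi_civita SU2 g) c V D t"
  shows "\<exists>w'. ((\<lambda>s. dagger (c s) ** V s) has_vector_derivative w') (at t) \<and>
    D = c t ** (w' + B (dagger (c t) ** v) (dagger (c t) ** V t))"
proof -
  obtain n :: nat and f :: "nat \<Rightarrow> real \<Rightarrow> real" and Y U where U: "open U" "t \<in> U"
    and f: "\<And>i. i < n \<Longrightarrow> smooth_on U (f i)" and Y: "\<And>i. i < n \<Longrightarrow> vector_field SU2 (Y i)"
    and V: "\<And>s. s \<in> U \<Longrightarrow> V s = (\<Sum>i<n. f i s *\<^sub>R Y i (c s))"
    and D: "D = (\<Sum>i<n. deriv (f i) t *\<^sub>R Y i (c t)
        + f i t *\<^sub>R levi_civita SU2 g (c t) (vector_derivative c (at t)) (Y i))"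
    using D unfolding has_covariant_derivative_def by blast
  have p: "c t \<in> SU2" using I by auto
  let ?y = "\<lambda>i q. dagger q ** Y i q"
  let ?dy = "\<lambda>i. frechet_derivative (?y i) (at (c t) within SU2) v"
  let ?x = "dagger (c t) ** v"
  define w' where "w' = (\<Sum>i<n. f i t *\<^sub>R ?dy i + deriv (f i) t *\<^sub>R ?y i (c t))"
  have "((\<lambda>s. \<Sum>i<n. f i s *\<^sub>R ?y i (c s)) has_vector_derivative w') (at t)"
    unfolding w'_def
  proof (rule has_vector_derivative_sum)
    fix i assume i: "i \<in> {..<n}"
    have "f i differentiable (at t)"
      using smooth_on_has_derivative[OF f U(2), of i] i by (auto simp: differentiable_def)
    then have "(f i has_real_derivative deriv (f i) t) (at t)"
      by (simp add: DERIV_deriv_iff_real_differentiable)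
    moreover have "((\<lambda>s. ?y i (c s)) has_vector_derivative ?dy i) (at t)"
      using i by (intro chain_rule_within[OF _ I(1,3,2) c]
          smooth_map_has_derivative[OF vector_field_body(1)[OF Y] p]) auto
    ultimately show "((\<lambda>s. f i s *\<^sub>R ?y i (c s)) has_vector_derivative
        f i t *\<^sub>R ?dy i + deriv (f i) t *\<^sub>R ?y i (c t)) (at t)"
      by (rule has_vector_derivative_scaleR)
  qed
  then have "((\<lambda>s. dagger (c s) ** V s) has_vector_derivative w') (at t)"
    by (rule has_vector_derivative_transform_within_open[OF _ U])
      (simp add: V mm.sum_right mm.scaleR_right)
  moreover have "D = c t ** (w' + B ?x (dagger (c t) ** V t))"
  proof -
    have "D = (\<Sum>i<n. deriv (f i) t *\<^sub>R (c t ** ?y i (c t)) + f i t *\<^sub>R (c t ** (?dy i + B ?x (?y i (c t)))))"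
      unfolding D using levi_civita_connection[OF p v Y] vector_derivative_at[OF c] p
      by (intro sum.cong) (auto simp: connection_def SU2_cancel)
    also have "\<dots> = c t ** (\<Sum>i<n. deriv (f i) t *\<^sub>R ?y i (c t) + f i t *\<^sub>R (?dy i + B ?x (?y i (c t))))"
      by (simp add: mm.sum_right mm.add_right mm.scaleR_right)
    also have "(\<Sum>i<n. deriv (f i) t *\<^sub>R ?y i (c t) + f i t *\<^sub>R (?dy i + B ?x (?y i (c t))))
        = w' + B ?x (\<Sum>i<n. f i t *\<^sub>R ?y i (c t))"
      by (simp add: w'_def sum.distrib scaleR_add_right B.sum_right B.scaleR_right algebra_simps)
    also have "(\<Sum>i<n. f i t *\<^sub>R ?y i (c t)) = dagger (c t) ** V t"
      using V[OF U(2)] by (simp add: mm.sum_right mm.scaleR_right)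
    finally show ?thesis .
  qed
  ultimately show ?thesis by blast
qed

lemma velocity_tangent:
  assumes I: "open I" "smooth_on I c" "c ` I \<subseteq> SU2" "t \<in> I" and c: "(c has_vector_derivative v) (at (t::real))"
  shows "v \<in> tangent_space SU2 (c t)"
proof -
  obtain e where e: "e > 0" "ball t e \<subseteq> I" using I openE by blast
  have sub: "(\<lambda>s. t + s) ` {-e<..<e} \<subseteq> I" using e(2) by (auto simp: subset_iff dist_real_def)
  have "smooth_on {-e<..<e} (\<lambda>s. t + s)"
    by (intro smooth_on_add smooth_on_const smooth_on_id open_greaterThanLessThan)
  then have "smooth_on {-e<..<e} (\<lambda>s. c (t + s))"
    by (rule smooth_on_compose[OF open_greaterThanLessThan I(1) sub _ I(2)])
  moreover have "((\<lambda>s. c (t + s)) has_vector_derivative v) (at 0)"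
    using vector_diff_chain_at[of "\<lambda>s. t + s" 1 0 c v] c
      has_vector_derivative_add[OF has_vector_derivative_const has_vector_derivative_id, of t]
    by (auto simp: o_def)
  moreover have "(\<lambda>s. c (t + s)) ` {-e<..<e} \<subseteq> SU2" using sub I(3) by auto
  ultimately show ?thesis
    unfolding tangent_space_def using e(1) by (auto intro!: exI[of _ e] exI[of _ "\<lambda>s. c (t + s)"])
qed

text \<open>After left translation the covariant derivative along the curve is the ordinary one plus \<open>B\<close>, so that
  vanishing acceleration becomes an autonomous equation. For the converse, the velocity is written as a
  combination of the left invariant fields spanned by \<open>pr_su\<close>.\<close>

lemma geodesic_iff_euler:
  "geodesic SU2 g I c \<longleftrightarrow> open I \<and> is_interval I \<and> smooth_on I c \<and> c ` I \<subseteq> SU2 \<and>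
    (\<exists>x. \<forall>t\<in>I. x t \<in> su \<and> (c has_vector_derivative c t ** x t) (at t) \<and>
       (x has_vector_derivative - B (x t) (x t)) (at t))"
proof (cases "open I \<and> is_interval I \<and> smooth_on I c \<and> c ` I \<subseteq> SU2")
  case False
  then show ?thesis by (auto simp: geodesic_def)
next
  case True
  then have I: "open I" "smooth_on I c" "c ` I \<subseteq> SU2" by auto
  have SU: "c t \<in> SU2" if "t \<in> I" for t using I(3) that by auto
  have dc: "(c has_vector_derivative vector_derivative c (at t)) (at t)" if "t \<in> I" for t
    using smooth_on_has_derivative[OF I(2) that] differentiableI vector_derivative_works by blast
  have tan: "vector_derivative c (at t) \<in> tangent_space SU2 (c t)" if "t \<in> I" for t
    by (rule velocity_tangent[OF I that dc[OF that]])
  have "(\<forall>t\<in>I. has_covariant_derivative SU2 (levi_civita SU2 g) c (\<lambda>s. vector_derivative c (at s)) 0 t)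
    \<longleftrightarrow> (\<exists>x. \<forall>t\<in>I. x t \<in> su \<and> (c has_vector_derivative c t ** x t) (at t) \<and>
       (x has_vector_derivative - B (x t) (x t)) (at t))" (is "?L \<longleftrightarrow> ?R")
  proof
    assume L: ?L
    define x where "x = (\<lambda>t. dagger (c t) ** vector_derivative c (at t))"
    have "x t \<in> su \<and> (c has_vector_derivative c t ** x t) (at t) \<and>
       (x has_vector_derivative - B (x t) (x t)) (at t)" if t: "t \<in> I" for t
    proof -
      obtain w' where w': "(x has_vector_derivative w') (at t)" "0 = c t ** (w' + B (x t) (x t))"
        using covariant_derivative_body[OF I(1,3) t dc[OF t] tan[OF t]] L t unfolding x_def by blast
      have "w' + B (x t) (x t) = dagger (c t) ** (c t ** (w' + B (x t) (x t)))"
        using SU[OF t] by (simp add: SU2_cancel)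
      then have "w' = - B (x t) (x t)" by (simp add: w'(2)[symmetric] mm.zero_right eq_neg_iff_add_eq_0)
      moreover have "x t \<in> su" using tan[OF t] SU[OF t] by (simp add: x_def tangent_space_SU2_iff)
      moreover have "c t ** x t = vector_derivative c (at t)" using SU[OF t] by (simp add: x_def SU2_cancel)
      ultimately show ?thesis using w' dc[OF t] by simp
    qed
    then show ?R by blast
  next
    assume ?R
    then obtain x where x: "\<And>t. t \<in> I \<Longrightarrow> x t \<in> su"
      and cx: "\<And>t. t \<in> I \<Longrightarrow> (c has_vector_derivative c t ** x t) (at t)"
      and xx: "\<And>t. t \<in> I \<Longrightarrow> (x has_vector_derivative - B (x t) (x t)) (at t)" by blast
    have vd: "vector_derivative c (at t) = c t ** x t" if "t \<in> I" for t
      using vector_derivative_at[OF cx[OF that]] .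
    have sx: "smooth_on I x"
    proof (rule smooth_on_ode_solution[OF I(1) xx])
      show "smooth_on UNIV (\<lambda>x. - B x x)"
        by (rule smooth_on_linear[OF bounded_linear_minus[OF bounded_linear_ident] open_UNIV
              smooth_on_bilinear[OF bounded_bilinear_B open_UNIV smooth_on_id smooth_on_id]]) auto
    qed auto
    obtain h where h: "bij_betw h {0..<card (Basis :: cmat2 set)} (Basis :: cmat2 set)"
      using ex_bij_betw_nat_finite[OF finite_Basis] by blast
    let ?n = "card (Basis :: cmat2 set)"
    have re: "(\<Sum>i<?n. F (h i)) = (\<Sum>b\<in>Basis. F b)" for F :: "cmat2 \<Rightarrow> cmat2"
      using sum.reindex_bij_betw[OF h, of F] by (simp add: atLeast0LessThan)
    show ?L
    proof
      fix t assume t: "t \<in> I"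
      have d: "deriv (\<lambda>s. x s \<bullet> b) t = - B (x t) (x t) \<bullet> b" for b
      proof (rule DERIV_imp_deriv)
        show "((\<lambda>s. x s \<bullet> b) has_real_derivative - B (x t) (x t) \<bullet> b) (at t)"
          using bounded_linear.has_vector_derivative[OF bounded_linear_inner_left xx[OF t]]
          by (simp add: has_real_derivative_iff_has_vector_derivative)
      qed
      have lc: "levi_civita SU2 g (c t) (c t ** x t) (\<lambda>q. q ** pr_su b) = c t ** B (x t) (pr_su b)" for b
      proof -
        have v: "c t ** x t \<in> tangent_space SU2 (c t)" using SU[OF t] x[OF t] by (rule tangent_SU2I)
        have "((\<lambda>q. dagger q ** (q ** pr_su b)) has_derivative (\<lambda>_. 0)) (at (c t) within SU2)"
          by (rule has_derivative_transform[OF SU[OF t] _ has_derivative_const[of "pr_su b"]])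
            (simp add: SU2_cancel)
        from frechet_derivative_within_eq[OF this v] show ?thesis
          using levi_civita_connection[OF SU[OF t] v left_invariant_field[OF pr_su_in]] SU[OF t]
          by (simp add: connection_def SU2_cancel)
      qed
      have "0 = (\<Sum>i<?n. deriv (\<lambda>s. x s \<bullet> h i) t *\<^sub>R (c t ** pr_su (h i))
          + (x t \<bullet> h i) *\<^sub>R levi_civita SU2 g (c t) (vector_derivative c (at t)) (\<lambda>q. q ** pr_su (h i)))"
      proof -
        have "- B (x t) (x t) \<in> su" using B_su x t su_neg by blast
        note expand = su_expansion[OF this, symmetric] su_expansion[OF x[OF t], symmetric]
        have "0 = c t ** ((\<Sum>b\<in>Basis. (- B (x t) (x t) \<bullet> b) *\<^sub>R pr_su b)
            + B (x t) (\<Sum>b\<in>Basis. (x t \<bullet> b) *\<^sub>R pr_su b))"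
          unfolding expand by (simp add: mm.zero_right)
        also have "\<dots> = (\<Sum>b\<in>Basis. (- B (x t) (x t) \<bullet> b) *\<^sub>R (c t ** pr_su b)
            + (x t \<bullet> b) *\<^sub>R (c t ** B (x t) (pr_su b)))"
          by (simp only: sum.distrib mm.add_right mm.sum_right mm.scaleR_right B.sum_right B.scaleR_right)
        finally show ?thesis unfolding vd[OF t] lc d
          by (subst re[of "\<lambda>b. (- B (x t) (x t) \<bullet> b) *\<^sub>R (c t ** pr_su b)
            + (x t \<bullet> b) *\<^sub>R (c t ** B (x t) (pr_su b))"])
      qed
      moreover have "vector_derivative c (at s) = (\<Sum>i<?n. (x s \<bullet> h i) *\<^sub>R (c s ** pr_su (h i)))" if "s \<in> I" for s
      proof -
        have "vector_derivative c (at s) = c s ** (\<Sum>b\<in>Basis. (x s \<bullet> b) *\<^sub>R pr_su b)"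
          using vd[OF that] su_expansion[OF x[OF that]] by simp
        also have "\<dots> = (\<Sum>b\<in>Basis. (x s \<bullet> b) *\<^sub>R (c s ** pr_su b))"
          by (simp only: mm.sum_right mm.scaleR_right)
        finally show ?thesis by (subst re[of "\<lambda>b. (x s \<bullet> b) *\<^sub>R (c s ** pr_su b)"])
      qed
      ultimately show "has_covariant_derivative SU2 (levi_civita SU2 g) c (\<lambda>s. vector_derivative c (at s)) 0 t"
        unfolding has_covariant_derivative_def
        using I(1) t smooth_on_linear[OF bounded_linear_inner_left I(1) sx] left_invariant_field[OF pr_su_in]
        by (intro exI[of _ ?n] exI[of _ "\<lambda>i s. x s \<bullet> h i"] exI[of _ "\<lambda>i q. q ** pr_su (h i)"] exI[of _ I])
          auto
    qed
  qed
  then show ?thesis using True by (auto simp: geodesic_def)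
qed

end

section \<open>Diagonalization of the metric in a quaternionic basis\<close>

lemma one_neq_zero_mat [simp]: "one \<noteq> 0"
  by (simp add: mat2_simps)

text \<open>An oriented basis which multiplies like the quaternion units. The conditions are invariant under cyclic
  permutation, which saves many cases below.\<close>

locale quat_basis =
  fixes e1 e2 e3 :: cmat2
  assumes e_su: "e1 \<in> su" "e2 \<in> su" "e3 \<in> su"
    and e_cyclic: "e1 ** e2 = e3" "e2 ** e3 = e1" "e3 ** e1 = e2"
    and e_square: "e1 ** e1 = - one" "e2 ** e2 = - one" "e3 ** e3 = - one"
begin

lemma rotate: "quat_basis e2 e3 e1"
  using e_su e_cyclic e_square by unfold_locales

lemma e_anticyclic: "e2 ** e1 = - e3" "e3 ** e2 = - e1" "e1 ** e3 = - e2"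
proof -
  have "y ** x = - z" if "x \<in> su" "y \<in> su" "z \<in> su" "x ** y = z" for x y z
  proof -
    have "dagger (x ** y) = y ** x"
      unfolding dagger_mult suD(1)[OF that(1)] suD(1)[OF that(2)] by (simp add: mm.minus_left mm.minus_right)
    then show ?thesis using suD(1)[OF that(3)] that(4) by simp
  qed
  then show "e2 ** e1 = - e3" "e3 ** e2 = - e1" "e1 ** e3 = - e2" using e_su e_cyclic by blast+
qed

lemmas e_mult = e_cyclic e_square e_anticyclic

lemma e_inner: "e1 \<bullet> e1 = 2" "e2 \<bullet> e2 = 2" "e3 \<bullet> e3 = 2"
  "e1 \<bullet> e2 = 0" "e2 \<bullet> e1 = 0" "e2 \<bullet> e3 = 0" "e3 \<bullet> e2 = 0" "e1 \<bullet> e3 = 0" "e3 \<bullet> e1 = 0"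
proof -
  have sq: "x \<bullet> x = 2" if "x \<in> su" "x ** x = - one" for x
  proof -
    have "(x \<bullet> x / 2 - 1) *\<^sub>R one = 0" using su_square[OF that(1)] that(2) by (simp add: scaleR_left_diff_distrib)
    then show ?thesis by simp
  qed
  have orth: "x \<bullet> y = 0" if "x \<in> su" "y \<in> su" "x ** y = - (y ** x)" for x y
    using su_anticommutator[OF that(1,2)] that(3) by simp
  show "e1 \<bullet> e1 = 2" "e2 \<bullet> e2 = 2" "e3 \<bullet> e3 = 2" using sq e_su e_square by auto
  have "e1 \<bullet> e2 = 0" "e2 \<bullet> e3 = 0" "e3 \<bullet> e1 = 0"
    using e_su by (auto intro!: orth simp: e_mult)
  then show "e1 \<bullet> e2 = 0" "e2 \<bullet> e1 = 0" "e2 \<bullet> e3 = 0" "e3 \<bullet> e2 = 0" "e1 \<bullet> e3 = 0" "e3 \<bullet> e1 = 0"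
    by (simp_all add: inner_commute)
qed

text \<open>An element orthogonal to the basis anticommutes with all three units, although the third is
  the product of the other two.\<close>

lemma expansion:
  assumes x: "x \<in> su"
  shows "x = ((x \<bullet> e1) / 2) *\<^sub>R e1 + ((x \<bullet> e2) / 2) *\<^sub>R e2 + ((x \<bullet> e3) / 2) *\<^sub>R e3"
proof -
  define d where "d = x - (((x \<bullet> e1) / 2) *\<^sub>R e1 + ((x \<bullet> e2) / 2) *\<^sub>R e2 + ((x \<bullet> e3) / 2) *\<^sub>R e3)"
  have d: "d \<in> su" unfolding d_def by (intro su_diff su_add su_scale x e_su)
  have "d \<bullet> e1 = 0" "d \<bullet> e2 = 0" "d \<bullet> e3 = 0"
    by (simp_all add: d_def inner_diff_left inner_add_left e_inner)
  then have ac: "d ** e1 = - (e1 ** d)" "d ** e2 = - (e2 ** d)" "d ** e3 = - (e3 ** d)"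
    using su_anticommutator[OF d e_su(1)] su_anticommutator[OF d e_su(2)] su_anticommutator[OF d e_su(3)]
    by (simp_all add: eq_neg_iff_add_eq_0)
  have "d ** e3 = (d ** e1) ** e2" by (simp add: e_cyclic(1) matrix_mul_assoc[symmetric])
  also have "\<dots> = - (e1 ** (d ** e2))" by (simp add: ac(1) mm_simps)
  also have "\<dots> = e1 ** e2 ** d" by (simp add: ac(2) mm_simps)
  also have "\<dots> = - (d ** e3)" by (simp add: e_cyclic(1) ac(3))
  finally have "d ** e3 = 0"
    by (metis (no_types) add.right_neutral scaleR_2 add_eq_0_iff scaleR_eq_0_iff zero_neq_numeral)
  then have "d ** (e3 ** e3) = 0" by (simp add: matrix_mul_assoc mm.zero_left)
  then show ?thesis by (simp add: e_square mm.minus_right d_def)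
qed

lemma inner_expansion:
  assumes "x \<in> su"
  shows "x \<bullet> y = ((x \<bullet> e1) * (e1 \<bullet> y) + (x \<bullet> e2) * (e2 \<bullet> y) + (x \<bullet> e3) * (e3 \<bullet> y)) / 2"
  by (subst expansion[OF assms]) (simp add: inner_add_left add_divide_distrib)

end

text \<open>Two orthogonal imaginary units anticommute; their product is the third unit.\<close>

lemma quat_basisI:
  assumes "e1 \<in> su" "e2 \<in> su" "e1 \<bullet> e1 = 2" "e2 \<bullet> e2 = 2" "e1 \<bullet> e2 = 0"
  shows "quat_basis e1 e2 (e1 ** e2)"
proof
  have sq: "e1 ** e1 = - one" "e2 ** e2 = - one"
    using su_square[of e1] su_square[of e2] assms by simp_all
  have ac: "e2 ** e1 = - (e1 ** e2)"
    using su_anticommutator[of e1 e2] assms by (simp add: eq_neg_iff_add_eq_0 add.commute)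
  have "bracket e1 e2 = 2 *\<^sub>R (e1 ** e2)" by (simp add: bracket_def ac scaleR_2)
  then show "e1 ** e2 \<in> su"
    using su_scale[OF bracket_su[OF assms(1,2)], of "1/2"] by simp
  show "e2 ** (e1 ** e2) = e1" by (simp add: matrix_mul_assoc ac mm.minus_left)
      (simp add: matrix_mul_assoc[symmetric] sq mm.minus_right)
  show "e1 ** e2 ** e1 = e2" by (simp add: matrix_mul_assoc[symmetric] ac mm.minus_right)
      (simp add: matrix_mul_assoc sq mm.minus_left)
  have "e1 ** e2 ** (e1 ** e2) = e1 ** (e2 ** e1) ** e2" by (simp add: matrix_mul_assoc)
  also have "\<dots> = - (e1 ** e1 ** (e2 ** e2))" by (simp add: ac mm.minus_left mm.minus_right matrix_mul_assoc)
  finally show "e1 ** e2 ** (e1 ** e2) = - one" by (simp add: sq mm.minus_left mm.minus_right)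
qed (use assms su_square[of e1] su_square[of e2] in auto)

lemma quat_basis_exists: "\<exists>e1 e2 e3. quat_basis e1 e2 e3"
proof -
  define a :: cmat2 where "a = (\<chi> i j. if i = j then if i = 1 then \<i> else - \<i> else 0)"
  define b :: cmat2 where "b = (\<chi> i j. if i = j then 0 else if i = 1 then 1 else - 1)"
  have "quat_basis a b (a ** b)"
    by (rule quat_basisI) (simp_all add: su_elements a_def b_def inner_vec_def sum_2 inner_complex_def)
  then show ?thesis by blast
qed

lemma dim_su_le: "dim su \<le> 3"
proof -
  obtain e1 e2 e3 where "quat_basis e1 e2 e3" using quat_basis_exists by blast
  then interpret quat_basis e1 e2 e3 .
  have "x \<in> span {e1, e2, e3}" if "x \<in> su" for x
    by (subst expansion[OF that]) (intro span_add span_scale span_base; simp)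
  then have "dim su \<le> card {e1, e2, e3}" by (intro dim_le_card) auto
  also have "\<dots> \<le> 3" by (simp add: card_insert_if)
  finally show ?thesis .
qed

lemma unit_su_in_SU2: "x \<in> su \<Longrightarrow> x \<bullet> x = 2 \<Longrightarrow> x \<in> SU2"
  using su_square[of x] by (simp add: SU2_iff suD mm.minus_right)

text \<open>Conjugation by a unit changes the sign of the units orthogonal to it, so that these are orthogonal for the
  form as well. Conjugation by the bisector of two orthogonal units exchanges them, so that all units have
  the same length.\<close>

lemma invariant_form_unique:
  fixes f :: "cmat2 \<Rightarrow> cmat2 \<Rightarrow> real"
  assumes add: "\<And>x y z a b. x \<in> su \<Longrightarrow> y \<in> su \<Longrightarrow> z \<in> su \<Longrightarrow> f (a *\<^sub>R x + b *\<^sub>R y) z = a * f x z + b * f y z"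
    and sym: "\<And>x y. x \<in> su \<Longrightarrow> y \<in> su \<Longrightarrow> f x y = f y x"
    and inv: "\<And>h x y. h \<in> SU2 \<Longrightarrow> x \<in> su \<Longrightarrow> y \<in> su \<Longrightarrow> f (h ** x ** dagger h) (h ** y ** dagger h) = f x y"
  shows "\<exists>\<kappa>. \<forall>x\<in>su. \<forall>y\<in>su. f x y = \<kappa> * (x \<bullet> y)"
proof -
  obtain e1 e2 e3 where "quat_basis e1 e2 e3" using quat_basis_exists by blast
  then interpret quat_basis e1 e2 e3 .
  have neg: "f x (- y) = - f x y" if "x \<in> su" "y \<in> su" for x y
    using add[OF that(2) su_zero that(1), of "-1" 0] sym[OF that(1) su_neg[OF that(2)]] sym[OF that] by simp
  have orth: "f x y = 0" if xy: "x \<in> su" "y \<in> su" "x \<bullet> x = 2" "x \<bullet> y = 0" for x y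
  proof -
    have xx: "x ** x = - one" using su_square[OF xy(1)] xy(3) by simp
    have "y ** x = - (x ** y)"
      using su_anticommutator[OF xy(1,2)] xy(4) by (simp add: eq_neg_iff_add_eq_0 add.commute)
    then have "x ** y ** x = y" by (simp add: matrix_mul_assoc[symmetric] mm.minus_right)
        (simp add: matrix_mul_assoc xx mm.minus_left)
    then have "f (x ** x ** dagger x) (x ** y ** dagger x) = f x (- y)"
      by (simp add: suD xy xx mm.minus_right mm.minus_left)
    then show ?thesis using inv[OF unit_su_in_SU2[OF xy(1,3)] xy(1,2)] neg[OF xy(1,2)] by simp
  qed
  have same: "f x x = f y y" if xy: "x \<in> su" "y \<in> su" "x \<bullet> x = 2" "y \<bullet> y = 2" "x \<bullet> y = 0" for x y
  proof -
    define h where "h = (1 / sqrt 2) *\<^sub>R (x + y)"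
    have h: "h \<in> su" "h \<bullet> h = 2"
      using xy by (auto simp: h_def inner_add_left inner_add_right inner_commute intro!: su_scale su_add)
    have xx: "x ** x = - one" "y ** y = - one"
      using su_square[OF xy(1)] su_square[OF xy(2)] xy by simp_all
    have ac: "y ** x = - (x ** y)"
      using su_anticommutator[OF xy(1,2)] xy(5) by (simp add: eq_neg_iff_add_eq_0 add.commute)
    have xyx: "x ** (y ** x) = y" by (simp add: ac mm.minus_right) (simp add: matrix_mul_assoc xx mm.minus_left)
    have yxy: "y ** (x ** y) = x" by (simp add: matrix_mul_assoc ac mm.minus_left)
        (simp add: matrix_mul_assoc[symmetric] xx mm.minus_right)
    have yxx: "y ** (x ** x) = - y" "x ** (x ** y) = - y" by (simp_all add: xx mm.minus_right)
        (simp add: matrix_mul_assoc xx mm.minus_left)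
    have "h ** x ** dagger h = - ((1/2) *\<^sub>R ((x + y) ** x ** (x + y)))"
    proof -
      have "dagger (x + y) = - (x + y)" using suD(1)[OF su_add[OF xy(1,2)]] .
      then show ?thesis
        unfolding h_def dagger_scaleR by (simp add: mm.scaleR_left mm.scaleR_right mm.minus_right del: minus_add_distrib)
    qed
    also have "(x + y) ** x ** (x + y) = - (2 *\<^sub>R y)"
      by (simp add: mm.add_left mm.add_right mm.diff_left matrix_mul_assoc[symmetric] yxx yxy xyx xx mm.minus_right mm.minus_left scaleR_2)
    finally have "h ** x ** dagger h = y" by simp
    then show ?thesis using inv[OF unit_su_in_SU2[OF h] xy(1) xy(1)] by simp
  qed
  have add3: "f (a *\<^sub>R e1 + b *\<^sub>R e2 + c *\<^sub>R e3) z = a * f e1 z + b * f e2 z + c * f e3 z" if "z \<in> su" for a b c z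
    using add[of "a *\<^sub>R e1 + b *\<^sub>R e2" e3 z 1 c] add[OF e_su(1,2) that, of a b] that
    by (simp add: su_add su_scale e_su)
  have diag: "f e z = (f e1 e1 / 2) * (e \<bullet> z)" if "e \<in> {e1, e2, e3}" "z \<in> su" for e z
  proof -
    have e: "e \<in> su" using that e_su by auto
    have "f z e = (z \<bullet> e1) / 2 * f e1 e + (z \<bullet> e2) / 2 * f e2 e + (z \<bullet> e3) / 2 * f e3 e"
      using add3[OF e] expansion[OF that(2)] by metis
    moreover have "f e2 e2 = f e1 e1" "f e3 e3 = f e1 e1"
      using same[of e2 e1] same[of e3 e1] by (simp_all add: e_su e_inner)
    moreover have "f e1 e2 = 0" "f e1 e3 = 0" "f e2 e1 = 0" "f e2 e3 = 0" "f e3 e1 = 0" "f e3 e2 = 0"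
      using orth by (simp_all add: e_su e_inner)
    ultimately show ?thesis using that(1) sym[OF e that(2)] by (auto simp: inner_commute)
  qed
  have "f x y = (f e1 e1 / 2) * (x \<bullet> y)" if x: "x \<in> su" and y: "y \<in> su" for x y
  proof -
    have "f x y = (x \<bullet> e1) / 2 * f e1 y + (x \<bullet> e2) / 2 * f e2 y + (x \<bullet> e3) / 2 * f e3 y"
      using add3[OF y] expansion[OF x] by metis
    then show ?thesis
      by (subst inner_expansion[OF x, of y]) (simp add: diag[OF _ y] algebra_simps add_divide_distrib)
  qed
  then show ?thesis by blast
qed

text \<open>If the extreme eigenvalues differ, unit eigenvectors for them are orthogonal, and their product \<open>e2\<close> is
  an eigenvector because \<open>A\<close> is symmetric. Its eigenvalue \<open>m\<close> is one of the given ones; it is the middle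
  one if all of them are different. Otherwise it may be any of them, which suffices for two eigenvalues to
  agree.\<close>

lemma eigenbasis_exists:
  assumes A: "\<And>x. x \<in> su \<Longrightarrow> A x \<in> su"
    and lin: "\<And>x y a b. x \<in> su \<Longrightarrow> y \<in> su \<Longrightarrow> A (a *\<^sub>R x + b *\<^sub>R y) = a *\<^sub>R A x + b *\<^sub>R A y"
    and sa: "\<And>x y. x \<in> su \<Longrightarrow> y \<in> su \<Longrightarrow> A x \<bullet> y = x \<bullet> A y"
    and le: "l1 \<le> l2" "l2 \<le> l3"
    and dims: "\<And>m. dim {x \<in> su. A x = m *\<^sub>R x} = count_list [l1, l2, l3] m"
  shows "\<exists>e1 e2 e3 m. quat_basis e1 e2 e3 \<and> A e1 = l1 *\<^sub>R e1 \<and> A e2 = m *\<^sub>R e2 \<and> A e3 = l3 *\<^sub>R e3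
    \<and> m \<in> {l1, l2, l3} \<and> (l1 < l2 \<and> l2 < l3 \<longrightarrow> m = l2)"
proof (cases "l1 = l3")
  case True
  then have l: "l2 = l1" "l3 = l1" using le by auto
  have sub: "subspace {x \<in> su. A x = l1 *\<^sub>R x}"
    using lin[OF su_zero su_zero, of 0 0] lin[of _ _ 1 1] lin[OF _ su_zero, of _ _ 0]
    by (auto simp: subspace_def su_zero su_add su_scale scaleR_add_right)
  have "{x \<in> su. A x = l1 *\<^sub>R x} = su"
    using dim_su_le dims[of l1] l by (intro subspace_dim_equal sub subspace_su) auto
  then have A: "A x = l1 *\<^sub>R x" if "x \<in> su" for x using that by blast
  obtain e1 e2 e3 where e: "quat_basis e1 e2 e3" using quat_basis_exists by blast
  then interpret quat_basis e1 e2 e3 .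
  show ?thesis using e A[OF e_su(1)] A[OF e_su(2)] A[OF e_su(3)] l
    by (intro exI[of _ e1] exI[of _ e2] exI[of _ e3] exI[of _ l1]) auto
next
  case False
  have scale: "A (a *\<^sub>R x) = a *\<^sub>R A x" if "x \<in> su" for a x
    using lin[OF that su_zero, of a 0] by simp
  have ex0: "\<exists>x. x \<in> su \<and> A x = m *\<^sub>R x \<and> x \<noteq> 0" if "m \<in> {l1, l2, l3}" for m
  proof (rule ccontr)
    assume "\<not> ?thesis"
    then have "{x \<in> su. A x = m *\<^sub>R x} \<subseteq> {0}" by auto
    then have "dim {x \<in> su. A x = m *\<^sub>R x} = 0" by (simp only: dim_eq_0)
    then show False using that dims[of m] by (auto split: if_splits)
  qed
  have ex: "\<exists>x. x \<in> su \<and> A x = m *\<^sub>R x \<and> x \<bullet> x = 2" if m: "m \<in> {l1, l2, l3}" for m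
  proof -
    obtain x where x: "x \<in> su" "A x = m *\<^sub>R x" "x \<noteq> 0" using ex0[OF m] by blast
    let ?x = "sqrt (2 / (x \<bullet> x)) *\<^sub>R x"
    have "?x \<bullet> ?x = (sqrt (2 / (x \<bullet> x)))\<^sup>2 * (x \<bullet> x)"
      by (simp only: inner_scaleR_left inner_scaleR_right power2_eq_square mult.assoc)
    also have "\<dots> = 2" using x(3) by simp
    finally have "?x \<bullet> ?x = 2" .
    then show ?thesis using x su_scale scale by (intro exI[of _ ?x]) auto
  qed
  have orth: "x \<bullet> y = 0" if "x \<in> su" "y \<in> su" "A x = a *\<^sub>R x" "A y = b *\<^sub>R y" "a \<noteq> b" for x y a b
    using sa[OF that(1,2)] that by simp
  obtain e1 where e1: "e1 \<in> su" "A e1 = l1 *\<^sub>R e1" "e1 \<bullet> e1 = 2" using ex[of l1] by auto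
  obtain e3 where e3: "e3 \<in> su" "A e3 = l3 *\<^sub>R e3" "e3 \<bullet> e3 = 2" using ex[of l3] by auto
  define e2 where "e2 = e3 ** e1"
  have "e3 \<bullet> e1 = 0" using orth[OF e3(1) e1(1) e3(2) e1(2)] False by auto
  then have "quat_basis e3 e1 e2" unfolding e2_def using e1 e3 by (intro quat_basisI) auto
  then have e: "quat_basis e1 e2 e3" by (rule quat_basis.rotate)
  then interpret quat_basis e1 e2 e3 .
  define m where "m = (A e2 \<bullet> e2) / 2"
  have "A e2 \<bullet> e1 = 0" "A e2 \<bullet> e3 = 0"
    using sa[OF e_su(2) e1(1)] sa[OF e_su(2) e3(1)] by (simp_all add: e1 e3 e_inner)
  then have m: "A e2 = m *\<^sub>R e2" using expansion[OF A[OF e_su(2)]] by (simp add: m_def)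
  have "m \<in> {l1, l2, l3}"
  proof (rule ccontr)
    assume "m \<notin> {l1, l2, l3}"
    then have "dim {x \<in> su. A x = m *\<^sub>R x} = 0" using dims[of m] by auto
    then have "{x \<in> su. A x = m *\<^sub>R x} \<subseteq> {0}" by (simp only: dim_eq_0)
    then have "e2 = 0" using m e_su(2) by auto
    then show False using e_inner(2) by simp
  qed
  moreover have "m = l2" if "l1 < l2" "l2 < l3"
  proof -
    obtain f where f: "f \<in> su" "A f = l2 *\<^sub>R f" "f \<noteq> 0" using ex0[of l2] by auto
    have "f \<bullet> e1 = 0" "f \<bullet> e3 = 0"
      using orth[OF f(1) e1(1) f(2) e1(2)] orth[OF f(1) e3(1) f(2) e3(2)] that by auto
    then have "f = ((f \<bullet> e2) / 2) *\<^sub>R e2" using expansion[OF f(1)] by simp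
    then have "f \<bullet> e2 \<noteq> 0" using f(3) by auto
    then show ?thesis using orth[OF f(1) e_su(2) f(2) m] by blast
  qed
  ultimately show ?thesis using e e1(2) m e3(2) by blast
qed

text \<open>The basis vectors have squared length 2 in the ambient inner product. The factor one half makes \<open>l1, l2, l3\<close> the
  eigenvalues of the operator of the metric.\<close>

locale diagonal_metric = quat_basis e1 e2 e3 for e1 e2 e3 :: cmat2 +
  fixes l1 l2 l3 :: real and g :: "cmat2 \<Rightarrow> cmat2 \<Rightarrow> cmat2 \<Rightarrow> real"
  assumes l_nonzero: "l1 \<noteq> 0" "l2 \<noteq> 0" "l3 \<noteq> 0"
    and g_diagonal: "\<And>p x y. p \<in> SU2 \<Longrightarrow> x \<in> su \<Longrightarrow> y \<in> su \<Longrightarrow> g p (p ** x) (p ** y) =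
      (l1 * (x \<bullet> e1) * (y \<bullet> e1) + l2 * (x \<bullet> e2) * (y \<bullet> e2) + l3 * (x \<bullet> e3) * (y \<bullet> e3)) / 2"
begin

lemma rotate_metric: "diagonal_metric e2 e3 e1 l2 l3 l1 g"
  using rotate l_nonzero g_diagonal
  by (auto simp: diagonal_metric_def diagonal_metric_axioms_def add.commute add.left_commute)

definition diag :: "real \<Rightarrow> real \<Rightarrow> real \<Rightarrow> cmat2 \<Rightarrow> cmat2" where
  "diag a b c x = (a * (x \<bullet> e1) / 2) *\<^sub>R e1 + (b * (x \<bullet> e2) / 2) *\<^sub>R e2 + (c * (x \<bullet> e3) / 2) *\<^sub>R e3"

lemma linear_diag: "linear (diag a b c)"
  unfolding diag_def
  by (auto intro!: linearI simp: inner_add_left algebra_simps add_divide_distrib)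

lemma diag_su: "diag a b c x \<in> su"
  unfolding diag_def by (intro su_add su_scale e_su)

lemma diag_inner: "diag a b c x \<bullet> e1 = a * (x \<bullet> e1)" "diag a b c x \<bullet> e2 = b * (x \<bullet> e2)"
  "diag a b c x \<bullet> e3 = c * (x \<bullet> e3)"
  by (simp_all add: diag_def inner_add_left e_inner)

sublocale left_invariant_metric "diag l1 l2 l3" "diag (1/l1) (1/l2) (1/l3)" g
proof (rule left_invariant_metric.intro)
  show "diag l1 l2 l3 (diag (1 / l1) (1 / l2) (1 / l3) x) = x" if "x \<in> su" for x
    using expansion[OF that] l_nonzero
    by (simp add: diag_def[of l1] diag_inner)
  show "diag l1 l2 l3 x \<bullet> y = x \<bullet> diag l1 l2 l3 y" for x y
    by (simp add: diag_def inner_add_left inner_add_right inner_commute[of _ y] inner_commute[of _ x]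
        mult.commute mult.left_commute)
  show "g p (p ** x) (p ** y) = diag l1 l2 l3 x \<bullet> y" if "p \<in> SU2" "x \<in> su" "y \<in> su" for p x y
    using g_diagonal[OF that]
    by (simp add: diag_def inner_add_left inner_add_right inner_commute[of _ y] inner_commute[of _ x] add_divide_distrib
        mult.commute mult.left_commute)
qed (rule linear_diag diag_su)+

end

text \<open>The scaling factor between the biinvariant metric and the ambient inner product is positive, so passing
  to the operator of \<open>g\<close> relative to the latter keeps the order and the coincidences of the eigenvalues.\<close>

lemma left_invariant_metric_diagonal:
  fixes g k :: "cmat2 \<Rightarrow> cmat2 \<Rightarrow> cmat2 \<Rightarrow> real"
    and A :: "cmat2 \<Rightarrow> cmat2"
    and l1 l2 l3 :: real
  assumes g: "pseudo_riemannian SU2 g" "left_invariant g"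
    and k: "riemannian SU2 k" "left_invariant k" "right_invariant k"
    and A: "self_adjoint_on_su2 (k one) A"
    and gk: "\<forall>x\<in>su2. \<forall>y\<in>su2. g one x y = k one (A x) y"
    and l: "l1 \<le> l2" "l2 \<le> l3" "eigenvalue_list_su2 A [l1, l2, l3]"
  shows "\<exists>e1 e2 e3 m1 m2 m3. diagonal_metric e1 e2 e3 m1 m2 m3 g \<and>
     (generic_eigenvalues l1 l2 l3 \<longrightarrow> m1 < m2 \<and> m2 < m3) \<and>
     (special_eigenvalues l1 l2 l3 \<longrightarrow> m1 = m2 \<or> m2 = m3)"
proof -
  have T1: "tangent_space SU2 one = su" using su2_eq_su by (simp add: su2_def)
  have ksym: "k one x y = k one y x" if "x \<in> su" "y \<in> su" for x y
    using k(1) that SU2_one unfolding riemannian_def pseudo_riemannian_def T1[symmetric] by blast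
  have klin: "k one (a *\<^sub>R x + b *\<^sub>R y) z = a * k one x z + b * k one y z"
    if "x \<in> su" "y \<in> su" "z \<in> su" for a b x y z
    using k(1) that SU2_one unfolding riemannian_def pseudo_riemannian_def T1[symmetric] by blast
  have kpos: "k one x x > 0" if "x \<in> su" "x \<noteq> 0" for x
    using k(1) that SU2_one unfolding riemannian_def T1[symmetric] by blast
  have kinv: "k one (h ** x ** dagger h) (h ** y ** dagger h) = k one x y"
    if h: "h \<in> SU2" and x: "x \<in> su" and y: "y \<in> su" for h x y
  proof -
    have t: "x \<in> tangent_space SU2 one" "y \<in> tangent_space SU2 one" using x y T1 by auto
    have "k one x y = k (h ** one) (h ** x) (h ** y)"
      using k(2)[unfolded left_invariant_def, rule_format, OF h SU2_one t] by simp
    also have "\<dots> = k (h ** dagger h) (h ** x ** dagger h) (h ** y ** dagger h)"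
      using k(3) SU2_dagger[OF h] h tangent_SU2I[OF h x] tangent_SU2I[OF h y]
      unfolding right_invariant_def by auto
    finally show ?thesis using SU2D(1)[OF h] by simp
  qed
  obtain \<kappa> where \<kappa>: "\<And>x y. x \<in> su \<Longrightarrow> y \<in> su \<Longrightarrow> k one x y = \<kappa> * (x \<bullet> y)"
    using invariant_form_unique[of "k one"] klin ksym kinv by blast
  have \<kappa>pos: "\<kappa> > 0"
  proof -
    obtain e1 e2 e3 where "quat_basis e1 e2 e3" using quat_basis_exists by blast
    then interpret quat_basis e1 e2 e3 .
    have "k one e1 e1 > 0" using kpos[OF e_su(1)] e_inner(1) by fastforce
    then show ?thesis using \<kappa>[OF e_su(1) e_su(1)] e_inner(1) by simp
  qed
  have A_su: "A x \<in> su" if "x \<in> su" for x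
    using A that unfolding self_adjoint_on_su2_def su2_eq_su by blast
  have A_lin: "A (a *\<^sub>R x + b *\<^sub>R y) = a *\<^sub>R A x + b *\<^sub>R A y" if "x \<in> su" "y \<in> su" for a b x y
    using A that unfolding self_adjoint_on_su2_def su2_eq_su by blast
  have A_sa: "A x \<bullet> y = x \<bullet> A y" if "x \<in> su" "y \<in> su" for x y
  proof -
    have "k one (A x) y = k one x (A y)"
      using A that unfolding self_adjoint_on_su2_def su2_eq_su by blast
    then show ?thesis using \<kappa> \<kappa>pos A_su that by simp
  qed
  have "dim {x \<in> su. A x = m *\<^sub>R x} = count_list [l1, l2, l3] m" for m
    using l(3) unfolding eigenvalue_list_su2_def su2_eq_su by blast
  from eigenbasis_exists[OF A_su A_lin A_sa l(1,2) this]
  obtain e1 e2 e3 m where e: "quat_basis e1 e2 e3" and Ae: "A e1 = l1 *\<^sub>R e1" "A e2 = m *\<^sub>R e2" "A e3 = l3 *\<^sub>R e3"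
    and m: "m \<in> {l1, l2, l3}" "l1 < l2 \<and> l2 < l3 \<longrightarrow> m = l2" by blast
  interpret quat_basis e1 e2 e3 by (rule e)
  have g1: "g one x y = (\<kappa> * l1 * (x \<bullet> e1) * (y \<bullet> e1) + \<kappa> * m * (x \<bullet> e2) * (y \<bullet> e2) + \<kappa> * l3 * (x \<bullet> e3) * (y \<bullet> e3)) / 2"
    if x: "x \<in> su" and y: "y \<in> su" for x y
  proof -
    have "A x \<bullet> e1 = l1 * (x \<bullet> e1)" "A x \<bullet> e2 = m * (x \<bullet> e2)" "A x \<bullet> e3 = l3 * (x \<bullet> e3)"
      using A_sa[OF x] e_su by (simp_all add: Ae)
    then have "A x \<bullet> y = (l1 * (x \<bullet> e1) * (y \<bullet> e1) + m * (x \<bullet> e2) * (y \<bullet> e2) + l3 * (x \<bullet> e3) * (y \<bullet> e3)) / 2"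
      using inner_expansion[OF A_su[OF x], of y] by (simp add: inner_commute)
    moreover have "g one x y = k one (A x) y" using gk x y su2_eq_su by auto
    ultimately show ?thesis using \<kappa>[OF A_su[OF x] y] by (simp add: field_simps)
  qed
  have gp: "g p (p ** x) (p ** y) = g one x y" if "p \<in> SU2" "x \<in> su" "y \<in> su" for p x y
    using g(2)[unfolded left_invariant_def, rule_format, of p one x y] that SU2_one T1 by simp
  have nondeg: "x = 0" if "x \<in> su" "\<And>y. y \<in> su \<Longrightarrow> g one x y = 0" for x
    using g(1) that SU2_one unfolding pseudo_riemannian_def T1[symmetric] by blast
  have "\<kappa> * l1 \<noteq> 0"
    using nondeg[OF e_su(1)] g1[OF e_su(1)] e_inner by fastforce
  moreover have "\<kappa> * m \<noteq> 0"
    using nondeg[OF e_su(2)] g1[OF e_su(2)] e_inner by fastforce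
  moreover have "\<kappa> * l3 \<noteq> 0"
    using nondeg[OF e_su(3)] g1[OF e_su(3)] e_inner by fastforce
  ultimately have "diagonal_metric e1 e2 e3 (\<kappa> * l1) (\<kappa> * m) (\<kappa> * l3) g"
    by unfold_locales (use gp g1 in auto)
  moreover have "\<kappa> * l1 < \<kappa> * m \<and> \<kappa> * m < \<kappa> * l3" if "generic_eigenvalues l1 l2 l3"
    using that m(2) \<kappa>pos by (simp add: generic_eigenvalues_def)
  moreover have "\<kappa> * l1 = \<kappa> * m \<or> \<kappa> * m = \<kappa> * l3" if "special_eigenvalues l1 l2 l3"
    using that m(1) by (auto simp: special_eigenvalues_def)
  ultimately show ?thesis by blast
qed

section \<open>Uniqueness of geodesics\<close>

text \<open>Gronwall: \<open>exp (- 2 K t)\<close> times the squared norm does not increase.\<close>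

lemma gronwall_zero:
  fixes d :: "real \<Rightarrow> 'a::real_inner"
  assumes T: "0 \<le> T" and d: "\<And>t. 0 \<le> t \<Longrightarrow> t \<le> T \<Longrightarrow> (d has_vector_derivative d' t) (at t)"
    and bound: "\<And>t. 0 \<le> t \<Longrightarrow> t \<le> T \<Longrightarrow> norm (d' t) \<le> K * norm (d t)" and "d 0 = 0"
  shows "d T = 0"
proof -
  let ?h = "\<lambda>t. (d t \<bullet> d t) * exp (- 2 * K * t)"
  have "?h T \<le> ?h 0"
  proof (rule DERIV_nonpos_imp_nonincreasing[OF T])
    fix t assume t: "0 \<le> t" "t \<le> T"
    have "((\<lambda>t. d t \<bullet> d t) has_vector_derivative d t \<bullet> d' t + d' t \<bullet> d t) (at t)"
      by (rule bounded_bilinear.has_vector_derivative[OF bounded_bilinear_inner d[OF t] d[OF t]])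
    then have 1: "((\<lambda>t. d t \<bullet> d t) has_real_derivative 2 * (d t \<bullet> d' t)) (at t)"
      by (simp add: has_real_derivative_iff_has_vector_derivative inner_commute)
    have "(?h has_real_derivative
        (2 * (d t \<bullet> d' t) - 2 * K * (d t \<bullet> d t)) * exp (- 2 * K * t)) (at t)"
      by (rule derivative_eq_intros 1 refl)+ (simp add: algebra_simps)
    moreover have "d t \<bullet> d' t \<le> norm (d t) * norm (d' t)" by (rule norm_cauchy_schwarz)
    then have "d t \<bullet> d' t \<le> K * (d t \<bullet> d t)"
      using mult_left_mono[OF bound[OF t] norm_ge_zero[of "d t"]]
      by (simp add: power2_norm_eq_inner[symmetric] power2_eq_square algebra_simps)
    then have "(2 * (d t \<bullet> d' t) - 2 * K * (d t \<bullet> d t)) * exp (- 2 * K * t) \<le> 0"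
      by (intro mult_nonpos_nonneg) auto
    ultimately show "\<exists>y. (?h has_real_derivative y) (at t) \<and> y \<le> 0" by blast
  qed
  then have "(d T \<bullet> d T) * exp (- 2 * K * T) \<le> 0" using assms(4) by simp
  then have "d T \<bullet> d T \<le> 0" by (simp add: mult_le_0_iff)
  then show ?thesis by (metis inner_eq_zero_iff inner_ge_zero order_antisym)
qed

text \<open>On a compact interval both solutions are bounded, so the quadratic right hand side is Lipschitz along
  them.\<close>

lemma quadratic_ode_unique_forward:
  fixes x y :: "real \<Rightarrow> 'a::euclidean_space"
  assumes b: "bounded_bilinear b" and T: "0 \<le> T"
    and x: "\<And>t. 0 \<le> t \<Longrightarrow> t \<le> T \<Longrightarrow> (x has_vector_derivative b (x t) (x t)) (at t)"
    and y: "\<And>t. 0 \<le> t \<Longrightarrow> t \<le> T \<Longrightarrow> (y has_vector_derivative b (y t) (y t)) (at t)"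
    and 0: "x 0 = y 0"
  shows "x T = y T"
proof -
  interpret b: bounded_bilinear b by (rule b)
  obtain K where K: "K > 0" "\<And>u v. norm (b u v) \<le> norm u * norm v * K" using b.pos_bounded by blast
  have "\<exists>M. \<forall>t\<in>{0..T}. norm (z t) \<le> M"
    if "\<And>t. 0 \<le> t \<Longrightarrow> t \<le> T \<Longrightarrow> (z has_vector_derivative b (z t) (z t)) (at t)" for z
  proof -
    have "continuous_on {0..T} z"
      using has_vector_derivative_continuous[OF that] by (intro continuous_at_imp_continuous_on) auto
    then have "bounded (z ` {0..T})" by (intro compact_imp_bounded compact_continuous_image) auto
    then show ?thesis by (auto simp: bounded_iff)
  qed
  from this[OF x] this[OF y] obtain M N
    where M: "\<And>t. 0 \<le> t \<Longrightarrow> t \<le> T \<Longrightarrow> norm (x t) \<le> M" and N: "\<And>t. 0 \<le> t \<Longrightarrow> t \<le> T \<Longrightarrow> norm (y t) \<le> N"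
    by (metis atLeastAtMost_iff)
  have "x T - y T = 0"
  proof (rule gronwall_zero[where d = "\<lambda>t. x t - y t" and d' = "\<lambda>t. b (x t) (x t) - b (y t) (y t)"
        and K = "(M + N) * K", OF T])
    fix t assume t: "0 \<le> t" "t \<le> T"
    show "((\<lambda>t. x t - y t) has_vector_derivative b (x t) (x t) - b (y t) (y t)) (at t)"
      by (intro has_vector_derivative_diff x y t)
    have "b (x t) (x t) - b (y t) (y t) = b (x t - y t) (x t) + b (y t) (x t - y t)"
      by (simp add: b.diff_left b.diff_right)
    also have "norm \<dots> \<le> norm (x t - y t) * norm (x t) * K + norm (y t) * norm (x t - y t) * K"
      by (intro norm_triangle_le add_mono K)
    also have "\<dots> \<le> norm (x t - y t) * M * K + N * norm (x t - y t) * K"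
      using K(1) M[OF t] N[OF t] by (intro add_mono mult_right_mono mult_left_mono) auto
    finally show "norm (b (x t) (x t) - b (y t) (y t)) \<le> (M + N) * K * norm (x t - y t)"
      by (simp add: algebra_simps)
  qed (use 0 in simp)
  then show ?thesis by simp
qed

lemma bounded_bilinear_uminus:
  fixes b :: "'a::euclidean_space \<Rightarrow> 'b::euclidean_space \<Rightarrow> 'c::real_normed_vector"
  shows "bounded_bilinear b \<Longrightarrow> bounded_bilinear (\<lambda>u v. - b u v)"
  unfolding bilinear_conv_bounded_bilinear[symmetric] bilinear_def
  by (auto intro: linear_compose_neg)

lemma quadratic_ode_unique:
  fixes x y :: "real \<Rightarrow> 'a::euclidean_space"
  assumes b: "bounded_bilinear b" and J: "is_interval J" "0 \<in> J" "T \<in> J"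
    and x: "\<And>t. t \<in> J \<Longrightarrow> (x has_vector_derivative b (x t) (x t)) (at t)"
    and y: "\<And>t. t \<in> J \<Longrightarrow> (y has_vector_derivative b (y t) (y t)) (at t)"
    and 0: "x 0 = y 0"
  shows "x T = y T"
proof -
  have mem: "t \<in> J" if "r \<in> J" "s \<in> J" "r \<le> t" "t \<le> s" for r s t
    using J(1)[unfolded is_interval_1] that by blast
  show ?thesis
  proof (cases "0 \<le> T")
    case True
    show ?thesis
      by (rule quadratic_ode_unique_forward[where x = x and y = y, OF b True _ _ 0]) (rule x y; rule mem[OF J(2,3)]; assumption)+
  next
    case False
    have reflected: "((\<lambda>t. z (- t)) has_vector_derivative - b (z (- t)) (z (- t))) (at t)"
      if "0 \<le> t" "t \<le> - T" and z: "\<And>t. t \<in> J \<Longrightarrow> (z has_vector_derivative b (z t) (z t)) (at t)" for z t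
    proof -
      have "- t \<in> J" using mem[OF J(3,2)] that by simp
      from vector_diff_chain_at[OF has_vector_derivative_minus[OF has_vector_derivative_id] z[OF this]]
      show ?thesis by (simp add: o_def)
    qed
    have "x (- (- T)) = y (- (- T))"
    proof (rule quadratic_ode_unique_forward[where x = "\<lambda>t. x (- t)" and y = "\<lambda>t. y (- t)",
          OF bounded_bilinear_uminus[OF b]])
      show "0 \<le> - T" "x (- 0) = y (- 0)" using False 0 by simp_all
      fix t assume t: "0 \<le> t" "t \<le> - T"
      show "((\<lambda>t. x (- t)) has_vector_derivative - b (x (- t)) (x (- t))) (at t)"
        by (rule reflected[OF t x])
      show "((\<lambda>t. y (- t)) has_vector_derivative - b (y (- t)) (y (- t))) (at t)"
        by (rule reflected[OF t y])
    qed
    then show ?thesis by simp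
  qed
qed

text \<open>The quotient of two solutions in the group is constant because \<open>x\<close> is skew.\<close>

lemma flow_unique:
  fixes c d x :: "real \<Rightarrow> cmat2"
  assumes J: "open J" "is_interval J" "0 \<in> J" "t \<in> J"
    and c: "\<And>t. t \<in> J \<Longrightarrow> (c has_vector_derivative c t ** x t) (at t)"
    and d: "\<And>t. t \<in> J \<Longrightarrow> (d has_vector_derivative d t ** x t) (at t)" "\<And>t. t \<in> J \<Longrightarrow> d t \<in> SU2"
    and x: "\<And>t. t \<in> J \<Longrightarrow> x t \<in> su" and 0: "c 0 = d 0"
  shows "c t = d t"
proof -
  let ?f = "\<lambda>s. c s ** dagger (d s)"
  have "(?f has_derivative (\<lambda>_. 0)) (at s within J)" if "s \<in> J" for s
  proof -
    have "(?f has_vector_derivative c s ** dagger (d s ** x s) + (c s ** x s) ** dagger (d s)) (at s)"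
      by (rule bounded_bilinear.has_vector_derivative[OF bounded_bilinear_mat_mult c[OF that]
            bounded_linear.has_vector_derivative[OF bounded_linear_dagger d(1)[OF that]]])
    also have "c s ** dagger (d s ** x s) + (c s ** x s) ** dagger (d s) = 0"
      by (simp add: dagger_mult suD(1)[OF x[OF that]] mm_simps)
    finally show ?thesis
      by (simp add: has_vector_derivative_def has_derivative_at_withinI)
  qed
  then have "\<exists>k. \<forall>s\<in>J. ?f s = k"
    by (intro has_derivative_zero_constant is_interval_convex J)
  then have "?f t = ?f 0" using J by metis
  then have "?f t = one" using 0 SU2D(1)[OF d(2)[OF J(3)]] by simp
  then have "?f t ** d t = d t" by simp
  then show ?thesis using SU2D(2)[OF d(2)[OF J(4)]] by (simp add: matrix_mul_assoc[symmetric])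
qed

context left_invariant_metric
begin

text \<open>A geodesic defined for all times is maximal because any other one with the same initial velocity solves
  the same Euler equation and then the same linear equation in the group.\<close>

lemma maximal_geodesic_complete:
  assumes "geodesic_from SU2 g v UNIV c"
  shows "maximal_geodesic SU2 g v UNIV c"
  unfolding maximal_geodesic_def
proof (intro conjI allI impI ballI)
  show "geodesic_from SU2 g v UNIV c" by fact
next
  fix J d assume d: "geodesic_from SU2 g v J d"
  show "J \<subseteq> UNIV" by simp
  fix t assume t: "t \<in> J"
  obtain x where x: "\<And>t. x t \<in> su" "\<And>t. (c has_vector_derivative c t ** x t) (at t)"
    "\<And>t. (x has_vector_derivative - B (x t) (x t)) (at t)" and cS: "\<And>t. c t \<in> SU2"
    using assms unfolding geodesic_from_def geodesic_iff_euler by blast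
  have J: "open J" "is_interval J" "0 \<in> J" and dS: "\<And>t. t \<in> J \<Longrightarrow> d t \<in> SU2"
    using d unfolding geodesic_from_def geodesic_iff_euler by blast+
  obtain y where y: "\<And>t. t \<in> J \<Longrightarrow> y t \<in> su" "\<And>t. t \<in> J \<Longrightarrow> (d has_vector_derivative d t ** y t) (at t)"
    "\<And>t. t \<in> J \<Longrightarrow> (y has_vector_derivative - B (y t) (y t)) (at t)"
    using d unfolding geodesic_from_def geodesic_iff_euler by blast
  have c0: "c 0 = d 0" using assms d by (simp add: geodesic_from_def)
  have "c 0 ** x 0 = d 0 ** y 0"
  proof -
    have "vector_derivative c (at 0) = vector_derivative d (at 0)"
      using assms d by (simp add: geodesic_from_def)
    then show ?thesis using vector_derivative_at[OF x(2)[of 0]] vector_derivative_at[OF y(2)[OF J(3)]] by simp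
  qed
  then have "dagger (c 0) ** (c 0 ** x 0) = dagger (c 0) ** (c 0 ** y 0)" using c0 by simp
  then have xy0: "x 0 = y 0" by (simp add: SU2_cancel[OF cS])
  have bb: "bounded_bilinear (\<lambda>u v. - B u v)"
    by (rule bounded_bilinear_uminus[OF bounded_bilinear_B])
  have xy: "x s = y s" if "s \<in> J" for s
    by (rule quadratic_ode_unique[OF bb J(2,3) that x(3) y(3) xy0])
  show "d t = c t"
  proof (rule flow_unique[where c = d and d = c and x = y, OF J t y(2)])
    show "(c has_vector_derivative c s ** y s) (at s)" if "s \<in> J" for s
      using x(2)[of s] xy[OF that] by simp
  qed (simp_all add: cS y(1) c0)
qed

end

section \<open>Generic metrics: a geodesic with a pole\<close>

lemma unit_quaternion_SU2:
  assumes n: "n \<in> su" "n ** n = - one" and uv: "u * u + v * v = (1::real)"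
  shows "u *\<^sub>R one + v *\<^sub>R n \<in> SU2"
  using uv suD[OF n(1)] unfolding SU2_iff
  by (simp add: adjugate_add dagger_add adjugate_scaleR dagger_scaleR mm_simps n(2) algebra_simps
      flip: scaleR_left_distrib)

context diagonal_metric
begin

text \<open>Euler's equations of the rigid body with moments of inertia \<open>l1, l2, l3\<close>. The factor 2 comes from the
  quaternion units, whose brackets are twice units.\<close>

lemma euler_field:
  "- B (x1 *\<^sub>R e1 + x2 *\<^sub>R e2 + x3 *\<^sub>R e3) (x1 *\<^sub>R e1 + x2 *\<^sub>R e2 + x3 *\<^sub>R e3) =
    (2 * (l2 - l3) / l1 * (x2 * x3)) *\<^sub>R e1 + (2 * (l3 - l1) / l2 * (x3 * x1)) *\<^sub>R e2
    + (2 * (l1 - l2) / l3 * (x1 * x2)) *\<^sub>R e3" (is "- B ?x ?x = _")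
proof -
  have Ax: "diag l1 l2 l3 ?x = (l1 * x1) *\<^sub>R e1 + (l2 * x2) *\<^sub>R e2 + (l3 * x3) *\<^sub>R e3"
    by (simp add: diag_def inner_add_left e_inner)
  let ?S = "((l3 - l2) * (x2 * x3)) *\<^sub>R e1 + ((l1 - l3) * (x3 * x1)) *\<^sub>R e2 + ((l2 - l1) * (x1 * x2)) *\<^sub>R e3"
  have "bracket ?x (diag l1 l2 l3 ?x) = ?S + ?S"
    unfolding Ax bracket_def
    by (simp add: mm.add_left mm.add_right mm.scaleR_left mm.scaleR_right e_mult)
      (simp add: algebra_simps)
  also have "?S + ?S = (2 * (l3 - l2) * (x2 * x3)) *\<^sub>R e1
      + (2 * (l1 - l3) * (x3 * x1)) *\<^sub>R e2 + (2 * (l2 - l1) * (x1 * x2)) *\<^sub>R e3"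
  proof -
    have two: "(2 * a * b) *\<^sub>R e = (a * b) *\<^sub>R e + (a * b) *\<^sub>R e" for a b and e :: cmat2
      by (simp only: mult_2 distrib_right scaleR_left_distrib)
    show ?thesis unfolding two by (simp only: ac_simps)
  qed
  finally have br: "bracket ?x (diag l1 l2 l3 ?x) = (2 * (l3 - l2) * (x2 * x3)) *\<^sub>R e1
      + (2 * (l1 - l3) * (x3 * x1)) *\<^sub>R e2 + (2 * (l2 - l1) * (x1 * x2)) *\<^sub>R e3" .
  have "B ?x ?x = diag (1/l1) (1/l2) (1/l3) ((2 * (l3 - l2) * (x2 * x3)) *\<^sub>R e1
      + (2 * (l1 - l3) * (x3 * x1)) *\<^sub>R e2 + (2 * (l2 - l1) * (x1 * x2)) *\<^sub>R e3)"
  proof -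
    have dbl: "(1/2) *\<^sub>R diag (1/l1) (1/l2) (1/l3) (u + u) = diag (1/l1) (1/l2) (1/l3) u" for u
      by (simp only: linear_add[OF linear_diag] scaleR_half_double)
    have "B ?x ?x = diag (1/l1) (1/l2) (1/l3) (bracket ?x (diag l1 l2 l3 ?x))"
      unfolding B_def bracket_self linear_0[OF linear_diag] add_0_left by (rule dbl)
    then show ?thesis using br by simp
  qed
  also have "- \<dots> = (2 * (l2 - l3) / l1 * (x2 * x3)) *\<^sub>R e1 + (2 * (l3 - l1) / l2 * (x3 * x1)) *\<^sub>R e2
      + (2 * (l1 - l2) / l3 * (x1 * x2)) *\<^sub>R e3"
    by (simp add: diag_def inner_add_left e_inner algebra_simps diff_divide_distrib)
  finally show ?thesis .
qed

text \<open>With velocity components \<open>a / cosh t\<close>, \<open>b / cosh t\<close> and \<open>w tanh t\<close>, Euler's equations become these three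
  equations for the amplitudes. A real solution with \<open>w\<close> different from zero exists if and only if the
  coefficients of Euler's equations for the first two components have the same sign and the third one has the opposite sign.\<close>

lemma separatrix_parameters:
  assumes "(l2 - l3) / l1 * ((l3 - l1) / l2) > 0" "(l2 - l3) / l1 * ((l1 - l2) / l3) < 0"
  obtains a b w :: real where "a * l1 = 2 * w * b * (l3 - l2)" "b * l2 = - 2 * w * a * (l3 - l1)"
    "w * l3 = 2 * a * b * (l1 - l2)" "w \<noteq> 0"
proof -
  define \<alpha>1 \<alpha>2 \<alpha>3 where "\<alpha>1 = 2 * (l2 - l3) / l1" and "\<alpha>2 = 2 * (l3 - l1) / l2" and "\<alpha>3 = 2 * (l1 - l2) / l3"
  have "\<alpha>1 * \<alpha>2 = 4 * ((l2 - l3) / l1 * ((l3 - l1) / l2))" "\<alpha>1 * \<alpha>3 = 4 * ((l2 - l3) / l1 * ((l1 - l2) / l3))"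
    using l_nonzero by (simp_all add: \<alpha>1_def \<alpha>2_def \<alpha>3_def field_simps)
  then have pos: "\<alpha>1 * \<alpha>2 > 0" "\<alpha>1 * \<alpha>3 < 0" using assms by linarith+
  then have nz: "\<alpha>1 \<noteq> 0" "\<alpha>3 \<noteq> 0" by auto
  define w where "w = 1 / sqrt (\<alpha>1 * \<alpha>2)"
  define a where "a = sqrt (- \<alpha>1 / \<alpha>3) * w"
  define b where "b = - a / (\<alpha>1 * w)"
  have w: "w \<noteq> 0" "\<alpha>1 * \<alpha>2 * w\<^sup>2 = 1" using pos(1) by (auto simp: w_def power_divide)
  have "- \<alpha>1 / \<alpha>3 \<ge> 0" using pos(2) by (auto simp: divide_le_0_iff mult_less_0_iff)
  then have a2: "a\<^sup>2 = - \<alpha>1 / \<alpha>3 * w\<^sup>2" by (simp add: a_def power_mult_distrib)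
  have "a = - \<alpha>1 * b * w" using w(1) nz by (simp add: b_def)
  then have 1: "a * l1 = 2 * w * b * (l3 - l2)" using l_nonzero by (simp add: \<alpha>1_def field_simps)
  have "b * (\<alpha>1 * w) = - \<alpha>2 * a * w * (\<alpha>1 * w)"
    using w nz by (simp add: b_def power2_eq_square algebra_simps)
  then have "b = - \<alpha>2 * a * w" using mult_right_cancel[of "\<alpha>1 * w" b "- \<alpha>2 * a * w"] w(1) nz by simp
  then have 2: "b * l2 = - 2 * w * a * (l3 - l1)" using l_nonzero by (simp add: \<alpha>2_def field_simps)
  have "w * w = \<alpha>3 * a * b * w" using w(1) nz a2 by (simp add: b_def power2_eq_square field_simps)
  then have "w = \<alpha>3 * a * b" using w(1) by simp
  then have 3: "w * l3 = 2 * a * b * (l1 - l2)" using l_nonzero by (simp add: \<alpha>3_def field_simps)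
  show ?thesis using that 1 2 3 w(1) by blast
qed

text \<open>The angular momentum \<open>A x\<close> moves in the plane of \<open>e3\<close> and a fixed vector orthogonal to it, from \<open>- e3\<close> to
  \<open>e3\<close> up to scale. The rotation \<open>R\<close> about the fixed unit \<open>N\<close>, with half angle \<open>arctan (exp t)\<close>, brings it to
  its constant value in space. The remaining factor \<open>Q\<close> is a rotation about this constant vector and has
  constant speed. So the geodesic is \<open>Q R\<close>; conjugating \<open>e3\<close> by it eliminates \<open>Q\<close> and shows \<open>tanh\<close>.\<close>

lemma separatrix_not_C_complete:
  assumes "(l2 - l3) / l1 * ((l3 - l1) / l2) > 0" "(l2 - l3) / l1 * ((l1 - l2) / l3) < 0"
  shows "\<not> C_complete g"
proof
  assume complete: "C_complete g"
  obtain a b w :: real where E: "a * l1 = 2 * w * b * (l3 - l2)" "b * l2 = - 2 * w * a * (l3 - l1)"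
    "w * l3 = 2 * a * b * (l1 - l2)" and w: "w \<noteq> 0"
    by (rule separatrix_parameters[OF assms])
  \<comment> \<open>Subtracting from the velocity its part \<open>A x / l3\<close> along the angular momentum leaves a multiple of the fixed
    vector \<open>n1 e1 + n2 e2\<close>.\<close>
  define n1 n2 where "n1 = 2 * a * (l3 - l1) / l3" and "n2 = 2 * b * (l3 - l2) / l3"
  have ab: "a = w * n2 + n1 / 2" "b = - w * n1 + n2 / 2"
  proof -
    have "w * n2 = (2 * w * b * (l3 - l2)) / l3" "- w * n1 = (- 2 * w * a * (l3 - l1)) / l3"
      by (simp_all add: n1_def n2_def)
    then have "w * n2 = a * l1 / l3" "- w * n1 = b * l2 / l3" by (simp_all only: E(1,2))
    then show "a = w * n2 + n1 / 2" "b = - w * n1 + n2 / 2"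
      using l_nonzero by (simp_all add: n1_def n2_def right_diff_distrib diff_divide_distrib)
  qed
  have unit: "n1 * n1 + n2 * n2 = 1"
  proof -
    have n: "w * l3 * n1 = - b * l2" "w * l3 * n2 = a * l1"
    proof -
      have "w * l3 * n1 = - (- 2 * w * a * (l3 - l1))" "w * l3 * n2 = 2 * w * b * (l3 - l2)"
        using l_nonzero by (simp_all add: n1_def n2_def)
      then show "w * l3 * n1 = - b * l2" "w * l3 * n2 = a * l1"
        unfolding E(1,2)[symmetric] by simp_all
    qed
    have "(w * l3)\<^sup>2 * (n1 * n1 + n2 * n2) = (w * l3 * n1)\<^sup>2 + (w * l3 * n2)\<^sup>2"
      by (simp add: power2_eq_square algebra_simps)
    also have "\<dots> = (b * l2) * (b * l2) + (a * l1) * (a * l1)" unfolding n by (simp add: power2_eq_square)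
    also have "\<dots> = (- 2 * w * a * (l3 - l1)) * (b * l2) + (2 * w * b * (l3 - l2)) * (a * l1)"
      using E by simp
    also have "\<dots> = (w * l3) * (2 * a * b * (l1 - l2))" by (simp add: algebra_simps)
    also have "\<dots> = (w * l3)\<^sup>2 * 1" using E(3) by (simp add: power2_eq_square)
    finally show ?thesis using w l_nonzero by simp
  qed
  define N where "N = n1 *\<^sub>R e1 + n2 *\<^sub>R e2"
  have N: "N \<in> su" unfolding N_def by (intro su_add su_scale e_su)
  have NN: "N ** N = - one"
  proof -
    have "N ** N = - (n1 * n1 + n2 * n2) *\<^sub>R one"
      unfolding N_def by (simp add: mm.add_left mm.add_right mm.scaleR_left mm.scaleR_right e_mult)
        (simp add: algebra_simps)
    then show ?thesis using unit by simp
  qed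
  have Ne: "N ** e3 = - (e3 ** N)" "e3 ** N = n1 *\<^sub>R e2 - n2 *\<^sub>R e1"
    unfolding N_def by (simp_all add: mm.add_left mm.add_right mm.scaleR_left mm.scaleR_right e_mult)
  define \<phi> where "\<phi> = (\<lambda>t::real. arctan (exp t))"
  \<comment> \<open>These are \<open>1 / cosh\<close> and \<open>tanh\<close>, written with \<open>exp\<close>.\<close>
  define sh th where "sh = (\<lambda>t::real. 2 * exp t / (1 + (exp t)\<^sup>2))"
    and "th = (\<lambda>t::real. ((exp t)\<^sup>2 - 1) / (1 + (exp t)\<^sup>2))"
  have den: "1 + (exp t)\<^sup>2 \<noteq> 0" for t :: real by (smt (verit) zero_le_power2)
  have cs: "cos (\<phi> t) * cos (\<phi> t) - sin (\<phi> t) * sin (\<phi> t) = - th t" "2 * (cos (\<phi> t) * sin (\<phi> t)) = sh t" for t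
  proof -
    have c2: "(cos (\<phi> t))\<^sup>2 = 1 / (1 + (exp t)\<^sup>2)" "(sin (\<phi> t))\<^sup>2 = (exp t)\<^sup>2 / (1 + (exp t)\<^sup>2)"
      by (simp_all add: \<phi>_def cos_arctan sin_arctan power_divide add_nonneg_nonneg)
    then show "cos (\<phi> t) * cos (\<phi> t) - sin (\<phi> t) * sin (\<phi> t) = - th t"
      by (simp add: th_def power2_eq_square[symmetric] diff_divide_distrib)
    have "cos (\<phi> t) * sin (\<phi> t) = exp t * (cos (\<phi> t))\<^sup>2"
      by (simp add: \<phi>_def cos_arctan sin_arctan power2_eq_square)
    then show "2 * (cos (\<phi> t) * sin (\<phi> t)) = sh t" using c2 by (simp add: sh_def)
  qed
  have d\<phi>: "(\<phi> has_real_derivative sh t / 2) (at t)" for t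
  proof -
    have "(\<phi> has_real_derivative inverse (1 + (exp t)\<^sup>2) * exp t) (at t)"
      unfolding \<phi>_def by (rule DERIV_chain2[OF DERIV_arctan DERIV_exp])
    moreover have "2 * E / D / 2 = inverse D * E" for E D :: real by (simp add: inverse_eq_divide)
    ultimately show ?thesis unfolding sh_def by (simp only:)
  qed
  have dD: "((\<lambda>t. 1 + (exp t)\<^sup>2) has_real_derivative 2 * (exp t)\<^sup>2) (at t)" for t :: real
    by (auto intro!: derivative_eq_intros simp: power2_eq_square)
  have dsh: "(sh has_real_derivative - sh t * th t) (at t)" for t
  proof -
    have "(sh has_real_derivative (2 * exp t * (1 + (exp t)\<^sup>2) - 2 * exp t * (2 * (exp t)\<^sup>2)) /
        ((1 + (exp t)\<^sup>2) * (1 + (exp t)\<^sup>2))) (at t)"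
      unfolding sh_def by (rule DERIV_divide[OF DERIV_cmult[OF DERIV_exp] dD den])
    also have "2 * exp t * (1 + (exp t)\<^sup>2) - 2 * exp t * (2 * (exp t)\<^sup>2) = - (2 * exp t) * ((exp t)\<^sup>2 - 1)"
      by (simp add: algebra_simps)
    finally show ?thesis by (simp only: sh_def th_def times_divide_times_eq minus_divide_left)
  qed
  have dth: "(th has_real_derivative sh t * sh t) (at t)" for t
  proof -
    have "((\<lambda>t. (exp t)\<^sup>2 - 1) has_real_derivative 2 * (exp t)\<^sup>2) (at t)"
      by (auto intro!: derivative_eq_intros simp: power2_eq_square)
    from DERIV_divide[OF this dD den] have "(th has_real_derivative
        (2 * (exp t)\<^sup>2 * (1 + (exp t)\<^sup>2) - ((exp t)\<^sup>2 - 1) * (2 * (exp t)\<^sup>2)) /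
        ((1 + (exp t)\<^sup>2) * (1 + (exp t)\<^sup>2))) (at t)"
      unfolding th_def .
    also have "2 * (exp t)\<^sup>2 * (1 + (exp t)\<^sup>2) - ((exp t)\<^sup>2 - 1) * (2 * (exp t)\<^sup>2) = (2 * exp t) * (2 * exp t)"
      by (simp add: algebra_simps power2_eq_square)
    finally show ?thesis by (simp only: sh_def times_divide_times_eq)
  qed
  define Q where "Q = (\<lambda>t. cos (w * t) *\<^sub>R one + (- sin (w * t)) *\<^sub>R e3)"
  define R where "R = (\<lambda>t. cos (\<phi> t) *\<^sub>R one + sin (\<phi> t) *\<^sub>R N)"
  define c where "c = (\<lambda>t. Q t ** R t)"
  define x where "x = (\<lambda>t. (a * sh t) *\<^sub>R e1 + (b * sh t) *\<^sub>R e2 + (w * th t) *\<^sub>R e3)"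
  have Q: "Q t \<in> SU2" for t unfolding Q_def
    by (rule unit_quaternion_SU2[OF e_su(3) e_square(3)]) (use sin_cos_squared_add2[of "w * t"] in \<open>simp add: power2_eq_square\<close>)
  have R: "R t \<in> SU2" for t unfolding R_def
    by (rule unit_quaternion_SU2[OF N NN]) (use sin_cos_squared_add2[of "\<phi> t"] in \<open>simp add: power2_eq_square\<close>)
  have conj: "dagger (R t) ** e3 ** R t = (- th t) *\<^sub>R e3 + sh t *\<^sub>R (e3 ** N)" for t
  proof -
    let ?C = "cos (\<phi> t)" and ?S = "sin (\<phi> t)"
    have "dagger (R t) ** e3 ** R t = (?C * ?C - ?S * ?S) *\<^sub>R e3 + (2 * (?C * ?S)) *\<^sub>R (e3 ** N)"
    proof -
      have NeN: "e3 ** (N ** N) = - e3" by (simp add: NN mm.minus_right)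
      have "dagger (R t) = ?C *\<^sub>R one - ?S *\<^sub>R N"
        by (simp add: R_def dagger_add dagger_scaleR suD(1)[OF N])
      then have "dagger (R t) ** e3 = ?C *\<^sub>R e3 + ?S *\<^sub>R (e3 ** N)"
        by (simp add: mm.diff_left mm.scaleR_left Ne(1))
      then show ?thesis
        by (simp add: R_def mm.add_left mm.add_right mm.scaleR_left mm.scaleR_right
            matrix_mul_assoc[symmetric] NeN) (simp add: algebra_simps flip: scaleR_2)
    qed
    then show ?thesis unfolding cs .
  qed
  have x_eq: "x t = (- w) *\<^sub>R (dagger (R t) ** e3 ** R t) + (sh t / 2) *\<^sub>R N" for t
    unfolding conj Ne(2) unfolding x_def N_def by (subst ab(1), subst ab(2)) (simp add: algebra_simps)
  have dQ: "(Q has_vector_derivative (- w) *\<^sub>R (Q t ** e3)) (at t)" for t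
  proof -
    have "((\<lambda>t. cos (w * t)) has_real_derivative - w * sin (w * t)) (at t)"
      "((\<lambda>t. - sin (w * t)) has_real_derivative - w * cos (w * t)) (at t)"
      by (auto intro!: derivative_eq_intros)
    then have "(Q has_vector_derivative (- w * sin (w * t)) *\<^sub>R one + (- w * cos (w * t)) *\<^sub>R e3) (at t)"
      unfolding Q_def by (intro has_vector_derivative_add has_vector_derivative_scaleR_const)
    then show ?thesis by (simp add: Q_def mm.diff_left mm.scaleR_left e_square scaleR_diff_right scaleR_add_right add.commute)
  qed
  have dR: "(R has_vector_derivative (sh t / 2) *\<^sub>R (R t ** N)) (at t)" for t
  proof -
    have "((\<lambda>t. cos (\<phi> t)) has_real_derivative - sh t / 2 * sin (\<phi> t)) (at t)"
      "((\<lambda>t. sin (\<phi> t)) has_real_derivative sh t / 2 * cos (\<phi> t)) (at t)"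
      by (auto intro!: derivative_eq_intros d\<phi>)
    then have "(R has_vector_derivative (- sh t / 2 * sin (\<phi> t)) *\<^sub>R one + (sh t / 2 * cos (\<phi> t)) *\<^sub>R N) (at t)"
      unfolding R_def by (intro has_vector_derivative_add has_vector_derivative_scaleR_const)
    then show ?thesis by (simp add: R_def mm.add_left mm.scaleR_left NN scaleR_diff_right scaleR_add_right add.commute)
  qed
  have dc: "(c has_vector_derivative c t ** x t) (at t)" for t
  proof -
    have "(c has_vector_derivative Q t ** ((sh t / 2) *\<^sub>R (R t ** N)) + ((- w) *\<^sub>R (Q t ** e3)) ** R t) (at t)"
      unfolding c_def by (rule bounded_bilinear.has_vector_derivative[OF bounded_bilinear_mat_mult dQ dR])
    moreover have "c t ** x t = Q t ** ((sh t / 2) *\<^sub>R (R t ** N)) + ((- w) *\<^sub>R (Q t ** e3)) ** R t"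
      unfolding c_def x_eq
      by (simp add: mm_simps SU2_cancel[OF R])
    ultimately show ?thesis by simp
  qed
  have dx: "(x has_vector_derivative - B (x t) (x t)) (at t)" for t
  proof -
    have "((\<lambda>t. a * sh t) has_real_derivative a * (- sh t * th t)) (at t)"
      "((\<lambda>t. b * sh t) has_real_derivative b * (- sh t * th t)) (at t)"
      "((\<lambda>t. w * th t) has_real_derivative w * (sh t * sh t)) (at t)"
      by (intro DERIV_cmult dsh dth)+
    then have "(x has_vector_derivative (a * (- sh t * th t)) *\<^sub>R e1 + (b * (- sh t * th t)) *\<^sub>R e2
        + (w * (sh t * sh t)) *\<^sub>R e3) (at t)"
      unfolding x_def by (intro has_vector_derivative_add has_vector_derivative_scaleR_const)
    moreover have "a * (- sh t * th t) = 2 * (l2 - l3) / l1 * ((b * sh t) * (w * th t))"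
    proof -
      have "a = 2 * (l2 - l3) / l1 * b * w * (- 1)" using E(1) l_nonzero by (simp add: field_simps)
      then show ?thesis by simp
    qed
    moreover have "b * (- sh t * th t) = 2 * (l3 - l1) / l2 * ((w * th t) * (a * sh t))"
    proof -
      have "b = 2 * (l3 - l1) / l2 * a * w * (- 1)" using E(2) l_nonzero by (simp add: field_simps)
      then show ?thesis by simp
    qed
    moreover have "w * (sh t * sh t) = 2 * (l1 - l2) / l3 * ((a * sh t) * (b * sh t))"
    proof -
      have "w = 2 * (l1 - l2) / l3 * a * b" using E(3) l_nonzero by (simp add: field_simps)
      then show ?thesis by simp
    qed
    ultimately show ?thesis unfolding x_def euler_field by (simp only:)
  qed
  have xsu: "x t \<in> su" for t unfolding x_def by (intro su_add su_scale e_su)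
  have cSU: "c t \<in> SU2" for t unfolding c_def by (intro SU2_mult Q R)
  have "smooth_on UNIV (\<lambda>t. (c t, x t))"
  proof (rule smooth_on_ode_solution[where G = "\<lambda>z :: cmat2 \<times> cmat2. (fst z ** snd z, - B (snd z) (snd z))", OF open_UNIV])
    show "((\<lambda>t. (c t, x t)) has_vector_derivative
        (fst (c t, x t) ** snd (c t, x t), - B (snd (c t, x t)) (snd (c t, x t)))) (at t)" for t
      using has_vector_derivative_Pair[OF dc dx] by simp
    have f: "smooth_on UNIV (fst :: cmat2 \<times> cmat2 \<Rightarrow> cmat2)" "smooth_on UNIV (snd :: cmat2 \<times> cmat2 \<Rightarrow> cmat2)"
      using smooth_on_linear[OF bounded_linear_fst open_UNIV smooth_on_id[OF open_UNIV]]
        smooth_on_linear[OF bounded_linear_snd open_UNIV smooth_on_id[OF open_UNIV]] by auto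
    show "smooth_on UNIV (\<lambda>z :: cmat2 \<times> cmat2. (fst z ** snd z, - B (snd z) (snd z)))"
      by (rule smooth_on_Pair[OF open_UNIV smooth_on_bilinear[OF bounded_bilinear_mat_mult open_UNIV f]
            smooth_on_linear[OF bounded_linear_minus[OF bounded_linear_ident] open_UNIV
              smooth_on_bilinear[OF bounded_bilinear_B open_UNIV f(2) f(2)]]])
  qed
  from smooth_on_linear[OF bounded_linear_fst open_UNIV this] have sc: "smooth_on UNIV c" by simp
  have "geodesic_from SU2 g (c 0, c 0 ** x 0) UNIV c"
    unfolding geodesic_from_def geodesic_iff_euler
    using sc cSU xsu dc dx vector_derivative_at[OF dc[of 0]] by (auto intro!: exI[of _ x])
  then have max: "maximal_geodesic SU2 g (c 0, c 0 ** x 0) UNIV c" by (rule maximal_geodesic_complete)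
  have "(c 0, c 0 ** x 0) \<in> tangent_bundle SU2"
    using cSU xsu by (simp add: tangent_bundle_SU2_iff SU2_cancel)
  from complete[unfolded C_complete_def, rule_format, OF this max] obtain F :: "complex \<Rightarrow> cmat2" where hol: "\<And>i j. (\<lambda>z. F z $ i $ j) holomorphic_on UNIV"
    and F: "\<And>t. F (complex_of_real t) = c t"
    by auto
  \<comment> \<open>The \<open>e3\<close> component of the conjugate of \<open>e3\<close>. The adjugate is polynomial in the entries, so it
    stands for the inverse without division or conjugation.\<close>
  define H where "H = (\<lambda>z. - (1 / 2) * trace (e3 ** (adjugate (F z) ** e3 ** F z)))"
  have "H holomorphic_on UNIV"
    unfolding H_def trace_def matrix_matrix_mult_def adjugate_def mat_def
    by (simp add: sum_2) (intro holomorphic_intros hol; simp)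
  then have hol_eq: "(\<lambda>z. H z * (1 + (exp z)\<^sup>2) + ((exp z)\<^sup>2 - 1)) holomorphic_on UNIV"
    by (intro holomorphic_intros)
  have real_eq: "H (complex_of_real t) * (1 + (exp (complex_of_real t))\<^sup>2) + ((exp (complex_of_real t))\<^sup>2 - 1) = 0" for t
  proof -
    have "adjugate (c t) ** e3 ** c t = dagger (R t) ** (dagger (Q t) ** e3 ** Q t) ** R t"
      unfolding SU2D(3)[OF cSU] by (simp add: c_def dagger_mult matrix_mul_assoc)
    also have "e3 ** Q t = Q t ** e3"
      by (simp add: Q_def mm.diff_left mm.diff_right mm.scaleR_left mm.scaleR_right)
    then have "dagger (Q t) ** e3 ** Q t = e3" by (simp add: matrix_mul_assoc[symmetric] SU2_cancel[OF Q])
    finally have "adjugate (c t) ** e3 ** c t = (- th t) *\<^sub>R e3 + sh t *\<^sub>R (e3 ** N)"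
      using conj by (simp add: matrix_mul_assoc)
    then have "e3 ** (adjugate (c t) ** e3 ** c t) = th t *\<^sub>R one - sh t *\<^sub>R N"
      by (simp add: mm.add_right mm.diff_right mm.minus_right mm.scaleR_right e_square matrix_mul_assoc mm.minus_left)
    moreover have "trace (u *\<^sub>R one - v *\<^sub>R N) = 2 * complex_of_real u" for u v
      using N by (simp add: su_elements trace_def sum_2 mat_def scaleR_conv_of_real[where 'a = complex])
    ultimately have "H (complex_of_real t) = - complex_of_real (th t)" by (simp add: H_def F)
    moreover have "complex_of_real (th t) * (1 + (exp (complex_of_real t))\<^sup>2) = (exp (complex_of_real t))\<^sup>2 - 1"
    proof -
      have "th t * (1 + (exp t)\<^sup>2) = (exp t)\<^sup>2 - 1" using den[of t] by (simp add: th_def)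
      from arg_cong[OF this, of complex_of_real] show ?thesis by (simp add: exp_of_real)
    qed
    ultimately show ?thesis by (simp only: mult_minus_left) simp
  qed
  have lim: "(0::complex) islimpt \<real>"
  proof (rule islimptI)
    fix T :: "complex set" assume "0 \<in> T" "open T"
    then obtain e where e: "e > 0" "ball 0 e \<subseteq> T" using openE by blast
    then have "complex_of_real (e / 2) \<in> T" by (auto simp: subset_iff)
    then show "\<exists>y\<in>\<real>. y \<in> T \<and> y \<noteq> 0" using e(1) by (intro bexI[of _ "complex_of_real (e / 2)"]) auto
  qed
  have "H (\<i> * (pi / 2)) * (1 + (exp (\<i> * (pi / 2)))\<^sup>2) + ((exp (\<i> * (pi / 2)))\<^sup>2 - 1) = 0"
  proof (rule analytic_continuation[OF hol_eq open_UNIV connected_UNIV subset_UNIV UNIV_I lim _ UNIV_I])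
    fix z :: complex assume "z \<in> \<real>"
    then obtain t where "z = complex_of_real t" by (rule Reals_cases)
    then show "H z * (1 + (exp z)\<^sup>2) + ((exp z)\<^sup>2 - 1) = 0" using real_eq[of t] by simp
  qed
  moreover have "(exp (\<i> * (complex_of_real pi / 2)))\<^sup>2 = - 1"
  proof -
    have "(exp (\<i> * (complex_of_real pi / 2)))\<^sup>2 = exp (\<i> * complex_of_real pi)"
      by (simp add: power2_eq_square exp_add[symmetric] distrib_left[symmetric])
    then show ?thesis by (simp add: exp_pi_i)
  qed
  ultimately show False by simp
qed

end

text \<open>The unstable axis is the one whose reciprocal eigenvalue lies between the two other reciprocals. A cyclic
  permutation of the basis makes it the third.\<close>

lemma generic_not_C_complete:
  assumes "diagonal_metric e1 e2 e3 l1 l2 l3 g" "l1 < l2" "l2 < l3"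
  shows "\<not> C_complete g"
proof -
  have r1: "diagonal_metric e2 e3 e1 l2 l3 l1 g" by (rule diagonal_metric.rotate_metric[OF assms(1)])
  have r2: "diagonal_metric e3 e1 e2 l3 l1 l2 g" by (rule diagonal_metric.rotate_metric[OF r1])
  have nz: "l1 \<noteq> 0" "l2 \<noteq> 0" "l3 \<noteq> 0" using diagonal_metric.l_nonzero[OF assms(1)] by auto
  consider "l1 < 0" "l2 > 0" | "l2 < 0" "l3 > 0" | "l1 > 0" | "l3 < 0" using nz by linarith
  then show ?thesis
  proof cases
    case 1
    then show ?thesis using assms(2,3)
      by (intro diagonal_metric.separatrix_not_C_complete[OF assms(1)])
        (auto simp: zero_less_mult_iff mult_less_0_iff zero_less_divide_iff divide_less_0_iff)
  next
    case 2
    then show ?thesis using assms(2,3)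
      by (intro diagonal_metric.separatrix_not_C_complete[OF r1])
        (auto simp: zero_less_mult_iff mult_less_0_iff zero_less_divide_iff divide_less_0_iff)
  next
    case 3
    then show ?thesis using assms(2,3)
      by (intro diagonal_metric.separatrix_not_C_complete[OF r2])
        (auto simp: zero_less_mult_iff mult_less_0_iff zero_less_divide_iff divide_less_0_iff)
  next
    case 4
    then show ?thesis using assms(2,3)
      by (intro diagonal_metric.separatrix_not_C_complete[OF r2])
        (auto simp: zero_less_mult_iff mult_less_0_iff zero_less_divide_iff divide_less_0_iff)
  qed
qed

section \<open>The exponential map of imaginary multiples\<close>

lemma entire_power_series_smooth:
  fixes a :: "nat \<Rightarrow> real"
  assumes "\<And>x. summable (\<lambda>n. a n * x ^ n)"
  shows "smooth_on UNIV (\<lambda>x. \<Sum>n. a n * x ^ n)"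
  unfolding smooth_on_def
proof
  fix k show "Ck_on k UNIV (\<lambda>x. \<Sum>n. a n * x ^ n)"
    using assms
  proof (induction k arbitrary: a)
    case 0
    have "isCont (\<lambda>x. \<Sum>n. a n * x ^ n) x" for x
      by (rule DERIV_isCont[OF termdiffs_strong_converges_everywhere[OF 0]])
    then show ?case by (simp add: continuous_at_imp_continuous_on)
  next
    case (Suc k)
    show ?case
    proof (rule Ck_on_SucI[OF open_UNIV])
      show "((\<lambda>x. \<Sum>n. a n * x ^ n) has_derivative (\<lambda>v. v *\<^sub>R (\<Sum>n. diffs a n * x ^ n))) (at x)" for x
        using termdiffs_strong_converges_everywhere[OF Suc.prems, of x]
        by (simp add: has_field_derivative_def mult_commute_abs)
      show "Ck_on k UNIV (\<lambda>x. v *\<^sub>R (\<Sum>n. diffs a n * x ^ n))" for v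
        by (rule Ck_on_bounded_linear_comp[OF open_UNIV bounded_linear_scaleR_right Suc.IH])
          (rule termdiff_converges_all[OF Suc.prems])
    qed
  qed
qed

text \<open>The values at \<open>r\<close> of the entire functions \<open>cosh (sqrt r)\<close> and \<open>sinh (sqrt r) / sqrt r\<close>. As power series in
  \<open>r\<close> they are smooth at zero and for negative arguments as well.\<close>

definition cosh_sqrt :: "real \<Rightarrow> real" where
  "cosh_sqrt r = (\<Sum>n. (1 / fact (2 * n)) * r ^ n)"

definition sinhc_sqrt :: "real \<Rightarrow> real" where
  "sinhc_sqrt r = (\<Sum>n. (1 / fact (2 * n + 1)) * r ^ n)"

lemma summable_over_fact:
  fixes r :: real
  assumes "\<And>n. n \<le> m n"
  shows "summable (\<lambda>n. (1 / fact (m n)) * r ^ n)"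
proof (rule summable_comparison_test'[OF summable_exp[of "\<bar>r\<bar>"]])
  fix n :: nat
  have "(fact n :: real) \<le> fact (m n)" using assms by (intro fact_mono) auto
  then have "1 / fact (m n) \<le> inverse (fact n :: real)" by (simp add: inverse_eq_divide frac_le)
  then show "norm ((1 / fact (m n)) * r ^ n) \<le> inverse (fact n) * \<bar>r\<bar> ^ n"
    by (simp add: abs_mult power_abs mult_right_mono divide_inverse)
qed

lemma summable_cosh_sqrt: "summable (\<lambda>n. (1 / fact (2 * n)) * (r::real) ^ n)"
  and summable_sinhc_sqrt: "summable (\<lambda>n. (1 / fact (2 * n + 1)) * (r::real) ^ n)"
  using summable_over_fact[of "\<lambda>n. 2 * n"] summable_over_fact[of "\<lambda>n. 2 * n + 1"] by auto

lemma smooth_cosh_sqrt: "smooth_on UNIV cosh_sqrt"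
  unfolding cosh_sqrt_def[abs_def] by (rule entire_power_series_smooth[OF summable_cosh_sqrt])

lemma smooth_sinhc_sqrt: "smooth_on UNIV sinhc_sqrt"
  unfolding sinhc_sqrt_def[abs_def] by (rule entire_power_series_smooth[OF summable_sinhc_sqrt])

lemma cosh_sqrt_derivative: "(cosh_sqrt has_real_derivative sinhc_sqrt r / 2) (at r)"
proof -
  have "diffs (\<lambda>n. 1 / fact (2 * n) :: real) n = (1 / fact (2 * n + 1)) / 2" for n
  proof -
    have "(fact (2 * Suc n) :: real) = (2 * real (Suc n)) * fact (2 * n + 1)"
      by simp
    then show ?thesis by (simp add: diffs_def divide_simps del: fact_Suc of_nat_Suc)
  qed
  then have "(cosh_sqrt has_real_derivative (\<Sum>n. (1 / fact (2 * n + 1)) / 2 * r ^ n)) (at r)"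
    using termdiffs_strong_converges_everywhere[OF summable_cosh_sqrt, of r]
    unfolding cosh_sqrt_def[abs_def] by simp
  moreover have "(\<Sum>n. (1 / fact (2 * n + 1)) / 2 * r ^ n) = sinhc_sqrt r / 2"
    using suminf_divide[OF summable_sinhc_sqrt[of r], of 2] by (simp only: sinhc_sqrt_def times_divide_eq_left)
  ultimately show ?thesis by (simp only:)
qed

definition sinhc_sqrt' :: "real \<Rightarrow> real" where
  "sinhc_sqrt' r = (\<Sum>n. diffs (\<lambda>n. 1 / fact (2 * n + 1)) n * r ^ n)"

lemma sinhc_sqrt_derivative: "(sinhc_sqrt has_real_derivative sinhc_sqrt' r) (at r)"
  using termdiffs_strong_converges_everywhere[OF summable_sinhc_sqrt, of r]
  unfolding sinhc_sqrt_def[abs_def] sinhc_sqrt'_def .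

lemma sinhc_sqrt_ode: "sinhc_sqrt r + 2 * r * sinhc_sqrt' r = cosh_sqrt r"
proof -
  let ?a = "\<lambda>n. 1 / fact (2 * n + 1) :: real"
  have "(\<lambda>n. real n * ?a n * r ^ (n - Suc 0)) sums sinhc_sqrt' r"
    unfolding sinhc_sqrt'_def
    by (rule diffs_equiv[OF termdiff_converges_all[OF summable_sinhc_sqrt]])
  then have 1: "(\<lambda>n. 2 * r * (real n * ?a n * r ^ (n - Suc 0))) sums (2 * r * sinhc_sqrt' r)"
    by (rule sums_mult)
  have 2: "(\<lambda>n. ?a n * r ^ n) sums sinhc_sqrt r"
    unfolding sinhc_sqrt_def by (rule summable_sums[OF summable_sinhc_sqrt])
  have "?a n * r ^ n + 2 * r * (real n * ?a n * r ^ (n - Suc 0)) = (1 / fact (2 * n)) * r ^ n" for n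
  proof -
    have shift: "2 * r * (real n * ?a n * r ^ (n - Suc 0)) = 2 * real n * ?a n * r ^ n"
      by (cases n) (simp_all del: fact_Suc mult_Suc_right of_nat_Suc add: ac_simps)
    have "?a n * (1 + 2 * real n) = 1 / fact (2 * n)"
      by (simp add: divide_simps)
    then have "(?a n * (1 + 2 * real n)) * r ^ n = (1 / fact (2 * n)) * r ^ n" by (simp only:)
    moreover have "a * x + 2 * m * a * x = (a * (1 + 2 * m)) * x" for a x m :: real
      by (simp add: algebra_simps)
    ultimately show ?thesis unfolding shift by (simp only:)
  qed
  with sums_add[OF 2 1] have "(\<lambda>n. (1 / fact (2 * n)) * r ^ n) sums (sinhc_sqrt r + 2 * r * sinhc_sqrt' r)"
    by simp
  then show ?thesis unfolding cosh_sqrt_def by (simp add: sums_iff)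
qed

lemma cosh_sinh_sqrt_identity: "(cosh_sqrt r)\<^sup>2 - r * (sinhc_sqrt r)\<^sup>2 = 1"
proof -
  let ?f = "\<lambda>r. (cosh_sqrt r)\<^sup>2 - r * (sinhc_sqrt r)\<^sup>2"
  have "(?f has_real_derivative 0) (at r)" for r
  proof -
    have "(?f has_real_derivative 2 * cosh_sqrt r * (sinhc_sqrt r / 2)
        - (1 * (sinhc_sqrt r)\<^sup>2 + r * (2 * sinhc_sqrt r * sinhc_sqrt' r))) (at r)"
      by (auto intro!: derivative_eq_intros cosh_sqrt_derivative sinhc_sqrt_derivative simp: algebra_simps)
    also have "2 * cosh_sqrt r * (sinhc_sqrt r / 2) - (1 * (sinhc_sqrt r)\<^sup>2 + r * (2 * sinhc_sqrt r * sinhc_sqrt' r)) = 0"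
      unfolding sinhc_sqrt_ode[symmetric, of r] by (simp add: power2_eq_square algebra_simps)
    finally show ?thesis .
  qed
  then have "?f r = ?f 0" by (intro DERIV_isconst_all) auto
  also have "cosh_sqrt 0 = 1"
  proof -
    have "cosh_sqrt 0 = 1 / fact (2 * 0)" unfolding cosh_sqrt_def by (rule powser_zero)
    then show ?thesis by simp
  qed
  then have "?f 0 = 1" by simp
  finally show ?thesis .
qed

text \<open>On the Lie algebra this is the matrix exponential of \<open>itimes w\<close>. Written with the two
  power series in the squared length it is visibly smooth.\<close>

definition expi :: "cmat2 \<Rightarrow> cmat2" where
  "expi w = cosh_sqrt ((w \<bullet> w) / 2) *\<^sub>R one + sinhc_sqrt ((w \<bullet> w) / 2) *\<^sub>R itimes w"

definition dexpi :: "cmat2 \<Rightarrow> cmat2 \<Rightarrow> cmat2" where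
  "dexpi w v = (sinhc_sqrt ((w \<bullet> w) / 2) / 2 * (w \<bullet> v)) *\<^sub>R one
     + (sinhc_sqrt' ((w \<bullet> w) / 2) * (w \<bullet> v)) *\<^sub>R itimes w + sinhc_sqrt ((w \<bullet> w) / 2) *\<^sub>R itimes v"

lemma smooth_expi: "smooth_on UNIV expi"
proof -
  have n: "smooth_on UNIV (\<lambda>w :: cmat2. (w \<bullet> w) / 2)"
    by (rule smooth_on_linear[OF bounded_linear_divide open_UNIV
          smooth_on_bilinear[OF bounded_bilinear_inner open_UNIV smooth_on_id[OF open_UNIV] smooth_on_id[OF open_UNIV]]])
  have f: "smooth_on UNIV (\<lambda>w :: cmat2. h ((w \<bullet> w) / 2))" if "smooth_on UNIV h" for h :: "real \<Rightarrow> real"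
    by (rule smooth_on_compose[OF open_UNIV open_UNIV subset_UNIV n that])
  have i: "smooth_on UNIV itimes"
    using smooth_on_linear[OF bounded_linear_itimes open_UNIV smooth_on_id[OF open_UNIV]] by simp
  show ?thesis unfolding expi_def[abs_def]
    by (rule smooth_on_add[OF open_UNIV
          smooth_on_bilinear[OF bounded_bilinear_scaleR open_UNIV f[OF smooth_cosh_sqrt] smooth_on_const]
          smooth_on_bilinear[OF bounded_bilinear_scaleR open_UNIV f[OF smooth_sinhc_sqrt] i]])
qed

lemma expi_has_derivative: "(expi has_derivative dexpi w) (at w)"
proof -
  have n: "((\<lambda>w :: cmat2. (w \<bullet> w) / 2) has_derivative (\<lambda>v. w \<bullet> v)) (at w)"
    using bounded_linear.has_derivative[OF bounded_linear_divide[of 2] bounded_bilinear.FDERIV[OF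
          bounded_bilinear_inner has_derivative_ident has_derivative_ident], of w UNIV]
    by (simp add: inner_commute)
  note c = DERIV_compose_FDERIV[OF cosh_sqrt_derivative n] and s = DERIV_compose_FDERIV[OF sinhc_sqrt_derivative n]
  have i: "(itimes has_derivative itimes) (at w)"
    by (rule bounded_linear_imp_has_derivative[OF bounded_linear_itimes])
  have "(expi has_derivative (\<lambda>v. (cosh_sqrt ((w \<bullet> w) / 2) *\<^sub>R 0 + (w \<bullet> v * (sinhc_sqrt ((w \<bullet> w) / 2) / 2)) *\<^sub>R one)
      + (sinhc_sqrt ((w \<bullet> w) / 2) *\<^sub>R itimes v + (w \<bullet> v * sinhc_sqrt' ((w \<bullet> w) / 2)) *\<^sub>R itimes w))) (at w)"
    unfolding expi_def[abs_def]
    by (rule has_derivative_add[OF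
          bounded_bilinear.FDERIV[OF bounded_bilinear_scaleR c has_derivative_const]
          bounded_bilinear.FDERIV[OF bounded_bilinear_scaleR s i]])
  then show ?thesis by (simp add: dexpi_def[abs_def] algebra_simps)
qed

lemma itimes_su_square: "w \<in> su \<Longrightarrow> itimes w ** itimes w = ((w \<bullet> w) / 2) *\<^sub>R one"
  by (simp add: itimes_mult su_square)

lemma expi_unit: "w \<in> su \<Longrightarrow> expi w ** adjugate (expi w) = one"
proof -
  assume w: "w \<in> su"
  let ?n = "(w \<bullet> w) / 2"
  have "adjugate (expi w) = cosh_sqrt ?n *\<^sub>R one - sinhc_sqrt ?n *\<^sub>R itimes w"
    by (simp add: expi_def adjugate_add adjugate_scaleR adjugate_itimes suD(2)[OF w] itimes_minus)
  then have "expi w ** adjugate (expi w) = (cosh_sqrt ?n * cosh_sqrt ?n - sinhc_sqrt ?n * (sinhc_sqrt ?n * ?n)) *\<^sub>R one"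
    by (simp only: expi_def mm.add_left mm.diff_right mm.scaleR_left mm.scaleR_right itimes_su_square[OF w])
      (simp add: algebra_simps)
  also have "cosh_sqrt ?n * cosh_sqrt ?n - sinhc_sqrt ?n * (sinhc_sqrt ?n * ?n) = 1"
    using cosh_sinh_sqrt_identity[of ?n] by (simp add: power2_eq_square algebra_simps)
  finally show ?thesis by simp
qed

text \<open>Along a line through zero, \<open>expi\<close> is a one-parameter group.\<close>

lemma dexpi_radial:
  assumes w: "w \<in> su"
  shows "dexpi (s *\<^sub>R w) w = expi (s *\<^sub>R w) ** itimes w"
proof -
  let ?m = "(w \<bullet> w) / 2"
  let ?n = "s * s * ?m"
  have n: "(s *\<^sub>R w) \<bullet> (s *\<^sub>R w) / 2 = ?n" by simp
  have "dexpi (s *\<^sub>R w) w = (s * ?m * sinhc_sqrt ?n) *\<^sub>R one + (sinhc_sqrt ?n + 2 * ?n * sinhc_sqrt' ?n) *\<^sub>R itimes w"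
    unfolding dexpi_def n by (simp add: itimes_scaleR algebra_simps)
  also have "\<dots> = (s * ?m * sinhc_sqrt ?n) *\<^sub>R one + cosh_sqrt ?n *\<^sub>R itimes w"
    by (simp only: sinhc_sqrt_ode)
  also have "\<dots> = expi (s *\<^sub>R w) ** itimes w"
    unfolding expi_def n
    by (simp add: mm.add_left mm.scaleR_left itimes_scaleR itimes_su_square[OF w] algebra_simps)
  finally show ?thesis .
qed

lemma expi_commute: "expi (s *\<^sub>R w) ** w = w ** expi (s *\<^sub>R w)"
  by (simp add: expi_def mm.add_left mm.add_right mm.scaleR_left mm.scaleR_right itimes_scaleR itimes_mult)

section \<open>The tangent bundle of SU(2) and pullback polarizations\<close>

text \<open>The conjugate transpose is the identity on \<open>itimes su\<close> and minus the identity on \<open>su\<close>.\<close>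

lemma su_complex_independent:
  assumes "a \<in> su" "b \<in> su" "a + itimes b = 0"
  shows "a = 0" "b = 0"
proof -
  have "dagger (a + itimes b) = - a + itimes b"
    by (simp add: dagger_add dagger_itimes suD(1)[OF assms(1)] suD(1)[OF assms(2)] itimes_minus)
  then have "- a + itimes b = 0" using assms(3) by (simp add: dagger_zero)
  then have *: "itimes b = a" by simp
  then have "2 *\<^sub>R a = 0" using assms(3) by (simp add: scaleR_2)
  then show "a = 0" by simp
  then have "itimes (itimes b) = 0" using * by (simp add: itimes_zero)
  then show "b = 0" by simp
qed

text \<open>The tangent bundle is cut out by the equations saying that the two anti-involutions
  \<open>dagger\<close> and \<open>adjugate\<close> invert the first component and reverse the sign of the left translate of the
  second; its tangent space is the kernel of their derivatives.\<close>

definition group_eq :: "(cmat2 \<Rightarrow> cmat2) \<Rightarrow> cmat2 \<times> cmat2 \<Rightarrow> cmat2" where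
  "group_eq L q = L (fst q) ** fst q"

definition algebra_eq :: "(cmat2 \<Rightarrow> cmat2) \<Rightarrow> cmat2 \<times> cmat2 \<Rightarrow> cmat2" where
  "algebra_eq L q = L (dagger (fst q) ** snd q) + dagger (fst q) ** snd q"

lemma smooth_fst: "smooth_on UNIV (fst :: 'a::euclidean_space \<times> 'b::euclidean_space \<Rightarrow> 'a)"
  and smooth_snd: "smooth_on UNIV (snd :: 'a \<times> 'b \<Rightarrow> 'b)"
  using smooth_on_linear[OF bounded_linear_fst open_UNIV smooth_on_id[OF open_UNIV]]
    smooth_on_linear[OF bounded_linear_snd open_UNIV smooth_on_id[OF open_UNIV]] by auto

lemma smooth_left_translate: "smooth_on UNIV (\<lambda>q :: cmat2 \<times> cmat2. dagger (fst q) ** snd q)"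
  by (rule smooth_on_bilinear[OF bounded_bilinear_mat_mult open_UNIV
        smooth_on_linear[OF bounded_linear_dagger open_UNIV smooth_fst] smooth_snd])

lemma left_translate_derivative:
  "((\<lambda>q :: cmat2 \<times> cmat2. dagger (fst q) ** snd q) has_derivative
     (\<lambda>h. dagger (fst q) ** snd h + dagger (fst h) ** snd q)) (at q)"
  by (rule bounded_bilinear.FDERIV[OF bounded_bilinear_mat_mult
        bounded_linear.has_derivative[OF bounded_linear_dagger has_derivative_fst[OF has_derivative_ident]]
        has_derivative_snd[OF has_derivative_ident]])

lemma smooth_defining_equations:
  assumes L: "bounded_linear L"
  shows "smooth_on UNIV (group_eq L)" "smooth_on UNIV (algebra_eq L)"
  unfolding group_eq_def[abs_def] algebra_eq_def[abs_def]
  by (rule smooth_on_bilinear[OF bounded_bilinear_mat_mult open_UNIV smooth_on_linear[OF L open_UNIV smooth_fst] smooth_fst])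
    (rule smooth_on_add[OF open_UNIV smooth_on_linear[OF L open_UNIV smooth_left_translate] smooth_left_translate])

lemma FD_defining_equations:
  assumes L: "bounded_linear L"
  shows "FD (group_eq L) (p, v) (a, b) = L p ** a + L a ** p"
    "FD (algebra_eq L) (p, v) (a, b) = L (dagger p ** b + dagger a ** v) + (dagger p ** b + dagger a ** v)"
proof -
  have "(group_eq L has_derivative (\<lambda>h. L (fst (p, v)) ** fst h + L (fst h) ** fst (p, v))) (at (p, v))"
    unfolding group_eq_def[abs_def]
    by (rule bounded_bilinear.FDERIV[OF bounded_bilinear_mat_mult
          bounded_linear.has_derivative[OF L has_derivative_fst[OF has_derivative_ident]]
          has_derivative_fst[OF has_derivative_ident]])
  from FD_eq[OF this] show "FD (group_eq L) (p, v) (a, b) = L p ** a + L a ** p" by simp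
  have "(algebra_eq L has_derivative (\<lambda>h. L (dagger (fst (p, v)) ** snd h + dagger (fst h) ** snd (p, v))
      + (dagger (fst (p, v)) ** snd h + dagger (fst h) ** snd (p, v)))) (at (p, v))"
    unfolding algebra_eq_def[abs_def]
    by (rule has_derivative_add[OF bounded_linear.has_derivative[OF L left_translate_derivative] left_translate_derivative])
  from FD_eq[OF this]
  show "FD (algebra_eq L) (p, v) (a, b) = L (dagger p ** b + dagger a ** v) + (dagger p ** b + dagger a ** v)"
    by simp
qed

lemma tangent_space_TSU2_kernel:
  assumes q: "q \<in> tangent_bundle SU2"
  shows "h \<in> tangent_space (tangent_bundle SU2) q \<longleftrightarrow>
    (\<forall>L\<in>{dagger, adjugate}. FD (group_eq L) q h = 0 \<and> FD (algebra_eq L) q h = 0)"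
proof -
  obtain p v a b where qh: "q = (p, v)" "h = (a, b)" by (metis surj_pair)
  have p: "p \<in> SU2" using q qh by (simp add: tangent_bundle_SU2_iff)
  let ?x = "dagger p ** a" and ?z = "dagger p ** b + dagger a ** v"
  have x: "dagger ?x = dagger a ** p" "adjugate ?x = adjugate a ** p"
    using SU2D(3)[OF SU2_dagger[OF p]] by (simp_all add: dagger_mult adjugate_mult)
  have 1: "?x \<in> su \<longleftrightarrow> (\<forall>L\<in>{dagger, adjugate}. FD (group_eq L) q h = 0)"
    unfolding su_def qh
    by (simp add: FD_defining_equations(1) bounded_linear_dagger bounded_linear_adjugate x SU2D(3)[OF p]
        eq_neg_iff_add_eq_0 add.commute)
  have 2: "?z \<in> su \<longleftrightarrow> (\<forall>L\<in>{dagger, adjugate}. FD (algebra_eq L) q h = 0)"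
    unfolding su_def qh
    by (simp add: FD_defining_equations(2) bounded_linear_dagger bounded_linear_adjugate eq_neg_iff_add_eq_0)
  have 3: "dagger p ** b - ?x ** (dagger p ** v) = ?z" if "?x \<in> su"
  proof -
    have "dagger a ** v = dagger ?x ** (dagger p ** v)"
      unfolding x using p by (simp add: matrix_mul_assoc[symmetric] SU2_cancel)
    then show ?thesis by (simp add: suD(1)[OF that] mm.minus_left)
  qed
  have "h \<in> tangent_space (tangent_bundle SU2) q \<longleftrightarrow> ?x \<in> su \<and> ?z \<in> su"
    unfolding qh(1,2) tangent_space_TSU2_iff[OF q[unfolded qh(1)]] by (metis (no_types) 3)
  then show ?thesis using 1 2 by auto
qed

text \<open>Fields annihilated by the differential of a map are closed under brackets. Applied to the equations of the
  tangent bundle, this shows that the bracket of tangent fields is tangent.\<close>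

lemma lie_bracket_kernel:
  fixes f :: "'a::euclidean_space \<Rightarrow> 'b::euclidean_space"
  assumes f: "smooth_on UNIV f" and A: "smooth_map (W \<inter> X) A" and B: "smooth_map (W \<inter> X) B"
    and W: "open W" "q \<in> W \<inter> X"
    and tan: "A q \<in> tangent_space X q" "B q \<in> tangent_space X q"
    and kA: "\<And>q. q \<in> W \<inter> X \<Longrightarrow> FD f q (A q) = 0" and kB: "\<And>q. q \<in> W \<inter> X \<Longrightarrow> FD f q (B q) = 0"
  shows "FD f q (lie_bracket (W \<inter> X) A B q) = 0"
proof -
  have z: "frechet_derivative (\<lambda>_. 0 :: 'b) (at q within (W \<inter> X)) v = 0" if "v \<in> tangent_space X q" for v
  proof -
    have "((\<lambda>_. 0 :: 'b) has_derivative (\<lambda>_. 0)) (at q within (W \<inter> X))" by simp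
    moreover from this
    have "((\<lambda>_. 0 :: 'b) has_derivative frechet_derivative (\<lambda>_. 0 :: 'b) (at q within (W \<inter> X))) (at q within (W \<inter> X))"
      using frechet_derivative_works unfolding differentiable_def by blast
    ultimately show ?thesis using tangent_derivative_unique[OF _ _ W(1) _ that] W(2) by blast
  qed
  show ?thesis
    using pushforward_lie_bracket[OF open_UNIV UNIV_I f A B tan W(1), of "\<lambda>_. 0" "\<lambda>_. 0"] W(2) kA kB z tan
    by auto
qed

lemma lie_bracket_tangent_TSU2:
  assumes A: "smooth_map (W \<inter> tangent_bundle SU2) A" and B: "smooth_map (W \<inter> tangent_bundle SU2) B"
    and W: "open W" "q \<in> W \<inter> tangent_bundle SU2"
    and tA: "\<And>q. q \<in> W \<inter> tangent_bundle SU2 \<Longrightarrow> A q \<in> tangent_space (tangent_bundle SU2) q"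
    and tB: "\<And>q. q \<in> W \<inter> tangent_bundle SU2 \<Longrightarrow> B q \<in> tangent_space (tangent_bundle SU2) q"
  shows "lie_bracket (W \<inter> tangent_bundle SU2) A B q \<in> tangent_space (tangent_bundle SU2) q"
proof -
  have "FD f q (lie_bracket (W \<inter> tangent_bundle SU2) A B q) = 0"
    if f: "smooth_on UNIV f" and k: "\<And>q h. q \<in> tangent_bundle SU2 \<Longrightarrow>
      h \<in> tangent_space (tangent_bundle SU2) q \<Longrightarrow> FD f q h = 0" for f :: "cmat2 \<times> cmat2 \<Rightarrow> cmat2"
    using W(2) tA tB k by (intro lie_bracket_kernel[OF f A B W]) auto
  then show ?thesis
    using W(2) tangent_space_TSU2_kernel smooth_defining_equations[OF bounded_linear_dagger]
      smooth_defining_equations[OF bounded_linear_adjugate] by simp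
qed

lemma smooth_map_FD_apply:
  assumes f: "smooth_on UNIV f" and G: "smooth_map S G"
  shows "smooth_map S (\<lambda>q. FD f q (G q))"
  unfolding smooth_map_def
proof
  fix p assume p: "p \<in> S"
  obtain U F where U: "open U" "p \<in> U" "smooth_on U F" "\<And>q. q \<in> U \<inter> S \<Longrightarrow> F q = G q"
    using smooth_mapE[OF G p] by blast
  have "smooth_on U (\<lambda>q. FD f q (F q))"
    using smooth_on_FD_apply[OF U(1) smooth_on_subset[OF f] U(3)] by simp
  then show "\<exists>U F. open U \<and> p \<in> U \<and> smooth_on U F \<and> (\<forall>q\<in>U \<inter> S. F q = FD f q (G q))"
    using U by (intro exI[of _ U] exI[of _ "\<lambda>q. FD f q (F q)"]) auto
qed

text \<open>A complex vector has image of type (1,0) if and only if the pullbacks of the differentials of the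
  antiholomorphic coordinates vanish on it. These forms are closed, so their common kernel is closed under
  brackets.\<close>

lemma pullback_polarization_bracket:
  fixes \<Phi> :: "'a::euclidean_space \<Rightarrow> cmat2"
  assumes \<Phi>: "smooth_on UNIV \<Phi>" and V: "smooth_map (U \<inter> X) V" and W: "smooth_map (U \<inter> X) W"
    and U: "open U" "q \<in> U \<inter> X"
    and tan: "fst (V q) \<in> tangent_space X q" "snd (V q) \<in> tangent_space X q"
      "fst (W q) \<in> tangent_space X q" "snd (W q) \<in> tangent_space X q"
    and PV: "\<And>q. q \<in> U \<inter> X \<Longrightarrow> FD \<Phi> q (fst (V q)) = itimes (FD \<Phi> q (snd (V q)))"
    and PW: "\<And>q. q \<in> U \<inter> X \<Longrightarrow> FD \<Phi> q (fst (W q)) = itimes (FD \<Phi> q (snd (W q)))"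
  shows "FD \<Phi> q (fst (complex_lie_bracket (U \<inter> X) V W q)) = itimes (FD \<Phi> q (snd (complex_lie_bracket (U \<inter> X) V W q)))"
proof -
  let ?S = "U \<inter> X"
  have s: "smooth_map ?S (fst \<circ> V)" "smooth_map ?S (snd \<circ> V)" "smooth_map ?S (fst \<circ> W)" "smooth_map ?S (snd \<circ> W)"
    using smooth_map_linear[OF bounded_linear_fst V] smooth_map_linear[OF bounded_linear_snd V]
      smooth_map_linear[OF bounded_linear_fst W] smooth_map_linear[OF bounded_linear_snd W]
    by (simp_all add: o_def)
  define m n where "m = (\<lambda>q. FD \<Phi> q ((snd \<circ> V) q))" and "n = (\<lambda>q. FD \<Phi> q ((snd \<circ> W) q))"
  have sm: "smooth_map ?S m" "smooth_map ?S n"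
    unfolding m_def n_def by (rule smooth_map_FD_apply[OF \<Phi> s(2)], rule smooth_map_FD_apply[OF \<Phi> s(4)])
  define D where "D = (\<lambda>k v. frechet_derivative (k :: 'a \<Rightarrow> cmat2) (at q within ?S) v)"
  have Di: "D (\<lambda>q. itimes (k q)) v = itimes (D k v)" if "smooth_map ?S k" "v \<in> tangent_space X q" for k v
  proof -
    have "((\<lambda>q. itimes (k q)) has_derivative (\<lambda>v. itimes (D k v))) (at q within ?S)"
      unfolding D_def
      by (rule bounded_linear.has_derivative[OF bounded_linear_itimes smooth_map_has_derivative[OF that(1) U(2)]])
    moreover from this have "((\<lambda>q. itimes (k q)) has_derivative D (\<lambda>q. itimes (k q))) (at q within ?S)"
      unfolding D_def using frechet_derivative_works unfolding differentiable_def by blast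
    ultimately show ?thesis using tangent_derivative_unique[OF _ _ U(1) _ that(2)] U(2) by blast
  qed
  have push: "FD \<Phi> q (lie_bracket ?S A B q) = D b (A q) - D a (B q)"
    if "smooth_map ?S A" "smooth_map ?S B" "A q \<in> tangent_space X q" "B q \<in> tangent_space X q"
      "\<And>q. q \<in> ?S \<Longrightarrow> a q = FD \<Phi> q (A q)" "\<And>q. q \<in> ?S \<Longrightarrow> b q = FD \<Phi> q (B q)" for A B a b
    unfolding D_def
    using pushforward_lie_bracket[OF open_UNIV UNIV_I \<Phi> that(1-4) U(1), of a b] U(2) that(5,6) by auto
  let ?V1 = "fst \<circ> V" and ?V2 = "snd \<circ> V" and ?W1 = "fst \<circ> W" and ?W2 = "snd \<circ> W"
  have 1: "FD \<Phi> q (lie_bracket ?S ?V1 ?W1 q) = itimes (D n (fst (V q))) - itimes (D m (fst (W q)))"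
    using push[OF s(1,3), of "\<lambda>q. itimes (m q)" "\<lambda>q. itimes (n q)"] tan PV PW Di sm by (simp add: m_def n_def)
  have 2: "FD \<Phi> q (lie_bracket ?S ?V2 ?W2 q) = D n (snd (V q)) - D m (snd (W q))"
    using push[OF s(2,4), of m n] tan by (simp add: m_def n_def)
  have 3: "FD \<Phi> q (lie_bracket ?S ?V1 ?W2 q) = D n (fst (V q)) - itimes (D m (snd (W q)))"
    using push[OF s(1,4), of "\<lambda>q. itimes (m q)" n] tan PV Di sm by (simp add: m_def n_def)
  have 4: "FD \<Phi> q (lie_bracket ?S ?V2 ?W1 q) = itimes (D n (snd (V q))) - D m (fst (W q))"
    using push[OF s(2,3), of m "\<lambda>q. itimes (n q)"] tan PW Di sm by (simp add: m_def n_def)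
  have lin: "linear (FD \<Phi> q)" using smooth_on_has_derivative[OF \<Phi> UNIV_I] has_derivative_linear by blast
  show ?thesis
    unfolding complex_lie_bracket_def Let_def fst_conv snd_conv linear_diff[OF lin] linear_add[OF lin] 1 2 3 4
    by (simp add: itimes_add itimes_diff algebra_simps)
qed

text \<open>The vector of the tangent bundle at \<open>(p, p ** u)\<close> with left trivialization \<open>(\<xi>, \<eta>)\<close>.\<close>

definition tang :: "cmat2 \<Rightarrow> cmat2 \<Rightarrow> cmat2 \<Rightarrow> cmat2 \<Rightarrow> cmat2 \<times> cmat2" where
  "tang p u \<xi> \<eta> = (p ** \<xi>, p ** (\<xi> ** u + \<eta>))"

lemma tang_add: "tang p u \<xi> \<eta> + tang p u \<xi>' \<eta>' = tang p u (\<xi> + \<xi>') (\<eta> + \<eta>')"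
  by (simp add: tang_def mm_simps algebra_simps)

lemma tang_scale: "r *\<^sub>R tang p u \<xi> \<eta> = tang p u (r *\<^sub>R \<xi>) (r *\<^sub>R \<eta>)"
  by (simp add: tang_def mm_simps scaleR_add_right)

lemma tang_diff: "tang p u \<xi> \<eta> - tang p u \<xi>' \<eta>' = tang p u (\<xi> - \<xi>') (\<eta> - \<eta>')"
  by (simp add: tang_def mm_simps algebra_simps)

lemma tang_eq_0:
  assumes "p \<in> SU2" "tang p u \<xi> \<eta> = 0"
  shows "\<xi> = 0" "\<eta> = 0"
proof -
  have "dagger p ** (p ** \<xi>) = 0" using assms(2) by (simp add: tang_def zero_prod_def mm.zero_right)
  then show xi: "\<xi> = 0" using assms(1) by (simp add: SU2_cancel)
  have "dagger p ** (p ** (\<xi> ** u + \<eta>)) = 0" using assms(2) by (simp add: tang_def zero_prod_def mm.zero_right)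
  then show "\<eta> = 0" using assms(1) xi by (simp add: SU2_cancel mm.zero_left)
qed

lemma tangent_space_TSU2_tang:
  assumes q: "(p, v) \<in> tangent_bundle SU2"
  shows "tangent_space (tangent_bundle SU2) (p, v) = (\<lambda>(\<xi>, \<eta>). tang p (dagger p ** v) \<xi> \<eta>) ` (su \<times> su)"
proof -
  have p: "p \<in> SU2" using q by (simp add: tangent_bundle_SU2_iff)
  have "h \<in> tangent_space (tangent_bundle SU2) (p, v) \<longleftrightarrow> (\<exists>\<xi>\<in>su. \<exists>\<eta>\<in>su. h = tang p (dagger p ** v) \<xi> \<eta>)" for h
  proof -
    obtain a b where h: "h = (a, b)" by (metis surj_pair)
    have "h = tang p (dagger p ** v) (dagger p ** a) (dagger p ** b - dagger p ** a ** (dagger p ** v))"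
      using p by (simp add: h tang_def mm_simps SU2_cancel)
    moreover have "\<xi> = dagger p ** a \<and> \<eta> = dagger p ** b - dagger p ** a ** (dagger p ** v)"
      if "h = tang p (dagger p ** v) \<xi> \<eta>" for \<xi> \<eta>
      using that p by (simp add: h tang_def mm_simps SU2_cancel)
    ultimately show ?thesis unfolding h tangent_space_TSU2_iff[OF q] by metis
  qed
  then show ?thesis by (auto simp: image_iff)
qed

lemma dim_su: "dim su = 3"
proof -
  obtain e1 e2 e3 where "quat_basis e1 e2 e3" using quat_basis_exists by blast
  then interpret quat_basis e1 e2 e3 .
  have ne: "e1 \<noteq> e2" "e1 \<noteq> e3" "e2 \<noteq> e3" "e1 \<noteq> 0" "e2 \<noteq> 0" "e3 \<noteq> 0" using e_inner by auto
  have "pairwise orthogonal {e1, e2, e3}" by (auto simp: pairwise_def orthogonal_def e_inner)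
  then have "independent {e1, e2, e3}" using ne by (intro pairwise_orthogonal_independent) auto
  then have "card {e1, e2, e3} \<le> dim su" using e_su by (intro independent_card_le_dim) auto
  then show ?thesis using ne dim_su_le by (simp add: card_insert_if)
qed

lemma dim_tangent_space_TSU2:
  assumes q: "q \<in> tangent_bundle SU2"
  shows "dim (tangent_space (tangent_bundle SU2) q) = 2 * 3"
proof -
  obtain p v where q': "q = (p, v)" by (metis surj_pair)
  let ?f = "\<lambda>(\<xi>, \<eta>). tang p (dagger p ** v) \<xi> \<eta>"
  have p: "p \<in> SU2" using q q' by (simp add: tangent_bundle_SU2_iff)
  have lin: "linear ?f" by (auto intro!: linearI simp: tang_add tang_scale)
  have "x = 0" if "?f x = 0" for x
    using tang_eq_0[OF p] that by (cases x) (auto simp: zero_prod_def)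
  then have "inj ?f" using linear_injective_0[OF lin] by blast
  then have "dim (?f ` (su \<times> su)) = dim (su \<times> su)"
    by (intro dim_image_eq lin) (auto intro: inj_on_subset)
  also have "\<dots> = 6" by (simp add: dim_Times subspace_su dim_su)
  finally show ?thesis using tangent_space_TSU2_tang q q' by simp
qed

section \<open>Special metrics: the continued geodesics\<close>

locale special_metric = diagonal_metric e1 e2 e3 l1 l1 l3 g for e1 e2 e3 l1 l3 g
begin

definition \<beta> :: "cmat2 \<Rightarrow> real" where
  "\<beta> x = (l3 - l1) / l1 * ((x \<bullet> e3) / 2)"

lemma linear_\<beta>: "linear \<beta>"
  unfolding \<beta>_def by (auto intro!: linearI simp: inner_add_left distrib_left add_divide_distrib)

lemma bounded_linear_\<beta>: "bounded_linear \<beta>"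
  using linear_\<beta> linear_conv_bounded_linear by blast

lemma \<beta>_scale: "\<beta> (s *\<^sub>R x) = s * \<beta> x"
  using linear_cmul[OF linear_\<beta>, of s x] by simp

text \<open>The component of the velocity along the third axis is constant because the other two eigenvalues agree. Hence
  the velocity rotates about this axis with a constant speed, which is proportional to \<open>\<beta>\<close>.\<close>

lemma euler_special:
  assumes x: "x \<in> su"
  shows "- B x x = \<beta> x *\<^sub>R bracket e3 x"
proof -
  define x1 x2 x3 where "x1 = (x \<bullet> e1) / 2" and "x2 = (x \<bullet> e2) / 2" and "x3 = (x \<bullet> e3) / 2"
  have ex: "x = x1 *\<^sub>R e1 + x2 *\<^sub>R e2 + x3 *\<^sub>R e3" using expansion[OF x] by (simp add: x1_def x2_def x3_def)
  have "bracket e3 (x1 *\<^sub>R e1 + x2 *\<^sub>R e2 + x3 *\<^sub>R e3) = (x1 + x1) *\<^sub>R e2 - (x2 + x2) *\<^sub>R e1"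
    unfolding bracket_def
    by (simp only: mm.add_left mm.add_right mm.scaleR_left mm.scaleR_right e_mult scaleR_left_distrib) simp
  then have "bracket e3 x = (x1 + x1) *\<^sub>R e2 - (x2 + x2) *\<^sub>R e1" using ex by simp
  moreover have "- B x x = (2 * (l1 - l3) / l1 * (x2 * x3)) *\<^sub>R e1 + (2 * (l3 - l1) / l1 * (x3 * x1)) *\<^sub>R e2"
    using euler_field[of x1 x2 x3] ex by simp
  moreover have "2 * (l1 - l3) / l1 * (x2 * x3) = - (\<beta> x * (x2 + x2))" "2 * (l3 - l1) / l1 * (x3 * x1) = \<beta> x * (x1 + x1)"
    using l_nonzero by (simp_all add: \<beta>_def x3_def[symmetric] field_simps)
  ultimately show ?thesis by (simp add: scaleR_diff_right)
qed

text \<open>The value at the imaginary unit of the analytic continuation of the geodesic from the identity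
  with initial velocity \<open>u\<close>.\<close>

definition Psi :: "cmat2 \<Rightarrow> cmat2" where
  "Psi u = expi (u + \<beta> u *\<^sub>R e3) ** expi ((- \<beta> u) *\<^sub>R e3)"

definition dPsi :: "cmat2 \<Rightarrow> cmat2 \<Rightarrow> cmat2" where
  "dPsi u v = expi (u + \<beta> u *\<^sub>R e3) ** dexpi ((- \<beta> u) *\<^sub>R e3) ((- \<beta> v) *\<^sub>R e3)
     + dexpi (u + \<beta> u *\<^sub>R e3) (v + \<beta> v *\<^sub>R e3) ** expi ((- \<beta> u) *\<^sub>R e3)"

lemma bounded_linear_shift: "bounded_linear (\<lambda>u. u + \<beta> u *\<^sub>R e3)" "bounded_linear (\<lambda>u. (- \<beta> u) *\<^sub>R e3)"
  by (intro bounded_linear_add bounded_linear_ident bounded_linear_minus bounded_linear_\<beta>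
      bounded_linear_scaleR_const)+

lemma smooth_Psi: "smooth_on UNIV Psi"
proof -
  have comp: "smooth_on UNIV (\<lambda>u. expi (L u))" if "bounded_linear L" for L :: "cmat2 \<Rightarrow> cmat2"
    by (rule smooth_on_compose[OF open_UNIV open_UNIV subset_UNIV
          smooth_on_linear[OF that open_UNIV smooth_on_id[OF open_UNIV]] smooth_expi])
  show ?thesis unfolding Psi_def[abs_def]
    by (rule smooth_on_bilinear[OF bounded_bilinear_mat_mult open_UNIV
          comp[OF bounded_linear_shift(1)] comp[OF bounded_linear_shift(2)]])
qed

lemma Psi_has_derivative: "(Psi has_derivative dPsi u) (at u)"
proof -
  have "((\<lambda>u. expi (L u)) has_derivative (\<lambda>v. dexpi (L u) (L v))) (at u)"
    if "bounded_linear L" for L :: "cmat2 \<Rightarrow> cmat2"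
    by (rule has_derivative_compose[OF bounded_linear_imp_has_derivative[OF that] expi_has_derivative])
  from bounded_bilinear.FDERIV[OF bounded_bilinear_mat_mult this[OF bounded_linear_shift(1)]
      this[OF bounded_linear_shift(2)]]
  show ?thesis unfolding Psi_def[abs_def] dPsi_def[abs_def] .
qed

lemma linear_dPsi: "linear (dPsi u)"
  using has_derivative_linear[OF Psi_has_derivative] .

lemma Psi_unit:
  assumes "u \<in> su"
  shows "Psi u ** adjugate (Psi u) = one" "adjugate (Psi u) ** Psi u = one"
proof -
  let ?a = "expi (u + \<beta> u *\<^sub>R e3)" and ?b = "expi ((- \<beta> u) *\<^sub>R e3)"
  have "?a ** adjugate ?a = one" "?b ** adjugate ?b = one"
    by (intro expi_unit su_add su_scale assms e_su)+
  then show 1: "Psi u ** adjugate (Psi u) = one"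
    unfolding Psi_def adjugate_mult by (metis matrix_mul_assoc matrix_mul_rid)
  then show "adjugate (Psi u) ** Psi u = one" by (simp only: mult_adjugate)
qed

text \<open>Rotation about the distinguished axis is an automorphism of the metric, so \<open>Psi\<close> is equivariant
  under conjugation; this is the infinitesimal form.\<close>

lemma dPsi_rotation:
  assumes u: "u \<in> su"
  shows "dPsi u (bracket e3 u) = bracket e3 (Psi u)"
proof -
  let ?w = "u + \<beta> u *\<^sub>R e3" and ?E2 = "expi ((- \<beta> u) *\<^sub>R e3)"
  let ?S = "sinhc_sqrt ((?w \<bullet> ?w) / 2)" and ?C = "cosh_sqrt ((?w \<bullet> ?w) / 2)"
  have orth: "bracket e3 u \<bullet> e3 = 0" "u \<bullet> bracket e3 u = 0" "e3 \<bullet> bracket e3 u = 0"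
    using bracket_invariant[OF e_su(3) u e_su(3)] bracket_invariant[OF e_su(3) e_su(3) u]
      bracket_invariant[OF e_su(3) u u] bracket_swap[of u e3]
    by (simp_all add: inner_commute)
  have \<beta>0: "\<beta> (bracket e3 u) = 0" by (simp add: \<beta>_def orth)
  have "?w \<bullet> bracket e3 u = 0" by (simp add: inner_add_left orth)
  then have d1: "dexpi ?w (bracket e3 u) = ?S *\<^sub>R itimes (bracket e3 u)" by (simp add: dexpi_def)
  have d2: "dexpi z 0 = 0" for z by (simp add: dexpi_def itimes_zero)
  have "dPsi u (bracket e3 u) = (?S *\<^sub>R itimes (bracket e3 u)) ** ?E2"
    unfolding dPsi_def \<beta>0 by (simp add: d1 d2 mm.zero_right)
  also have "?S *\<^sub>R itimes (bracket e3 u) = bracket e3 (expi ?w)"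
    unfolding expi_def bracket_def
    by (simp add: mm.add_left mm.add_right mm.scaleR_left mm.scaleR_right itimes_mult itimes_add itimes_diff
        itimes_scaleR algebra_simps)
  also have "bracket e3 (expi ?w) ** ?E2 = bracket e3 (Psi u)"
    unfolding bracket_def Psi_def
    by (simp only: mm.diff_left matrix_mul_assoc[symmetric] expi_commute[where s = "- \<beta> u" and w = e3])
  finally show ?thesis .
qed

lemma dPsi_radial:
  assumes x: "x \<in> su"
  shows "dPsi (s *\<^sub>R x) x = expi (s *\<^sub>R (x + \<beta> x *\<^sub>R e3)) ** itimes x ** expi (s *\<^sub>R ((- \<beta> x) *\<^sub>R e3))"
proof -
  let ?w = "x + \<beta> x *\<^sub>R e3" and ?b = "(- \<beta> x) *\<^sub>R e3"
  have w: "s *\<^sub>R x + \<beta> (s *\<^sub>R x) *\<^sub>R e3 = s *\<^sub>R ?w" "(- \<beta> (s *\<^sub>R x)) *\<^sub>R e3 = s *\<^sub>R ?b"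
    by (simp_all add: \<beta>_scale scaleR_add_right)
  have su: "?w \<in> su" "?b \<in> su" by (intro su_add su_scale x e_su)+
  have "dPsi (s *\<^sub>R x) x = expi (s *\<^sub>R ?w) ** (expi (s *\<^sub>R ?b) ** itimes ?b) + expi (s *\<^sub>R ?w) ** itimes ?w ** expi (s *\<^sub>R ?b)"
    unfolding dPsi_def w dexpi_radial[OF su(1)] dexpi_radial[OF su(2)] ..
  also have "expi (s *\<^sub>R ?b) ** itimes ?b = itimes ?b ** expi (s *\<^sub>R ?b)"
    by (simp only: itimes_mult expi_commute)
  also have "expi (s *\<^sub>R ?w) ** (itimes ?b ** expi (s *\<^sub>R ?b)) + expi (s *\<^sub>R ?w) ** itimes ?w ** expi (s *\<^sub>R ?b)
      = expi (s *\<^sub>R ?w) ** itimes (?b + ?w) ** expi (s *\<^sub>R ?b)"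
    by (simp only: itimes_add mm.add_left mm.add_right matrix_mul_assoc)
  finally show ?thesis by simp
qed

text \<open>The Cauchy-Riemann equation of \<open>Psi\<close> along a geodesic: the complex derivative of the
  continued geodesic, once in the imaginary and once in the real direction.\<close>

lemma Psi_cauchy_riemann:
  assumes x: "x \<in> su"
  shows "dPsi (s *\<^sub>R x) x = itimes (x ** Psi (s *\<^sub>R x) + s *\<^sub>R dPsi (s *\<^sub>R x) (\<beta> x *\<^sub>R bracket e3 x))"
proof -
  let ?w = "x + \<beta> x *\<^sub>R e3" and ?b = "(- \<beta> x) *\<^sub>R e3"
  let ?E1 = "expi (s *\<^sub>R ?w)" and ?E2 = "expi (s *\<^sub>R ?b)"
  have w: "s *\<^sub>R x + \<beta> (s *\<^sub>R x) *\<^sub>R e3 = s *\<^sub>R ?w" "(- \<beta> (s *\<^sub>R x)) *\<^sub>R e3 = s *\<^sub>R ?b"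
    by (simp_all add: \<beta>_scale scaleR_add_right)
  have Psi: "Psi (s *\<^sub>R x) = ?E1 ** ?E2" unfolding Psi_def w ..
  have "s *\<^sub>R dPsi (s *\<^sub>R x) (\<beta> x *\<^sub>R bracket e3 x) = \<beta> x *\<^sub>R dPsi (s *\<^sub>R x) (bracket e3 (s *\<^sub>R x))"
    by (simp add: linear_cmul[OF linear_dPsi] br.scaleR_right)
  also have "\<dots> = \<beta> x *\<^sub>R bracket e3 (Psi (s *\<^sub>R x))"
    by (simp only: dPsi_rotation[OF su_scale[OF x]])
  finally have "x ** Psi (s *\<^sub>R x) + s *\<^sub>R dPsi (s *\<^sub>R x) (\<beta> x *\<^sub>R bracket e3 x)
      = ?w ** ?E1 ** ?E2 + ?E1 ** (?E2 ** ?b)"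
    unfolding Psi bracket_def
    by (simp add: mm.add_left mm.scaleR_left mm.scaleR_right mm.minus_left mm.minus_right scaleR_diff_right matrix_mul_assoc)
  also have "\<dots> = ?E1 ** (?w + ?b) ** ?E2"
  proof -
    have c: "?w ** ?E1 = ?E1 ** ?w" "?E2 ** ?b = ?b ** ?E2" by (rule expi_commute[symmetric], rule expi_commute)
    show ?thesis unfolding c by (simp only: mm.add_left mm.add_right matrix_mul_assoc)
  qed
  finally show ?thesis using dPsi_radial[OF x] by (simp add: itimes_mult)
qed

definition Phi :: "cmat2 \<times> cmat2 \<Rightarrow> cmat2" where
  "Phi q = fst q ** Psi (dagger (fst q) ** snd q)"

lemma smooth_Phi: "smooth_on UNIV Phi"
  unfolding Phi_def[abs_def]
  by (rule smooth_on_bilinear[OF bounded_bilinear_mat_mult open_UNIV smooth_fst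
        smooth_on_compose[OF open_UNIV open_UNIV subset_UNIV smooth_left_translate smooth_Psi]])

text \<open>Since \<open>Phi\<close> commutes with left translations, its differential in the directions of the group is,
  in the left trivialization, right multiplication by \<open>Psi u\<close>, which is invertible.\<close>

lemma FD_Phi:
  assumes p: "p \<in> SU2" and \<xi>: "\<xi> \<in> su"
  shows "FD Phi (p, p ** u) (tang p u \<xi> \<eta>) = p ** (\<xi> ** Psi u + dPsi u \<eta>)"
proof -
  have "(Phi has_derivative (\<lambda>h. fst (p, p ** u) ** dPsi (dagger (fst (p, p ** u)) ** snd (p, p ** u))
      (dagger (fst (p, p ** u)) ** snd h + dagger (fst h) ** snd (p, p ** u))
      + fst h ** Psi (dagger (fst (p, p ** u)) ** snd (p, p ** u)))) (at (p, p ** u))"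
    unfolding Phi_def[abs_def]
    by (rule bounded_bilinear.FDERIV[OF bounded_bilinear_mat_mult has_derivative_fst[OF has_derivative_ident]
          has_derivative_compose[OF left_translate_derivative Psi_has_derivative]])
  from FD_eq[OF this] show ?thesis
    using p by (simp add: tang_def SU2_cancel dagger_mult suD(1)[OF \<xi>] mm_simps)
qed

text \<open>The complex tangent vectors whose image under the differential of \<open>Phi\<close> is of type (1,0): with
  \<open>w = (w1, w2)\<close> standing for \<open>w1 + i w2\<close>, the image of \<open>w1\<close> is the complex structure applied to the image
  of \<open>w2\<close>.\<close>

definition polar :: "cmat2 \<times> cmat2 \<Rightarrow> ((cmat2 \<times> cmat2) \<times> (cmat2 \<times> cmat2)) set" where
  "polar q = {w \<in> complex_tangent_space (tangent_bundle SU2) q. FD Phi q (fst w) = itimes (FD Phi q (snd w))}"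

text \<open>The logarithmic derivative of \<open>Psi\<close> takes values in the complexified Lie algebra; these are its real
  and imaginary parts.\<close>

definition Theta :: "cmat2 \<Rightarrow> cmat2 \<Rightarrow> cmat2" where
  "Theta u \<eta> = dPsi u \<eta> ** adjugate (Psi u)"

definition Theta_re :: "cmat2 \<Rightarrow> cmat2 \<Rightarrow> cmat2" where
  "Theta_re u \<eta> = (1/2) *\<^sub>R (Theta u \<eta> - dagger (Theta u \<eta>))"

definition Theta_im :: "cmat2 \<Rightarrow> cmat2 \<Rightarrow> cmat2" where
  "Theta_im u \<eta> = (- 1/2) *\<^sub>R itimes (Theta u \<eta> + dagger (Theta u \<eta>))"

lemma linear_Theta: "linear (Theta u)" "linear (Theta_re u)" "linear (Theta_im u)"
  unfolding Theta_re_def Theta_im_def Theta_def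
  by (auto intro!: linearI simp: linear_add[OF linear_dPsi] linear_cmul[OF linear_dPsi] mm.add_left
      mm.scaleR_left dagger_add dagger_scaleR itimes_add itimes_scaleR algebra_simps)

text \<open>\<open>Psi\<close> takes values in matrices of determinant one; differentiate \<open>Psi ** adjugate Psi = one\<close>.\<close>

lemma adjugate_Theta:
  assumes u: "u \<in> su" and \<eta>: "\<eta> \<in> su"
  shows "adjugate (Theta u \<eta>) = - Theta u \<eta>"
proof -
  let ?c = "\<lambda>t. u + t *\<^sub>R \<eta>"
  have "((\<lambda>t. Psi (?c t)) has_vector_derivative dPsi u \<eta>) (at 0)"
  proof -
    have "(?c has_derivative (\<lambda>h. h *\<^sub>R \<eta>)) (at 0)" by (auto intro!: derivative_eq_intros)
    from has_derivative_compose[OF this, of Psi "dPsi u"] Psi_has_derivative[of u] show ?thesis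
      by (simp add: has_vector_derivative_def linear_cmul[OF linear_dPsi])
  qed
  from bounded_bilinear.has_vector_derivative[OF bounded_bilinear_mat_mult this
      bounded_linear.has_vector_derivative[OF bounded_linear_adjugate this]]
  have "((\<lambda>t. Psi (?c t) ** adjugate (Psi (?c t))) has_vector_derivative
      Psi u ** adjugate (dPsi u \<eta>) + dPsi u \<eta> ** adjugate (Psi u)) (at 0)" by simp
  moreover have "(\<lambda>t. Psi (?c t) ** adjugate (Psi (?c t))) = (\<lambda>t. one)"
    using Psi_unit(1) su_add[OF u su_scale[OF \<eta>]] by auto
  ultimately have "((\<lambda>t::real. one) has_vector_derivative
      Psi u ** adjugate (dPsi u \<eta>) + dPsi u \<eta> ** adjugate (Psi u)) (at 0)" by simp
  from vector_derivative_unique_at[OF this has_vector_derivative_const]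
  have "Psi u ** adjugate (dPsi u \<eta>) + dPsi u \<eta> ** adjugate (Psi u) = 0" .
  then show ?thesis by (simp add: Theta_def adjugate_mult eq_neg_iff_add_eq_0)
qed

lemma Theta_parts:
  assumes u: "u \<in> su" and \<eta>: "\<eta> \<in> su"
  shows "Theta_re u \<eta> \<in> su" "Theta_im u \<eta> \<in> su" "Theta u \<eta> = Theta_re u \<eta> + itimes (Theta_im u \<eta>)"
proof -
  let ?Y = "Theta u \<eta>"
  note a = adjugate_Theta[OF assms]
  have da: "adjugate (dagger ?Y) = - dagger ?Y" by (simp add: dagger_adjugate[symmetric] a dagger_minus)
  show "Theta_re u \<eta> \<in> su"
    by (simp add: su_def Theta_re_def dagger_scaleR dagger_diff adjugate_scaleR adjugate_diff a da scaleR_diff_right)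
  show "Theta_im u \<eta> \<in> su"
    unfolding Theta_im_def
  proof (rule su_scale)
    have "dagger (?Y + dagger ?Y) = ?Y + dagger ?Y" "adjugate (?Y + dagger ?Y) = - (?Y + dagger ?Y)"
      by (simp_all add: dagger_add adjugate_add a da add.commute)
    then show "itimes (?Y + dagger ?Y) \<in> su"
      by (simp only: su_def mem_Collect_eq dagger_itimes adjugate_itimes itimes_minus simp_thms)
  qed
  have "itimes (Theta_im u \<eta>) = (1/2) *\<^sub>R (?Y + dagger ?Y)"
    by (simp only: Theta_im_def itimes_scaleR itimes_itimes itimes_minus scaleR_minus_right scaleR_minus_left
        minus_divide_left[symmetric] minus_minus)
  then have "Theta_re u \<eta> + itimes (Theta_im u \<eta>) = (1/2) *\<^sub>R (?Y + ?Y)"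
    unfolding Theta_re_def by (simp only: scaleR_add_right[symmetric]) (simp add: algebra_simps)
  then show "?Y = Theta_re u \<eta> + itimes (Theta_im u \<eta>)" by (simp only: scaleR_half_double)
qed

text \<open>A complex vector of the polarization is determined by its vertical part, which is arbitrary.
  This is the reason why the rank is right everywhere, although \<open>Phi\<close> need not be an immersion.\<close>

definition graph :: "cmat2 \<Rightarrow> cmat2 \<Rightarrow> cmat2 \<Rightarrow> cmat2 \<Rightarrow> (cmat2 \<times> cmat2) \<times> (cmat2 \<times> cmat2)" where
  "graph p u \<eta>1 \<eta>2 = (tang p u (- Theta_re u \<eta>1 - Theta_im u \<eta>2) \<eta>1, tang p u (Theta_im u \<eta>1 - Theta_re u \<eta>2) \<eta>2)"

lemma polar_eq_graph:
  assumes p: "p \<in> SU2" and u: "u \<in> su"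
  shows "polar (p, p ** u) = (\<lambda>(\<eta>1, \<eta>2). graph p u \<eta>1 \<eta>2) ` (su \<times> su)"
proof -
  have X: "(p, p ** u) \<in> tangent_bundle SU2" using p u by (simp add: tangent_bundle_SU2_iff SU2_cancel)
  have T: "tangent_space (tangent_bundle SU2) (p, p ** u) = (\<lambda>(\<xi>, \<eta>). tang p u \<xi> \<eta>) ` (su \<times> su)"
    using tangent_space_TSU2_tang[OF X] p by (simp add: SU2_cancel)
  have cond: "FD Phi (p, p ** u) (tang p u \<xi>1 \<eta>1) = itimes (FD Phi (p, p ** u) (tang p u \<xi>2 \<eta>2)) \<longleftrightarrow>
      \<xi>1 = - Theta_re u \<eta>1 - Theta_im u \<eta>2 \<and> \<xi>2 = Theta_im u \<eta>1 - Theta_re u \<eta>2"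
    if su: "\<xi>1 \<in> su" "\<eta>1 \<in> su" "\<xi>2 \<in> su" "\<eta>2 \<in> su" for \<xi>1 \<eta>1 \<xi>2 \<eta>2
  proof -
    have F: "FD Phi (p, p ** u) (tang p u \<xi> \<eta>) = p ** ((\<xi> + Theta u \<eta>) ** Psi u)" if "\<xi> \<in> su" for \<xi> \<eta>
      unfolding FD_Phi[OF p that]
      by (simp add: Theta_def mm.add_left matrix_mul_assoc[symmetric] Psi_unit[OF u])
    have cancel: "p ** (a ** Psi u) = p ** (b ** Psi u) \<longleftrightarrow> a = b" for a b
    proof
      assume "p ** (a ** Psi u) = p ** (b ** Psi u)"
      then have "dagger p ** (p ** (a ** Psi u)) ** adjugate (Psi u) = dagger p ** (p ** (b ** Psi u)) ** adjugate (Psi u)"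
        by simp
      then show "a = b" using p by (simp add: SU2_cancel matrix_mul_assoc[symmetric] Psi_unit[OF u])
    qed simp
    have mv: "itimes (p ** (a ** b)) = p ** (itimes a ** b)" for a b by (simp add: itimes_mult)
    let ?a = "\<xi>1 + Theta_re u \<eta>1 + Theta_im u \<eta>2" and ?b = "Theta_im u \<eta>1 - \<xi>2 - Theta_re u \<eta>2"
    have "FD Phi (p, p ** u) (tang p u \<xi>1 \<eta>1) = itimes (FD Phi (p, p ** u) (tang p u \<xi>2 \<eta>2)) \<longleftrightarrow>
        \<xi>1 + Theta u \<eta>1 = itimes (\<xi>2 + Theta u \<eta>2)"
      unfolding F[OF su(1)] F[OF su(3)] by (simp only: mv cancel)
    also have "\<dots> \<longleftrightarrow> ?a + itimes ?b = 0"
    proof -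
      have "\<xi>1 + Theta u \<eta>1 - itimes (\<xi>2 + Theta u \<eta>2) = ?a + itimes ?b"
        unfolding Theta_parts(3)[OF u su(2)] Theta_parts(3)[OF u su(4)]
        by (simp add: itimes_add itimes_diff)
      then show ?thesis by (simp only: eq_iff_diff_eq_0[of "\<xi>1 + Theta u \<eta>1"])
    qed
    also have "\<dots> \<longleftrightarrow> ?a = 0 \<and> ?b = 0"
      using su_complex_independent[of ?a ?b] Theta_parts[OF u su(2)] Theta_parts[OF u su(4)] su
      by (auto simp: su_add su_diff itimes_zero)
    also have "\<dots> \<longleftrightarrow> \<xi>1 = - Theta_re u \<eta>1 - Theta_im u \<eta>2 \<and> \<xi>2 = Theta_im u \<eta>1 - Theta_re u \<eta>2"
      by (auto simp: algebra_simps eq_neg_iff_add_eq_0)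
    finally show ?thesis .
  qed
  have T_I: "tang p u \<xi> \<eta> \<in> tangent_space (tangent_bundle SU2) (p, p ** u)" if "\<xi> \<in> su" "\<eta> \<in> su" for \<xi> \<eta>
    unfolding T by (rule image_eqI[where x = "(\<xi>, \<eta>)"]) (use that in auto)
  have T_E: "\<exists>\<xi>\<in>su. \<exists>\<eta>\<in>su. h = tang p u \<xi> \<eta>"
    if "h \<in> tangent_space (tangent_bundle SU2) (p, p ** u)" for h
    using that unfolding T by fast
  show ?thesis
  proof (rule set_eqI, rule iffI)
    fix w assume "w \<in> (\<lambda>(\<eta>1, \<eta>2). graph p u \<eta>1 \<eta>2) ` (su \<times> su)"
    then obtain \<eta>1 \<eta>2 where \<eta>: "\<eta>1 \<in> su" "\<eta>2 \<in> su" "w = graph p u \<eta>1 \<eta>2" by fast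
    have \<xi>: "- Theta_re u \<eta>1 - Theta_im u \<eta>2 \<in> su" "Theta_im u \<eta>1 - Theta_re u \<eta>2 \<in> su"
      using Theta_parts(1,2)[OF u] \<eta> by (auto intro: su_diff su_neg)
    show "w \<in> polar (p, p ** u)"
      unfolding polar_def complex_tangent_space_def \<eta>(3) graph_def mem_Collect_eq mem_Times_iff fst_conv snd_conv
      using cond[OF \<xi>(1) \<eta>(1) \<xi>(2) \<eta>(2)] T_I[OF \<xi>(1) \<eta>(1)] T_I[OF \<xi>(2) \<eta>(2)] by blast
  next
    fix w assume w: "w \<in> polar (p, p ** u)"
    then have "fst w \<in> tangent_space (tangent_bundle SU2) (p, p ** u)" "snd w \<in> tangent_space (tangent_bundle SU2) (p, p ** u)"
      and F: "FD Phi (p, p ** u) (fst w) = itimes (FD Phi (p, p ** u) (snd w))"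
      by (auto simp: polar_def complex_tangent_space_def)
    then obtain \<xi>1 \<eta>1 \<xi>2 \<eta>2 where su: "\<xi>1 \<in> su" "\<eta>1 \<in> su" "\<xi>2 \<in> su" "\<eta>2 \<in> su"
      and fs: "fst w = tang p u \<xi>1 \<eta>1" "snd w = tang p u \<xi>2 \<eta>2" by (meson T_E)
    have "w = graph p u \<eta>1 \<eta>2"
      using cond[OF su] F fs unfolding graph_def by (simp add: prod_eq_iff[of w])
    then show "w \<in> (\<lambda>(\<eta>1, \<eta>2). graph p u \<eta>1 \<eta>2) ` (su \<times> su)"
      using su by (intro image_eqI[where x = "(\<eta>1, \<eta>2)"]) auto
  qed
qed

definition basis :: "nat \<Rightarrow> cmat2" where
  "basis j = (if j = 0 then e1 else if j = 1 then e2 else e3)"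

lemma basis_su: "basis j \<in> su"
  using e_su by (simp add: basis_def)

lemma sum_basis: "(\<Sum>j<3. f j *\<^sub>R basis j) = f 0 *\<^sub>R e1 + f 1 *\<^sub>R e2 + f 2 *\<^sub>R e3"
  by (simp add: basis_def numeral_3_eq_3 eval_nat_numeral)

lemma sum_basis_eq_0: "(\<Sum>j<3. f j *\<^sub>R basis j) = 0 \<Longrightarrow> j < 3 \<Longrightarrow> f j = 0"
proof -
  assume s: "(\<Sum>j<3. f j *\<^sub>R basis j) = 0" and j: "j < 3"
  have "(f 0 *\<^sub>R e1 + f 1 *\<^sub>R e2 + f 2 *\<^sub>R e3) \<bullet> e = 0" for e using s by (simp add: sum_basis)
  from this[of e1] this[of e2] this[of e3] have "f 0 = 0" "f 1 = 0" "f 2 = 0"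
    by (simp_all add: inner_add_left e_inner)
  moreover have "j = 0 \<or> j = 1 \<or> j = 2" using j by auto
  ultimately show "f j = 0" by auto
qed

definition frame :: "nat \<Rightarrow> cmat2 \<times> cmat2 \<Rightarrow> (cmat2 \<times> cmat2) \<times> (cmat2 \<times> cmat2)" where
  "frame j q = graph (fst q) (dagger (fst q) ** snd q) (basis j) 0"

lemma cscale_graph: "cscale z (graph p u \<eta> 0) = graph p u (Re z *\<^sub>R \<eta>) (Im z *\<^sub>R \<eta>)"
  by (simp add: cscale_def graph_def tang_scale tang_add tang_diff linear_0[OF linear_Theta(2)]
      linear_0[OF linear_Theta(3)] linear_cmul[OF linear_Theta(2)] linear_cmul[OF linear_Theta(3)])

lemma graph_add: "graph p u \<eta>1 \<eta>2 + graph p u \<eta>1' \<eta>2' = graph p u (\<eta>1 + \<eta>1') (\<eta>2 + \<eta>2')"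
  by (simp add: graph_def tang_add linear_add[OF linear_Theta(2)] linear_add[OF linear_Theta(3)] algebra_simps)

lemma graph_zero: "graph p u 0 0 = 0"
  by (simp add: graph_def tang_def linear_0[OF linear_Theta(2)] linear_0[OF linear_Theta(3)]
      mm.zero_left mm.zero_right zero_prod_def)

lemma sum_frame:
  "(\<Sum>j<n. cscale (z j) (frame j q)) = graph (fst q) (dagger (fst q) ** snd q)
     (\<Sum>j<n. Re (z j) *\<^sub>R basis j) (\<Sum>j<n. Im (z j) *\<^sub>R basis j)"
  by (induction n) (simp_all add: frame_def cscale_graph graph_add graph_zero)

lemma smooth_frame: "smooth_on UNIV (frame j)"
proof -
  let ?u = "\<lambda>q :: cmat2 \<times> cmat2. dagger (fst q) ** snd q"
  note comp = smooth_on_compose[OF open_UNIV open_UNIV subset_UNIV]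
  have dP: "smooth_on UNIV (\<lambda>u. dPsi u (basis j))"
    using smooth_on_FD[OF smooth_Psi, of "basis j"] FD_eq[OF Psi_has_derivative] by simp
  have Th: "smooth_on UNIV (\<lambda>u. Theta u (basis j))" unfolding Theta_def
    by (rule smooth_on_bilinear[OF bounded_bilinear_mat_mult open_UNIV dP
          smooth_on_linear[OF bounded_linear_adjugate open_UNIV smooth_Psi]])
  have bl: "bounded_linear (\<lambda>Y. - ((1/2) *\<^sub>R (Y - dagger Y)))" "bounded_linear (\<lambda>Y. (- 1/2) *\<^sub>R itimes (Y + dagger Y))"
    unfolding linear_conv_bounded_linear[symmetric]
    by (auto intro!: linearI simp: dagger_add dagger_scaleR itimes_add itimes_scaleR algebra_simps)
  have re: "smooth_on UNIV (\<lambda>q. - Theta_re (?u q) (basis j))"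
    using comp[OF smooth_left_translate smooth_on_linear[OF bl(1) open_UNIV Th]] by (simp add: Theta_re_def)
  have im: "smooth_on UNIV (\<lambda>q. Theta_im (?u q) (basis j))"
    using comp[OF smooth_left_translate smooth_on_linear[OF bl(2) open_UNIV Th]] by (simp add: Theta_im_def)
  have tang: "smooth_on UNIV (\<lambda>q. tang (fst q) (?u q) (k q) \<eta>)" if "smooth_on UNIV k" for k \<eta>
    unfolding tang_def
    by (intro smooth_on_Pair smooth_on_bilinear[OF bounded_bilinear_mat_mult] smooth_on_add smooth_on_const
        smooth_fst smooth_left_translate that open_UNIV)
  show ?thesis
    using smooth_on_Pair[OF open_UNIV tang[OF re, of "basis j"] tang[OF im, of 0]]
    by (simp add: frame_def[abs_def] graph_def linear_0[OF linear_Theta(2)] linear_0[OF linear_Theta(3)])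
qed

lemma polar_fst_snd:
  assumes q: "q \<in> tangent_bundle SU2"
  shows "polar q = (\<lambda>(\<eta>1, \<eta>2). graph (fst q) (dagger (fst q) ** snd q) \<eta>1 \<eta>2) ` (su \<times> su)"
proof -
  obtain p v where qv: "q = (p, v)" by (metis surj_pair)
  have p: "p \<in> SU2" "dagger p ** v \<in> su" using q qv by (auto simp: tangent_bundle_SU2_iff)
  then show ?thesis using polar_eq_graph[OF p] qv by (simp add: SU2_cancel)
qed

lemma complex_subbundle_polar: "complex_subbundle (tangent_bundle SU2) 3 polar"
  unfolding complex_subbundle_def
proof (intro conjI ballI)
  fix q assume "q \<in> tangent_bundle SU2"
  show "polar q \<subseteq> complex_tangent_space (tangent_bundle SU2) q" by (auto simp: polar_def)
next
  fix p assume "p \<in> tangent_bundle SU2"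
  have sect: "local_section (UNIV \<inter> tangent_bundle SU2) polar (frame j)" for j
    unfolding local_section_def
  proof (intro conjI ballI smooth_mapI[OF smooth_frame])
    fix q assume "q \<in> UNIV \<inter> tangent_bundle SU2"
    then show "frame j q \<in> polar q"
      using polar_fst_snd[of q] basis_su[of j] su_zero unfolding frame_def by auto
  qed
  have range: "polar q = range (\<lambda>z :: nat \<Rightarrow> complex. \<Sum>j<3. cscale (z j) (frame j q))"
    if q: "q \<in> tangent_bundle SU2" for q
  proof -
    let ?G = "graph (fst q) (dagger (fst q) ** snd q)"
    have "?G \<eta>1 \<eta>2 \<in> range (\<lambda>z :: nat \<Rightarrow> complex. \<Sum>j<3. cscale (z j) (frame j q))"
      if "\<eta>1 \<in> su" "\<eta>2 \<in> su" for \<eta>1 \<eta>2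
    proof -
      define z where "z = (\<lambda>j. Complex ((\<eta>1 \<bullet> basis j) / 2) ((\<eta>2 \<bullet> basis j) / 2))"
      have "(\<Sum>j<3. ((\<eta> \<bullet> basis j) / 2) *\<^sub>R basis j) = \<eta>" if "\<eta> \<in> su" for \<eta>
        using expansion[OF that] unfolding sum_basis by (simp add: basis_def)
      then have "?G \<eta>1 \<eta>2 = (\<Sum>j<3. cscale (z j) (frame j q))"
        unfolding sum_frame using that by (simp add: z_def)
      then show ?thesis by blast
    qed
    moreover have "(\<Sum>j<3. cscale (z j) (frame j q)) \<in> (\<lambda>(\<eta>1, \<eta>2). ?G \<eta>1 \<eta>2) ` (su \<times> su)" for z
      unfolding sum_frame
      by (rule image_eqI[where x = "(\<Sum>j<3. Re (z j) *\<^sub>R basis j, \<Sum>j<3. Im (z j) *\<^sub>R basis j)"])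
        (auto intro!: su_sum su_scale basis_su)
    ultimately show ?thesis unfolding polar_fst_snd[OF q] by auto
  qed
  have indep: "z j = 0" if q: "q \<in> tangent_bundle SU2" and s: "(\<Sum>j<3. cscale (z j) (frame j q)) = 0" and j: "j < 3"
    for q and z :: "nat \<Rightarrow> complex" and j
  proof -
    have p: "fst q \<in> SU2" using q by (auto simp: tangent_bundle_def)
    note zero = s[unfolded sum_frame graph_def]
    have "(\<Sum>j<3. Re (z j) *\<^sub>R basis j) = 0"
      by (rule tang_eq_0(2)[OF p]) (rule arg_cong[OF zero, of fst, unfolded fst_conv fst_zero])
    moreover have "(\<Sum>j<3. Im (z j) *\<^sub>R basis j) = 0"
      by (rule tang_eq_0(2)[OF p]) (rule arg_cong[OF zero, of snd, unfolded snd_conv snd_zero])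
    ultimately have "(\<Sum>j<3. Re (z j) *\<^sub>R basis j) = 0" "(\<Sum>j<3. Im (z j) *\<^sub>R basis j) = 0" by auto
    then show ?thesis
      using sum_basis_eq_0[of "\<lambda>j. Re (z j)" j] sum_basis_eq_0[of "\<lambda>j. Im (z j)" j] j
      by (simp add: complex_eq_iff)
  qed
  show "\<exists>U E. open U \<and> p \<in> U \<and> (\<forall>j<3. local_section (U \<inter> tangent_bundle SU2) polar (E j)) \<and>
      (\<forall>q\<in>U \<inter> tangent_bundle SU2. polar q = range (\<lambda>z :: nat \<Rightarrow> complex. \<Sum>j<3. cscale (z j) (E j q)) \<and>
        (\<forall>z :: nat \<Rightarrow> complex. (\<Sum>j<3. cscale (z j) (E j q)) = 0 \<longrightarrow> (\<forall>j<3. z j = 0)))"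
    using sect range indep by (intro exI[of _ UNIV] exI[of _ frame]) auto
qed

lemma involutive_polar: "involutive (tangent_bundle SU2) polar"
  unfolding involutive_def
proof (intro allI impI ballI, elim conjE)
  let ?X = "tangent_bundle SU2"
  fix U V W q
  assume U: "open U" and V: "local_section (U \<inter> ?X) polar V" and W: "local_section (U \<inter> ?X) polar W"
    and q: "q \<in> U \<inter> ?X"
  have sm: "smooth_map (U \<inter> ?X) V" "smooth_map (U \<inter> ?X) W" using V W by (auto simp: local_section_def)
  have tan: "fst (V q) \<in> tangent_space ?X q" "snd (V q) \<in> tangent_space ?X q"
      "fst (W q) \<in> tangent_space ?X q" "snd (W q) \<in> tangent_space ?X q"
    and P: "FD Phi q (fst (V q)) = itimes (FD Phi q (snd (V q)))" "FD Phi q (fst (W q)) = itimes (FD Phi q (snd (W q)))"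
    if "q \<in> U \<inter> ?X" for q
    using V W that by (auto simp: local_section_def polar_def complex_tangent_space_def mem_Times_iff)
  have s: "smooth_map (U \<inter> ?X) (fst \<circ> V)" "smooth_map (U \<inter> ?X) (snd \<circ> V)"
    "smooth_map (U \<inter> ?X) (fst \<circ> W)" "smooth_map (U \<inter> ?X) (snd \<circ> W)"
    using smooth_map_linear[OF bounded_linear_fst sm(1)] smooth_map_linear[OF bounded_linear_snd sm(1)]
      smooth_map_linear[OF bounded_linear_fst sm(2)] smooth_map_linear[OF bounded_linear_snd sm(2)]
    by (simp_all add: o_def)
  have br: "lie_bracket (U \<inter> ?X) A C q \<in> tangent_space ?X q"
    if "A \<in> {fst \<circ> V, snd \<circ> V}" "C \<in> {fst \<circ> W, snd \<circ> W}" for A C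
    by (rule lie_bracket_tangent_TSU2[OF _ _ U q]) (use that s tan in auto)
  have sub: "subspace (tangent_space ?X q)"
  proof -
    obtain p v where qv: "q = (p, v)" by (metis surj_pair)
    have "linear (\<lambda>(\<xi>, \<eta>). tang p (dagger p ** v) \<xi> \<eta>)" by (auto intro!: linearI simp: tang_add tang_scale)
    moreover have "subspace (su \<times> su)" by (intro subspace_Times subspace_su)
    ultimately show ?thesis using tangent_space_TSU2_tang[of p v] q qv linear_subspace_image by force
  qed
  have "complex_lie_bracket (U \<inter> ?X) V W q \<in> complex_tangent_space ?X q"
    unfolding complex_lie_bracket_def complex_tangent_space_def Let_def
    using br by (auto intro!: subspace_diff[OF sub] subspace_add[OF sub])
  moreover have "FD Phi q (fst (complex_lie_bracket (U \<inter> ?X) V W q)) = itimes (FD Phi q (snd (complex_lie_bracket (U \<inter> ?X) V W q)))"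
    by (rule pullback_polarization_bracket[OF smooth_Phi sm U q tan[OF q] P])
  ultimately show "complex_lie_bracket (U \<inter> ?X) V W q \<in> polar q" by (simp add: polar_def)
qed

lemma polarization_polar: "polarization (tangent_bundle SU2) polar"
  unfolding polarization_def
  by (intro conjI exI[of _ 3] ballI complex_subbundle_polar involutive_polar dim_tangent_space_TSU2)

text \<open>In the left trivialization, the derivatives of \<open>Omega c\<close> in the real and in the imaginary
  direction are \<open>(x, s x')\<close> and \<open>(0, x)\<close> at \<open>u = s x\<close>. Applied to them, the differential of \<open>Phi\<close> gives
  the two sides of \<open>Psi_cauchy_riemann\<close>.\<close>

lemma Omega_polar:
  assumes c: "geodesic SU2 g I c" and z: "Re z \<in> I" and w: "w \<in> T10"
  shows "complexify (frechet_derivative (Omega c) (at z)) w \<in> polar (Omega c z)"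
proof -
  obtain x where I: "open I" and cS: "\<And>t. t \<in> I \<Longrightarrow> c t \<in> SU2" and xsu: "\<And>t. t \<in> I \<Longrightarrow> x t \<in> su"
    and dc: "\<And>t. t \<in> I \<Longrightarrow> (c has_vector_derivative c t ** x t) (at t)"
    and dx: "\<And>t. t \<in> I \<Longrightarrow> (x has_vector_derivative - B (x t) (x t)) (at t)"
    using c unfolding geodesic_iff_euler by blast
  let ?p = "c (Re z)" and ?x = "x (Re z)" and ?s = "Im z"
  let ?u = "?s *\<^sub>R ?x" and ?x' = "\<beta> ?x *\<^sub>R bracket e3 ?x"
  have p: "?p \<in> SU2" and x: "?x \<in> su" using cS xsu z by auto
  have x'su: "?x' \<in> su" by (intro su_scale bracket_su e_su x)
  have u: "?u \<in> su" by (intro su_scale x)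
  have Om: "Omega c y = (c (Re y), Im y *\<^sub>R (c (Re y) ** x (Re y)))" if "Re y \<in> I" for y
    using vector_derivative_at[OF dc[OF that]] by (simp add: Omega_def)
  have "((\<lambda>y. c (Re y)) has_derivative (\<lambda>h. Re h *\<^sub>R (?p ** ?x))) (at z)"
    using has_derivative_compose[of Re Re z UNIV c "\<lambda>h. h *\<^sub>R (?p ** ?x)"] dc[OF z]
      bounded_linear_imp_has_derivative[OF bounded_linear_Re]
    by (simp add: has_vector_derivative_def)
  moreover have "((\<lambda>y. x (Re y)) has_derivative (\<lambda>h. Re h *\<^sub>R ?x')) (at z)"
    using has_derivative_compose[of Re Re z UNIV x "\<lambda>h. h *\<^sub>R ?x'"] dx[OF z, unfolded euler_special[OF x]]
      bounded_linear_imp_has_derivative[OF bounded_linear_Re]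
    by (simp add: has_vector_derivative_def)
  moreover have "(Im has_derivative Im) (at z)" by (rule bounded_linear_imp_has_derivative[OF bounded_linear_Im])
  ultimately have "((\<lambda>y. (c (Re y), Im y *\<^sub>R (c (Re y) ** x (Re y)))) has_derivative
      (\<lambda>h. (Re h *\<^sub>R (?p ** ?x), ?s *\<^sub>R (?p ** (Re h *\<^sub>R ?x') + (Re h *\<^sub>R (?p ** ?x)) ** ?x) + Im h *\<^sub>R (?p ** ?x)))) (at z)"
    by (intro has_derivative_Pair bounded_bilinear.FDERIV[OF bounded_bilinear_scaleR]
        bounded_bilinear.FDERIV[OF bounded_bilinear_mat_mult])
  moreover have "open (Re -` I)" by (rule open_vimage[OF I continuous_on_Re[OF continuous_on_id]])
  ultimately have der: "(Omega c has_derivative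
      (\<lambda>h. (Re h *\<^sub>R (?p ** ?x), ?s *\<^sub>R (?p ** (Re h *\<^sub>R ?x') + (Re h *\<^sub>R (?p ** ?x)) ** ?x) + Im h *\<^sub>R (?p ** ?x)))) (at z)"
    by (rule has_derivative_transform_within_open) (use z Om in auto)
  have "(Re h *\<^sub>R (?p ** ?x), ?s *\<^sub>R (?p ** (Re h *\<^sub>R ?x') + (Re h *\<^sub>R (?p ** ?x)) ** ?x) + Im h *\<^sub>R (?p ** ?x))
      = tang ?p ?u (Re h *\<^sub>R ?x) (Im h *\<^sub>R ?x + (?s * Re h) *\<^sub>R ?x')" for h
    by (simp add: tang_def mm_simps algebra_simps)
  then have D: "frechet_derivative (Omega c) (at z) h = tang ?p ?u (Re h *\<^sub>R ?x) (Im h *\<^sub>R ?x + (?s * Re h) *\<^sub>R ?x')" for h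
    unfolding FD_eq[OF der] .
  obtain a b where ab: "w = (a, b)" by (cases w)
  have "\<i> * a = - b" using w by (simp add: ab T10_def complexify_def cscale_def)
  then have b: "b = - \<i> * a" by simp
  have Omz: "Omega c z = (?p, ?p ** ?u)" using Om[OF z] by (simp add: mm.scaleR_right)
  define M where "M = ?x ** Psi ?u + ?s *\<^sub>R dPsi ?u ?x'"
  have cr: "dPsi ?u ?x = itimes M" unfolding M_def by (rule Psi_cauchy_riemann[OF x])
  have F: "FD Phi (?p, ?p ** ?u) (frechet_derivative (Omega c) (at z) h) = ?p ** (Re h *\<^sub>R M + Im h *\<^sub>R itimes M)" for h
    unfolding D FD_Phi[OF p su_scale[OF x]] linear_add[OF linear_dPsi] linear_cmul[OF linear_dPsi] cr[symmetric]
    by (simp add: M_def mm.scaleR_left scaleR_add_right algebra_simps linear_cmul[OF linear_dPsi])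
  have T: "frechet_derivative (Omega c) (at z) h \<in> tangent_space (tangent_bundle SU2) (?p, ?p ** ?u)" for h
  proof -
    have "(?p, ?p ** ?u) \<in> tangent_bundle SU2" using p u by (simp add: tangent_bundle_SU2_iff SU2_cancel)
    from tangent_space_TSU2_tang[OF this]
    have "tangent_space (tangent_bundle SU2) (?p, ?p ** ?u) = (\<lambda>(\<xi>, \<eta>). tang ?p ?u \<xi> \<eta>) ` (su \<times> su)"
      using p by (simp add: SU2_cancel)
    moreover have "(Re h *\<^sub>R ?x, Im h *\<^sub>R ?x + (?s * Re h) *\<^sub>R ?x') \<in> su \<times> su"
      by (intro SigmaI su_add su_scale x x'su)
    ultimately show ?thesis unfolding D by (auto intro: rev_image_eqI)
  qed
  have "FD Phi (?p, ?p ** ?u) (frechet_derivative (Omega c) (at z) a)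
      = itimes (FD Phi (?p, ?p ** ?u) (frechet_derivative (Omega c) (at z) b))"
    unfolding F by (simp add: b itimes_mult(2)[symmetric] itimes_add itimes_scaleR itimes_minus itimes_diff add.commute)
  then show ?thesis
    unfolding polar_def complex_tangent_space_def complexify_def ab Omz using T by simp
qed

lemma special_metric_P_complete: "P_complete SU2 g"
  unfolding P_complete_def ac_polarization_def
  using polarization_polar Omega_polar
  by (intro exI[of _ polar]) (auto simp: maximal_geodesic_def geodesic_from_def)

end

lemma special_P_complete:
  assumes d: "diagonal_metric e1 e2 e3 l1 l2 l3 g" and "l1 = l2 \<or> l2 = l3"
  shows "P_complete SU2 g"
  using assms(2)
proof
  assume "l1 = l2"
  then interpret special_metric e1 e2 e3 l1 l3 g using d by (simp add: special_metric_def)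
  show ?thesis by (rule special_metric_P_complete)
next
  assume "l2 = l3"
  then interpret special_metric e2 e3 e1 l2 l1 g
    using diagonal_metric.rotate_metric[OF d] by (simp add: special_metric_def)
  show ?thesis by (rule special_metric_P_complete)
qed

theorem theorem7p12:
  fixes g k :: "cmat2 \<Rightarrow> cmat2 \<Rightarrow> cmat2 \<Rightarrow> real"
    and A :: "cmat2 \<Rightarrow> cmat2"
    and l1 l2 l3 :: real
  assumes "pseudo_riemannian SU2 g" and "left_invariant g"
    and "riemannian SU2 k" and "left_invariant k" and "right_invariant k"
    and "constant_sectional_curvature SU2 k 1"
    and "self_adjoint_on_su2 (k (mat 1)) A"
    and "\<forall>x\<in>su2. \<forall>y\<in>su2. g (mat 1) x y = k (mat 1) (A x) y"
    and "l1 \<le> l2" and "l2 \<le> l3" and "eigenvalue_list_su2 A [l1, l2, l3]"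
  shows "(generic_eigenvalues l1 l2 l3 \<longrightarrow> \<not> C_complete g) \<and>
         (special_eigenvalues l1 l2 l3 \<longrightarrow> P_complete SU2 g)"
proof -
  obtain e1 e2 e3 m1 m2 m3 where "diagonal_metric e1 e2 e3 m1 m2 m3 g"
    "generic_eigenvalues l1 l2 l3 \<longrightarrow> m1 < m2 \<and> m2 < m3"
    "special_eigenvalues l1 l2 l3 \<longrightarrow> m1 = m2 \<or> m2 = m3"
    using left_invariant_metric_diagonal[OF assms(1-5,7-11)] by blast
  then show ?thesis using generic_not_C_complete special_P_complete by blast
qed

end
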